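(* Consider the system $$\dot I_1=\varepsilon^{q_1}[A_1(\xi,\varepsilon)I_1+\varepsilon^{q_2}g_1],\quad \dot I_2=\varepsilon^{q_3}[A_2(\xi,\varepsilon)I_2+\varepsilon^{q_4}g_2],\quad \dot\varphi_1=\varepsilon^{q_5}[\omega_1(\xi,\varepsilon)+\varepsilon^{q_6}g_3],\quad \dot\varphi_2=\omega_2(\xi,\varepsilon)+\varepsilon^{q_7}g_4,$$ $g_j=g_j(I,\varphi;\xi,\varepsilon)$, satisfying assumptions (H1), (H2), (H3) stated in the context, and let $\Pi_\gamma$ be the Cantor set described in the context. Assume moreover that $n_3+n_3^2+\cdots+n_3^\alpha\ge n_2$ and, with $\widetilde\omega,\widetilde\omega_0,\widetilde\Lambda_2,K^*$ as in the context: (i) for all $\xi\in\Pi$, $${\rm rank}\Big(\widetilde\omega,\frac{\partial^{|\beta|_1}\widetilde\omega}{\partial\xi^\beta}:1\le|\beta|_1\le\alpha\Big)=n_2\ \text{ in the case } n_{22}=0,\qquad {\rm rank}\Big(\frac{\partial^{|\beta|_1}\widetilde\omega}{\partial\xi^\beta}:1\le|\beta|_1\le\alpha\Big)=n_2\ \text{ in the case } n_{22}\ne0;$$ (ii)' there is a constant $c_3>0$ such that the functions $$f_{km}(\xi)=\langle k,\widetilde\omega_0+\varepsilon^{q_5}\widetilde\omega(\xi)\rangle+\varepsilon^{q_3}\langle m,{\rm Im}\,\widetilde\Lambda_2(\xi)\rangle$$ satisfy $$\max_{1\le\mu\le\alpha}\|D^\mu f_{km}(\xi)\|\ge c_3\varepsilon^{q_5}$$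 for all $\xi\in\Pi$, all $k\in\mathbb{Z}^{n_2}$ with $0<|k|_2<K^*$ and all $m=(m_1,\dots,m_{n_{12}})\in\mathbb{Z}^{n_{12}}$ with $1\le|m|_1\le2$ and $m_1+\cdots+m_{n_{12}}=0$ or $-1$. Then ${\rm meas}\,\Pi_\gamma={\rm meas}\,\Pi-O(\gamma^{1/\alpha})$ for sufficiently small $\gamma$.
   Context: Setting. $I={\rm col}(I_1,I_2)\in\Omega=\Omega_1\times\Omega_2\subset\mathbb{R}^{n_{11}}\times\mathbb{R}^{n_{12}}=\mathbb{R}^{n_1}$ with $\Omega_1,\Omega_2$ convex open neighbourhoods of the origin; $\varphi={\rm col}(\varphi_1,\varphi_2)\in\mathbb{T}^{n_{21}}\times\mathbb{T}^{n_{22}}=\mathbb{T}^{n_2}$; $\xi\in\Pi\subset\mathbb{R}^{n_3}$, $\Pi$ a convex bounded open set of positive Lebesgue measure; $\varepsilon>0$ a small parameter. $|x|$ is the maximum norm, $|x|_p$ the $p$-norm, $[x]$ the integer part; a diagonal matrix is also regarded as the column vector of its diagonal entries; ${\rm Im}$ is the imaginary part. For functions of $\xi$, $\|f\|_{\alpha;\Pi}$ is the supremum over $\Pi$ of all $|\partial_\xi^\beta f|$, $|\beta|_1\le\alpha$ (on closed sets, functions are assumed differentiable in a neighbourhood). For a scalar function $h(\xi)$, $D^\mu h(\xi)$ is its $\mu$-th differential and $\|D^\mu h(\xi)\|=\max_{a\in\mathbb{R}^{n_3},|a|_2=1}|D^\mu h(\xi)(a,\dots,a)|$. $C^{l,\alpha}(\Omega\times\mathbb{T}^{n_2},\Pi)$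 is the class of $f$ such that for some $M$ and all $|\beta|_1\le\alpha$: $|D^k\partial_\xi^\beta f|\le M$ for $|k|_1\le[l]$, and $D^k\partial^\beta_\xi f$ with $|k|_1=[l]$ is Hölder continuous in $x=(I,\varphi)$ with exponent $l-[l]$ and constant $M$, uniformly in $\xi$ ($D^k$ = derivatives in $x$); the norm is the smallest $M$. (H1) $q_1,\dots,q_7\ge0$, $q_1>q_3\ge q_5$, $q_7\ge q_2+q_5$, $0<q_2\le\min\{q_4,q_6\}$. (H2) $\omega_i,A_i\in C^\alpha(\Pi)$ with a positive integer $\alpha$, $A_i=B_i\Lambda_iB_i^{-1}$ with $\Lambda_i$ diagonal ($i=1,2$); $\omega={\rm col}(\varepsilon^{q_5}\omega_1,\omega_2)$, $\Lambda_1={\rm diag}(\lambda_1,\dots,\lambda_{n_{11}})$, $\Lambda_2={\rm diag}(\lambda_{n_{11}+1},\dots,\lambda_{n_1})$. There are positive $c_0,c_1,\varepsilon_*$ such that for $\varepsilon\in(0,\varepsilon_*]$: $\inf_\Pi|\lambda_j|\ge c_0$, $\inf_\Pi|\lambda_j-\lambda_i|\ge c_0$ for $i\ne j$ with $1\le i,j\le n_{11}$ or $n_{11}+1\le i,j\le n_1$; $\|B_i\|_{\alpha;\Pi},\|B_i^{-1}\|_{\alpha;\Pi},\|\Lambda_i\|_{\alpha;\Pi}\le c_1$, $\sup_\Pi|\omega_i|\le c_1$; $\sup_\Pi|\partial_\xi^\beta\omega|\le c_1\varepsilon^{q_5}$ for $1\le|\beta|_1\le\alpha$. (H3) $g_j\in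 C^{l,\alpha}(\Omega\times\mathbb{T}^{n_2},\Pi)$, $j=1,\dots,4$, with norms bounded uniformly in $\varepsilon$, $l>2(\alpha+1)(\iota+2)+\alpha\iota$, $\iota>\alpha n_2-1$. The limiting data. By (H2) one writes $\omega_2(\xi,\varepsilon)=\omega_{20}+\varepsilon^{q_5}\omega_{21}(\xi)+o(\varepsilon^{q_5})$ with $\omega_{20}$ independent of $\xi$ and the $o(\varepsilon^{q_5})$ holding for derivatives in $\xi$ up to order $\alpha$. Put $\widetilde\Lambda_2(\xi)=\Lambda_2(\xi,0)$; $\widetilde\omega(\xi)={\rm col}(\omega_1(\xi,0),\omega_{21}(\xi))$ if $n_{22}\ne0$ and $\widetilde\omega(\xi)=\omega_1(\xi,0)$ if $n_{22}=0$; $\widetilde\omega_0={\rm col}(0,\omega_{20})$. The constants $c_2$ and $K^*$. $c_2>0$ is a constant (whose existence is a consequence of (i)) such that for all $\xi\in\Pi$ and all $b\in\mathbb{R}^{n_2}$ with $|b|_2=1$: $\max_{0\le\mu\le\alpha}\|D^\mu\langle b,\widetilde\omega(\xi)\rangle\|\ge c_2$ if $n_{22}=0$, and $\max_{1\le\mu\le\alpha}\|D^\mu\langle b,\widetilde\omega(\xi)\rangle\|\ge c_2$ if $n_{22}\ne0$. Put $K^*=\frac{32c_1}{c_2}n_3^{\alpha/2}$. The Cantor set $\Pi_\gamma$. Under (H1)-(H3), for every $0<\gamma\ll1$ there is a sufficiently small $\varepsilon_0^*=o(\gamma^{(\alpha+1)/q_2})$ such that for $0<\varepsilon\le\varepsilon_0^*$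 there exist closed sets $\Pi_\nu\subset\Pi$, vectors $\omega^\nu={\rm col}(\varepsilon^{q_5}\omega_1^\nu,\omega_2^\nu)$ and diagonal matrices $\Lambda^\nu={\rm diag}(\varepsilon^{q_1}\Lambda_1^\nu,\varepsilon^{q_3}\Lambda_2^\nu)$ depending on $\xi$, $\nu\ge1$, with $\|\omega_1^\nu-\omega_1\|_{\alpha;\Pi_\nu}\le c\varepsilon^{q_6}$, $\|\omega_2^\nu-\omega_2\|_{\alpha;\Pi_\nu}\le c\varepsilon^{q_7}$, $\|\Lambda_1^\nu-\Lambda_1\|_{\alpha;\Pi_\nu}\le c\varepsilon^{q_2}$, $\|\Lambda_2^\nu-\Lambda_2\|_{\alpha;\Pi_\nu}\le c\varepsilon^{q_4}$ ($c$ independent of $\nu,\varepsilon,\gamma$), and $\Pi_\nu=\Pi_{\nu-1}\setminus\bigcup_{k,m}\mathfrak{R}^\nu_{km}(\gamma)$, the union being over $m\in\mathfrak{m}=\{m\in\mathbb{Z}^{n_1}:|m|_1\le2,\sum_jm_j=0\text{ or }-1\}$ and $k\in\mathbb{Z}^{n_2}$ with $K_{\nu-1}<|k|_2\le K_\nu$, where $\mathfrak{R}^\nu_{km}(\gamma)=\{\xi\in\Pi_{\nu-1}:|\sqrt{-1}\langle k,\omega^{\nu-1}\rangle+\langle m,\Lambda^{\nu-1}\rangle|<\gamma\varepsilon^{q_5}|k|_2^{-\iota}\}$, $\omega^0=\omega$, $\Lambda^0={\rm diag}(\varepsilon^{q_1}\Lambda_1,\varepsilon^{q_3}\Lambda_2)$,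 $K_0=0$, $K_\nu=[K'_\nu]+1$, $K'_\nu=r^{-1}3^{\nu+1}[(l+(n_2+1)(\nu+1)-\alpha)\ln3+(n_2+1)|\ln r|+\ln\widetilde C]$, $\widetilde C=24(n_2!)n_2^{n_2}e^{-n_2}$, $r$ the radius of $\Omega$, and $\Pi_0$ is a closed subset of $\Pi$ whose distance to $\partial\Pi$ is at least $\gamma$ (with ${\rm meas}(\Pi\setminus\Pi_0)=O(\gamma)$). Then $\Pi_\gamma=\bigcap_{\nu\ge0}\Pi_\nu$, and for each $\xi\in\Pi_\gamma$ the system has a quasi-periodic invariant torus $I=\Phi(\varphi;\xi)$, $\varphi\in\mathbb{T}^{n_2}$.
   Formalization: C^α(Π) is read as derivatives uniformly continuous up to the closure; ω_1, Λ_2 tend to their values at ε=0 in C^α(Π); the bounds on ω^ν−ω, Λ^ν−Λ over Π_ν hold for some C^α extension to Π, since bounds at points of Π_ν alone allow independent shifts that empty Π_γ. *)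

theory Defs
  imports "HOL-Analysis.Analysis" "HOL-Library.Landau_Symbols"
begin

section \<open>Block vectors\<close>

text \<open>
  A splitting \<open>\<real>\<^sup>n = \<real>\<^sup>a \<times> \<real>\<^sup>b\<close>, \<open>a + b = n\<close>, is a subset \<open>N\<close> of the index type of \<open>\<real>\<^sup>n\<close>:
  the coordinates in \<open>N\<close> form the first factor, those in \<open>- N\<close> the second one.  Since \<open>N\<close> may
  be empty or everything, \<open>a = 0\<close> and \<open>b = 0\<close> are both covered.
\<close>

definition col :: "'n set \<Rightarrow> 'a ^ 'n \<Rightarrow> 'a ^ 'n \<Rightarrow> 'a ^ 'n::finite" where
  "col N u v = (\<chi> i. if i \<in> N then u $ i else v $ i)"

definition block_scale :: "'n set \<Rightarrow> real \<Rightarrow> real \<Rightarrow> ('a::real_vector) ^ 'n \<Rightarrow> 'a ^ 'n::finite" where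
  "block_scale N a b v = col N (a *\<^sub>R v) (b *\<^sub>R v)"

definition same_block :: "'n set \<Rightarrow> 'n \<Rightarrow> 'n \<Rightarrow> bool" where
  "same_block N i j \<longleftrightarrow> (i \<in> N \<longleftrightarrow> j \<in> N)"

definition block_diagonal :: "'n set \<Rightarrow> ('a::zero) ^ 'n ^ 'n::finite \<Rightarrow> bool" where
  "block_diagonal N M \<longleftrightarrow> (\<forall>i j. \<not> same_block N i j \<longrightarrow> M $ i $ j = 0)"

definition diag :: "('a::zero) ^ 'n \<Rightarrow> 'a ^ 'n ^ 'n::finite" where
  "diag v = (\<chi> i j. if i = j then v $ i else 0)"

definition is_block_product :: "'n set \<Rightarrow> (real ^ 'n::finite) set \<Rightarrow> bool" where
  "is_block_product N S \<longleftrightarrow> (\<forall>u\<in>S. \<forall>v\<in>S. col N u v \<in> S)"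

text \<open>The radius of a neighbourhood of the origin: that of the largest open ball about the origin
  contained in it, for the maximum norm.\<close>

definition is_radius :: "(real ^ 'n::finite) set \<Rightarrow> real \<Rightarrow> bool" where
  "is_radius S r \<longleftrightarrow> 0 < r \<and> {x. infnorm x < r} \<subseteq> S \<and> (\<forall>\<rho>>r. \<not> {x. infnorm x < \<rho>} \<subseteq> S)"

definition real_vec :: "int ^ 'n \<Rightarrow> real ^ 'n::finite" where
  "real_vec k = (\<chi> i. real_of_int (k $ i))"

definition one_norm :: "int ^ 'n::finite \<Rightarrow> int" where
  "one_norm m = (\<Sum>i\<in>UNIV. \<bar>m $ i\<bar>)"


section \<open>Partial derivatives and classes of differentiable functions\<close>

definition dir_deriv :: "'a \<Rightarrow> ('a \<Rightarrow> 'b) \<Rightarrow> 'a::real_vector \<Rightarrow> 'b::real_normed_vector" where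
  "dir_deriv b f x = vector_derivative (\<lambda>t. f (x + t *\<^sub>R b)) (at 0)"

text \<open>
  A partial derivative of order \<open>n\<close> is given by a list of \<open>n\<close> basis vectors.  For a \<open>C\<^sup>n\<close> function
  the order in the list is immaterial, so lists of length \<open>n\<close> represent the multi-indices \<open>\<beta>\<close> with
  \<open>\<bar>\<beta>\<bar>\<^sub>1 = n\<close>.
\<close>

definition pderivs :: "'a list \<Rightarrow> ('a \<Rightarrow> 'b) \<Rightarrow> 'a::real_vector \<Rightarrow> 'b::real_normed_vector" where
  "pderivs bs f = foldr dir_deriv bs f"

definition multi_indices :: "nat set \<Rightarrow> 'a::euclidean_space list set" where
  "multi_indices L = {bs. set bs \<subseteq> Basis \<and> length bs \<in> L}"

definition has_pderivs_on ::
    "nat \<Rightarrow> 'a set \<Rightarrow> ('a::euclidean_space \<Rightarrow> 'b::real_normed_vector) \<Rightarrow> bool" where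
  "has_pderivs_on n S f \<longleftrightarrow>
     (\<forall>bs\<in>multi_indices {..<n}. \<forall>b\<in>Basis. \<forall>x\<in>S.
        (\<lambda>t. pderivs bs f (x + t *\<^sub>R b)) differentiable (at 0))"

text \<open>
  \<open>C\<^sup>n\<close> on a bounded open set \<open>S\<close>, in the sense that the derivatives up to order \<open>n\<close> extend
  continuously to the closure, i.e. are uniformly continuous on \<open>S\<close>.
\<close>

definition Ck_on :: "nat \<Rightarrow> 'a set \<Rightarrow> ('a::euclidean_space \<Rightarrow> 'b::real_normed_vector) \<Rightarrow> bool" where
  "Ck_on n S f \<longleftrightarrow> has_pderivs_on n S f \<and>
     (\<forall>bs\<in>multi_indices {..n}. uniformly_continuous_on S (pderivs bs f))"

text \<open>\<open>f \<in> C\<^sup>n(S)\<close> and \<open>\<parallel>f\<parallel> \<le> M\<close> in \<open>C\<^sup>n(S)\<close>.  Vector- and matrix-valued functions carry the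
  maximum norm, so for them this is required of every entry.\<close>

definition Ck_norm_le ::
    "nat \<Rightarrow> 'a set \<Rightarrow> ('a::euclidean_space \<Rightarrow> 'b::real_normed_vector) \<Rightarrow> real \<Rightarrow> bool" where
  "Ck_norm_le n S f M \<longleftrightarrow> Ck_on n S f \<and>
     (\<forall>bs\<in>multi_indices {..n}. \<forall>x\<in>S. norm (pderivs bs f x) \<le> M)"

text \<open>
  The same for a closed subset \<open>T\<close> of the open set \<open>S\<close>: \<open>S\<close> serves as the neighbourhood of \<open>T\<close> on
  which the function has to be differentiable, and the estimate is that of an extension to \<open>S\<close>
  (the quotient norm of the restrictions to \<open>T\<close>).  Bounding derivatives at the points of \<open>T\<close> only
  would allow independent perturbations on the components of a disconnected \<open>T\<close>.
\<close>

definition Ck_norm_le_closed ::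
    "nat \<Rightarrow> 'a set \<Rightarrow> 'a set \<Rightarrow> ('a::euclidean_space \<Rightarrow> 'b::real_normed_vector) \<Rightarrow> real \<Rightarrow> bool" where
  "Ck_norm_le_closed n S T f M \<longleftrightarrow> (\<exists>F. Ck_norm_le n S F M \<and> (\<forall>x\<in>T. F x = f x))"

text \<open>The \<open>\<mu>\<close>-th differential \<open>D\<^sup>\<mu>h(x)(a,\<dots>,a)\<close> in coordinates, and its norm.\<close>

definition differential :: "nat \<Rightarrow> ('a::euclidean_space \<Rightarrow> real) \<Rightarrow> 'a \<Rightarrow> 'a \<Rightarrow> real" where
  "differential \<mu> h x a =
     (\<Sum>bs\<in>multi_indices {\<mu>}. pderivs bs h x * prod_list (map (\<lambda>b. a \<bullet> b) bs))"

definition differential_norm :: "nat \<Rightarrow> ('a::euclidean_space \<Rightarrow> real) \<Rightarrow> 'a \<Rightarrow> real" where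
  "differential_norm \<mu> h x = (SUP a\<in>sphere 0 1. \<bar>differential \<mu> h x a\<bar>)"

text \<open>Functions on the torus \<open>\<real>\<^sup>n / 2\<pi>\<int>\<^sup>n\<close> are periodic functions on \<open>\<real>\<^sup>n\<close>.\<close>

definition periodic :: "(real ^ 'n::finite \<Rightarrow> 'b) \<Rightarrow> bool" where
  "periodic f \<longleftrightarrow> (\<forall>\<phi> i. f (\<phi> + axis i (2 * pi)) = f \<phi>)"

text \<open>Membership in \<open>C\<^sup>l\<^sup>,\<^sup>\<alpha>(\<Omega> \<times> \<T>\<^sup>n, P)\<close> with norm at most \<open>M\<close>; \<open>x = (I, \<phi>)\<close>.\<close>

definition Holder_norm_le ::
    "real \<Rightarrow> nat \<Rightarrow> (real ^ 'n1::finite) set \<Rightarrow> (real ^ 'n3::finite) set \<Rightarrow>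
     ((real ^ 'n1) \<times> (real ^ 'n2::finite) \<Rightarrow> real ^ 'n3 \<Rightarrow> real) \<Rightarrow> real \<Rightarrow> bool" where
  "Holder_norm_le l \<alpha> \<Omega> P f M \<longleftrightarrow>
     (\<forall>I\<in>\<Omega>. \<forall>\<xi>\<in>P. periodic (\<lambda>\<phi>. f (I, \<phi>) \<xi>)) \<and>
     (\<forall>x\<in>\<Omega> \<times> UNIV. has_pderivs_on \<alpha> P (f x)) \<and>
     (\<forall>bs\<in>multi_indices {..\<alpha>}. \<forall>\<xi>\<in>P.
        let h = (\<lambda>x. pderivs bs (f x) \<xi>); n = nat \<lfloor>l\<rfloor> in
        has_pderivs_on n (\<Omega> \<times> UNIV) h \<and>
        (\<forall>ks\<in>multi_indices {..n}. \<forall>x\<in>\<Omega> \<times> UNIV. \<bar>pderivs ks h x\<bar> \<le> M) \<and>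
        (\<forall>ks\<in>multi_indices {n}. \<forall>x\<in>\<Omega> \<times> UNIV. \<forall>y\<in>\<Omega> \<times> UNIV. x \<noteq> y \<longrightarrow>
           \<bar>pderivs ks h x - pderivs ks h y\<bar> \<le> M * infnorm (x - y) powr (l - of_int \<lfloor>l\<rfloor>)))"


section \<open>The multiscale system and its invariant tori\<close>

text \<open>
  \<open>A = diag(A\<^sub>1, A\<^sub>2)\<close>, \<open>\<omega> = col(\<omega>\<^sub>1, \<omega>\<^sub>2)\<close> without powers of \<open>\<epsilon>\<close>, \<open>g = col(g\<^sub>1, g\<^sub>2)\<close> and
  \<open>h = col(g\<^sub>3, g\<^sub>4)\<close>, all at a fixed parameter \<open>\<xi>\<close> and a fixed \<open>\<epsilon>\<close>.
\<close>

definition multiscale_field ::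
    "(nat \<Rightarrow> real) \<Rightarrow> 'n1 set \<Rightarrow> 'n2 set \<Rightarrow> real \<Rightarrow> real ^ 'n1 ^ 'n1 \<Rightarrow> real ^ 'n2 \<Rightarrow>
     ((real ^ 'n1::finite) \<times> (real ^ 'n2::finite) \<Rightarrow> real ^ 'n1) \<Rightarrow>
     ((real ^ 'n1) \<times> (real ^ 'n2) \<Rightarrow> real ^ 'n2) \<Rightarrow>
     (real ^ 'n1) \<times> (real ^ 'n2) \<Rightarrow> (real ^ 'n1) \<times> (real ^ 'n2)" where
  "multiscale_field q N11 N21 \<epsilon> A \<omega> g h = (\<lambda>(I, \<phi>).
     (block_scale N11 (\<epsilon> powr q 1) (\<epsilon> powr q 3)
        (A *v I + block_scale N11 (\<epsilon> powr q 2) (\<epsilon> powr q 4) (g (I, \<phi>))),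
      block_scale N21 (\<epsilon> powr q 5) 1
        (\<omega> + block_scale N21 (\<epsilon> powr q 6) (\<epsilon> powr q 7) (h (I, \<phi>)))))"

text \<open>
  \<open>I = \<Phi>(\<phi>)\<close> is an invariant torus of \<open>x' = F x\<close> on which the flow is conjugate, by a homeomorphism
  of the torus with lift \<open>u\<close>, to the linear flow with rationally independent frequencies \<open>w\<close>.
\<close>

definition quasi_periodic_torus ::
    "((real ^ 'n1::finite) \<times> (real ^ 'n2::finite) \<Rightarrow> (real ^ 'n1) \<times> (real ^ 'n2)) \<Rightarrow>
     (real ^ 'n1) set \<Rightarrow> (real ^ 'n2 \<Rightarrow> real ^ 'n1) \<Rightarrow> bool" where
  "quasi_periodic_torus F \<Omega> \<Phi> \<longleftrightarrow>
     continuous_on UNIV \<Phi> \<and> periodic \<Phi> \<and> range \<Phi> \<subseteq> \<Omega> \<and>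
     (\<exists>w u u'. (\<forall>k. k \<noteq> 0 \<longrightarrow> real_vec k \<bullet> w \<noteq> 0) \<and>
        homeomorphism UNIV UNIV u u' \<and> periodic (\<lambda>\<theta>. u \<theta> - \<theta>) \<and>
        (\<forall>\<theta> t. ((\<lambda>s. (\<Phi> (u (\<theta> + s *\<^sub>R w)), u (\<theta> + s *\<^sub>R w))) has_vector_derivative
                 F (\<Phi> (u (\<theta> + t *\<^sub>R w)), u (\<theta> + t *\<^sub>R w))) (at t)))"


section \<open>Small divisors\<close>

text \<open>The cut-offs \<open>K\<^sub>\<nu>\<close>; \<open>n\<close> is the number of angles.\<close>

definition C_tilde :: "nat \<Rightarrow> real" where
  "C_tilde n = 24 * fact n * real n ^ n * exp (- real n)"

definition K_prime :: "real \<Rightarrow> real \<Rightarrow> nat \<Rightarrow> nat \<Rightarrow> nat \<Rightarrow> real" where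
  "K_prime r l \<alpha> n \<nu> = 1 / r * 3 ^ (\<nu> + 1) *
     ((l + (real n + 1) * (real \<nu> + 1) - real \<alpha>) * ln 3 + (real n + 1) * \<bar>ln r\<bar> + ln (C_tilde n))"

definition K_cut :: "real \<Rightarrow> real \<Rightarrow> nat \<Rightarrow> nat \<Rightarrow> nat \<Rightarrow> real" where
  "K_cut r l \<alpha> n \<nu> = (if \<nu> = 0 then 0 else of_int \<lfloor>K_prime r l \<alpha> n \<nu>\<rfloor> + 1)"

definition modes :: "(int ^ 'n1::finite) set" where
  "modes = {m. one_norm m \<le> 2 \<and> (\<Sum>i\<in>UNIV. m $ i) \<in> {0, -1}}"

definition small_divisor :: "int ^ 'n2 \<Rightarrow> int ^ 'n1 \<Rightarrow> real ^ 'n2::finite \<Rightarrow> complex ^ 'n1::finite \<Rightarrow> complex" where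
  "small_divisor k m w \<Lambda> =
     \<i> * complex_of_real (real_vec k \<bullet> w) + (\<Sum>i\<in>UNIV. of_int (m $ i) * \<Lambda> $ i)"

definition resonance_zone ::
    "(real ^ 'n3::finite) set \<Rightarrow> (real ^ 'n3 \<Rightarrow> real ^ 'n2::finite) \<Rightarrow> (real ^ 'n3 \<Rightarrow> complex ^ 'n1::finite) \<Rightarrow>
     int ^ 'n2 \<Rightarrow> int ^ 'n1 \<Rightarrow> real \<Rightarrow> (real ^ 'n3) set" where
  "resonance_zone P w \<Lambda> k m \<delta> = {\<xi>\<in>P. cmod (small_divisor k m (w \<xi>) (\<Lambda> \<xi>)) < \<delta>}"

text \<open>The function \<open>f\<^sub>k\<^sub>m\<close>; \<open>m\<close> is supported on the second block \<open>- N11\<close>, and \<open>L\<close> is \<open>\<Lambda>\<close> at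
  \<open>\<epsilon> = 0\<close>, of which only the second block enters.\<close>

definition f_km ::
    "(nat \<Rightarrow> real) \<Rightarrow> 'n1 set \<Rightarrow> real ^ 'n2 \<Rightarrow> (real ^ 'n3 \<Rightarrow> real ^ 'n2) \<Rightarrow> (real ^ 'n3 \<Rightarrow> complex ^ 'n1) \<Rightarrow>
     real \<Rightarrow> int ^ 'n2::finite \<Rightarrow> int ^ 'n1::finite \<Rightarrow> real ^ 'n3::finite \<Rightarrow> real" where
  "f_km q N11 w0 w L \<epsilon> k m \<xi> =
     real_vec k \<bullet> (w0 + (\<epsilon> powr q 5) *\<^sub>R w \<xi>) +
     \<epsilon> powr q 3 * (\<Sum>j\<in>- N11. real_of_int (m $ j) * Im (L \<xi> $ j))"

end

theory Submission
  imports Defs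
begin

text \<open>
  Divided by \<open>\<epsilon>\<^bsup>q 5\<^esup> \<bar>k\<bar>\<close>, the imaginary part of a small divisor is a function of \<open>\<xi>\<close> which differs, by
  a term small in \<open>C\<^sup>\<alpha>\<close>, from a linear combination with bounded coefficients of finitely many
  fixed functions: the components of \<open>\<omega>_tilde\<close>, those of \<open>Im \<Lambda>\<close> at \<open>\<epsilon> = 0\<close> in the second block, and a
  constant.  At every point, some derivative of order at most \<open>\<alpha>\<close> in some direction is bounded
  below uniformly in \<open>k\<close>, \<open>m\<close> and \<open>\<epsilon>\<close>: for \<open>\<bar>k\<bar> \<ge> K_star\<close> the term with \<open>\<Lambda>\<close> is absorbed by \<open>c2\<close>, and the
  remaining case is the nondegeneracy condition on \<open>f_km\<close>.  Uniform continuity of the finitely many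
  functions keeps this bound on balls of a fixed radius, where the sublevel set \<open>{\<bar>h\<bar> < \<delta>}\<close> therefore
  has measure \<open>O(\<delta>\<^bsup>1/\<alpha>\<^esup>)\<close>.  With \<open>\<delta> = \<gamma> \<bar>k\<bar>\<^bsup>-\<iota>-1\<^esup>\<close> the sum over \<open>k\<close> converges because
  \<open>(\<iota> + 1) / \<alpha> > n\<^sub>2\<close>.
\<close>

text \<open>The modulus of a small divisor dominates its imaginary part, so sublevel sets of the
  latter contain the resonance zones. The perturbed frequencies and eigenvalues live on the closed
  sets of the iteration, which may be disconnected, whereas slicing by lines works on the convex set
  \<open>P\<close>. Each zone is therefore covered by a sublevel set, in all of \<open>P\<close>, of
  a function extended from the closed set; such a cover is open, hence measurable.

  The constant term contains \<open>\<omega>20\<close> divided by \<open>\<epsilon> powr q 5\<close>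
  and may blow up as \<epsilon> tends to 0. It has to be left arbitrary: it disappears in
  differences and in derivatives of positive order. The remaining coefficients, formed from k / |k|
  and m / |k|, stay in a fixed bounded set, which is what makes one modulus of continuity serve
  infinitely many k.\<close>

section \<open>Iterated partial derivatives\<close>

text \<open>Differentiability is given along coordinate lines, but sublevel sets will be sliced in
  arbitrary directions. Continuity of the partial derivatives bridges the gap: one walks from
  \<open>x\<close> to \<open>x + v\<close> one coordinate at a time, with the mean value theorem on
  every leg.\<close>

lemma has_derivative_continuous_partials:
  fixes f :: "'a::euclidean_space \<Rightarrow> real"
  assumes S: "open S" "x \<in> S"
    and part: "\<And>b y. b \<in> Basis \<Longrightarrow> y \<in> S \<Longrightarrow>
      ((\<lambda>t. f (y + t *\<^sub>R b)) has_real_derivative g b y) (at 0)"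
    and cont: "\<And>b. b \<in> Basis \<Longrightarrow> continuous_on S (g b)"
  shows "(f has_derivative (\<lambda>v. \<Sum>b\<in>Basis. (v \<bullet> b) * g b x)) (at x)"
proof -
  have part': "((\<lambda>t. f (y + t *\<^sub>R b)) has_real_derivative g b (y + s *\<^sub>R b)) (at s)"
    if "b \<in> Basis" "y + s *\<^sub>R b \<in> S" for b y s
  proof -
    have "((\<lambda>t. f ((y + s *\<^sub>R b) + (t - s) *\<^sub>R b)) has_real_derivative g b (y + s *\<^sub>R b) * 1) (at s)"
      by (rule DERIV_chain'[of "\<lambda>t. t - s" 1 s UNIV "\<lambda>t. f ((y + s *\<^sub>R b) + t *\<^sub>R b)"])
        (use part[OF that] in \<open>auto intro!: derivative_eq_intros\<close>)
    then show ?thesis by (simp add: algebra_simps)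
  qed
  show ?thesis
    unfolding has_derivative_at_alt
  proof (intro conjI allI impI)
    show "bounded_linear (\<lambda>v. \<Sum>b\<in>Basis. (v \<bullet> b) * g b x)"
      by (intro bounded_linear_sum bounded_linear_mult_left[THEN bounded_linear_compose]
          bounded_linear_inner_left)
  next
    fix e :: real assume "0 < e"
    \<comment> \<open>There are \<open>DIM('a)\<close> legs, and each contributes an error of at
      most \<open>e' * norm v\<close>.\<close>
    define e' where "e' = e / DIM('a)"
    have "0 < e'" using \<open>0 < e\<close> by (simp add: e'_def)
    have "\<forall>b\<in>Basis. \<forall>\<^sub>F y in nhds x. \<bar>g b y - g b x\<bar> \<le> e'"
    proof
      fix b :: 'a assume "b \<in> Basis"
      then have "isCont (g b) x"
        using S cont continuous_on_eq_continuous_at by blast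
      then have "(g b \<longlongrightarrow> g b x) (nhds x)"
        by (simp add: isCont_def tendsto_at_iff_tendsto_nhds)
      then have "\<forall>\<^sub>F y in nhds x. dist (g b y) (g b x) < e'"
        using \<open>0 < e'\<close> by (rule tendstoD)
      then show "\<forall>\<^sub>F y in nhds x. \<bar>g b y - g b x\<bar> \<le> e'"
        by eventually_elim (simp add: dist_real_def)
    qed
    then have "\<forall>\<^sub>F y in nhds x. \<forall>b\<in>Basis. \<bar>g b y - g b x\<bar> \<le> e'"
      by (simp add: eventually_ball_finite)
    moreover have "\<forall>\<^sub>F y in nhds x. y \<in> S"
      using S by (simp add: eventually_nhds_in_open)
    ultimately have "\<forall>\<^sub>F y in nhds x. y \<in> S \<and> (\<forall>b\<in>Basis. \<bar>g b y - g b x\<bar> \<le> e')"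
      by eventually_elim simp
    then obtain d0 where d0: "0 < d0"
      and near: "\<And>y. dist y x < d0 \<Longrightarrow> y \<in> S \<and> (\<forall>b\<in>Basis. \<bar>g b y - g b x\<bar> \<le> e')"
      unfolding eventually_nhds_metric by blast
    \<comment> \<open>Every coordinate of \<open>v\<close> is at most \<open>norm v\<close>, so the
      whole path of axis-parallel legs stays within \<open>d0\<close> of \<open>x\<close>.\<close>
    define d where "d = d0 / DIM('a)"
    have "0 < d" using d0 by (simp add: d_def)
    \<comment> \<open>\<open>A\<close> is the set of coordinates already walked;
      \<open>A = Basis\<close> is the claim.\<close>
    have step: "\<bar>f (x + (\<Sum>b\<in>A. (v \<bullet> b) *\<^sub>R b)) - f x - (\<Sum>b\<in>A. (v \<bullet> b) * g b x)\<bar> \<le> card A * (e' * norm v)"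
      if v: "norm v < d" and "A \<subseteq> Basis" for v A
      using finite_subset[OF \<open>A \<subseteq> Basis\<close> finite_Basis] \<open>A \<subseteq> Basis\<close>
    proof (induction A rule: finite_induct)
      case empty
      then show ?case by simp
    next
      case (insert b A)
      define y where "y = x + (\<Sum>b\<in>A. (v \<bullet> b) *\<^sub>R b)"
      have seg: "dist (y + s *\<^sub>R b) x < d0" if "\<bar>s\<bar> \<le> \<bar>v \<bullet> b\<bar>" for s
      proof -
        have "dist (y + s *\<^sub>R b) x = norm ((\<Sum>b\<in>A. (v \<bullet> b) *\<^sub>R b) + s *\<^sub>R b)"
          by (simp add: y_def dist_norm add.assoc)
        also have "\<dots> \<le> (\<Sum>b\<in>A. \<bar>v \<bullet> b\<bar>) + \<bar>v \<bullet> b\<bar>"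
          using insert.prems that
          by (intro norm_triangle_le add_mono sum_norm_le order_trans[OF norm_sum] sum_mono)
             (auto simp: norm_Basis subset_iff)
        also have "\<dots> = (\<Sum>b\<in>insert b A. \<bar>v \<bullet> b\<bar>)"
          using insert.hyps by simp
        also have "\<dots> \<le> (\<Sum>b\<in>Basis. \<bar>v \<bullet> b\<bar>)"
          using insert.prems by (intro sum_mono2) auto
        also have "\<dots> \<le> (\<Sum>b\<in>(Basis::'a set). norm v)"
          by (intro sum_mono) (simp add: Basis_le_norm)
        also have "\<dots> < d0"
          using v by (simp add: d_def field_simps)
        finally show ?thesis .
      qed
      have "\<exists>z. \<bar>z\<bar> \<le> \<bar>v \<bullet> b\<bar> \<and> f (y + (v \<bullet> b) *\<^sub>R b) - f y = (v \<bullet> b) * g b (y + z *\<^sub>R b)"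
      proof (cases "v \<bullet> b" "0::real" rule: linorder_cases)
        case equal
        then show ?thesis by (intro exI[of _ 0]) simp
      next
        case less
        then have "\<exists>z>v \<bullet> b. z < 0 \<and> f (y + 0 *\<^sub>R b) - f (y + (v \<bullet> b) *\<^sub>R b) = (0 - v \<bullet> b) * g b (y + z *\<^sub>R b)"
          using insert.prems seg near by (intro MVT2 part') auto
        then obtain z where "v \<bullet> b < z" "z < 0"
            "f y - f (y + (v \<bullet> b) *\<^sub>R b) = - (v \<bullet> b) * g b (y + z *\<^sub>R b)" by auto
          then show ?thesis by (intro exI[of _ z]) auto
      next
        case greater
        then have "\<exists>z>0. z < v \<bullet> b \<and> f (y + (v \<bullet> b) *\<^sub>R b) - f (y + 0 *\<^sub>R b) = (v \<bullet> b - 0) * g b (y + z *\<^sub>R b)"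
          using insert.prems seg near by (intro MVT2 part') auto
        then obtain z where "0 < z" "z < v \<bullet> b"
            "f (y + (v \<bullet> b) *\<^sub>R b) - f y = (v \<bullet> b) * g b (y + z *\<^sub>R b)" by auto
        then show ?thesis by (intro exI[of _ z]) auto
      qed
      then obtain z where z: "\<bar>z\<bar> \<le> \<bar>v \<bullet> b\<bar>"
        and fz: "f (y + (v \<bullet> b) *\<^sub>R b) - f y = (v \<bullet> b) * g b (y + z *\<^sub>R b)" by blast
      have gz: "\<bar>g b (y + z *\<^sub>R b) - g b x\<bar> \<le> e'"
        using near[OF seg[OF z]] insert.prems by auto
      have "f (x + (\<Sum>b\<in>insert b A. (v \<bullet> b) *\<^sub>R b)) - f x - (\<Sum>b\<in>insert b A. (v \<bullet> b) * g b x)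
          = (f (y + (v \<bullet> b) *\<^sub>R b) - f y - (v \<bullet> b) * g b x) + (f y - f x - (\<Sum>b\<in>A. (v \<bullet> b) * g b x))"
        using insert.hyps by (simp add: y_def algebra_simps)
      also have "\<bar>\<dots>\<bar> \<le> \<bar>v \<bullet> b\<bar> * \<bar>g b (y + z *\<^sub>R b) - g b x\<bar> + card A * (e' * norm v)"
        using insert.IH insert.prems unfolding y_def[symmetric] fz
        by (intro order_trans[OF abs_triangle_ineq] add_mono)
          (auto simp flip: abs_mult simp: algebra_simps)
      also have "\<dots> \<le> norm v * e' + card A * (e' * norm v)"
        using gz insert.prems by (intro add_right_mono mult_mono) (auto simp: Basis_le_norm)
      also have "\<dots> = card (insert b A) * (e' * norm v)"
        using insert.hyps by (simp add: algebra_simps)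
      finally show ?case .
    qed
    show "\<exists>d>0. \<forall>y. norm (y - x) < d \<longrightarrow>
        norm (f y - f x - (\<Sum>b\<in>Basis. ((y - x) \<bullet> b) * g b x)) \<le> e * norm (y - x)"
    proof (intro exI[of _ d] conjI allI impI \<open>0 < d\<close>)
      fix y assume "norm (y - x) < d"
      from step[OF this order_refl]
      show "norm (f y - f x - (\<Sum>b\<in>Basis. ((y - x) \<bullet> b) * g b x)) \<le> e * norm (y - x)"
        by (simp add: euclidean_representation e'_def)
    qed
  qed
qed

text \<open>
  \<open>J bs\<close> stands for the iterated partial derivative \<open>pderivs bs h\<close> of \<open>h = J []\<close>.  In contrast to
  \<open>pderivs\<close>, such families are closed under linear combinations without any proviso.
\<close>

definition jet :: "nat \<Rightarrow> 'a set \<Rightarrow> ('a::euclidean_space list \<Rightarrow> 'a \<Rightarrow> real) \<Rightarrow> bool" where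
  "jet n S J \<longleftrightarrow>
     (\<forall>bs\<in>multi_indices {..<n}. \<forall>b\<in>Basis. \<forall>x\<in>S.
        ((\<lambda>t. J bs (x + t *\<^sub>R b)) has_real_derivative J (b # bs) x) (at 0)) \<and>
     (\<forall>bs\<in>multi_indices {..n}. uniformly_continuous_on S (J bs))"

text \<open>Summing over ordered lists avoids multinomial coefficients, and the sum of order
  \<open>Suc \<mu>\<close> arises from that of order \<open>\<mu>\<close> by prepending one basis
  vector.\<close>

definition jet_diff :: "nat \<Rightarrow> ('a::euclidean_space list \<Rightarrow> 'a \<Rightarrow> real) \<Rightarrow> 'a \<Rightarrow> 'a \<Rightarrow> real" where
  "jet_diff \<mu> J x a = (\<Sum>bs\<in>multi_indices {\<mu>}. J bs x * prod_list (map (\<lambda>b. a \<bullet> b) bs))"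

lemma jetD:
  assumes "jet n S J" "bs \<in> multi_indices {..<n}" "b \<in> Basis" "x \<in> S"
  shows "((\<lambda>t. J bs (x + t *\<^sub>R b)) has_real_derivative J (b # bs) x) (at 0)"
  using assms unfolding jet_def by blast

lemma jet_continuous:
  "jet n S J \<Longrightarrow> bs \<in> multi_indices {..n} \<Longrightarrow> continuous_on S (J bs)"
  unfolding jet_def by (blast intro: uniformly_continuous_imp_continuous)

lemma multi_indices_finite [simp]:
  "finite (multi_indices {..n} :: 'a::euclidean_space list set)"
  "finite (multi_indices {n} :: 'a list set)"
proof -
  have "multi_indices {..n} = {bs :: 'a list. set bs \<subseteq> Basis \<and> length bs \<le> n}"
    by (auto simp: multi_indices_def)
  then show "finite (multi_indices {..n} :: 'a list set)"
    using finite_lists_length_le[OF finite_Basis] by simp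
  then show "finite (multi_indices {n} :: 'a list set)"
    by (rule rev_finite_subset) (auto simp: multi_indices_def)
qed

lemma Cons_in_multi_indices [simp]:
  "b # bs \<in> multi_indices L \<longleftrightarrow> b \<in> Basis \<and> bs \<in> multi_indices {n. Suc n \<in> L}"
  by (auto simp: multi_indices_def)

lemma Nil_in_multi_indices [simp]: "[] \<in> multi_indices L \<longleftrightarrow> 0 \<in> L"
  by (auto simp: multi_indices_def)

lemma multi_indices_mono: "bs \<in> multi_indices L \<Longrightarrow> L \<subseteq> L' \<Longrightarrow> bs \<in> multi_indices L'"
  by (auto simp: multi_indices_def)

lemma sum_multi_indices_Suc:
  "(\<Sum>bs\<in>multi_indices {Suc n}. f bs) = (\<Sum>bs\<in>multi_indices {n}. \<Sum>b\<in>Basis. f (b # bs))"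
proof -
  have eq: "multi_indices {Suc n} = (\<lambda>(bs, b). b # bs) ` (multi_indices {n} \<times> Basis)"
    by (auto simp: multi_indices_def image_iff length_Suc_conv)
  have "inj_on (\<lambda>(bs, b). b # bs) (multi_indices {n} \<times> Basis)"
    by (auto simp: inj_on_def)
  then show ?thesis
    unfolding eq by (subst sum.reindex) (simp_all add: sum.cartesian_product case_prod_unfold)
qed

lemma multi_indices_zero [simp]: "multi_indices {0} = {[]}"
  by (auto simp: multi_indices_def)

text \<open>The power of a sum expanded into words: every list contributes one product.\<close>

lemma sum_multi_indices_prod:
  "(\<Sum>bs\<in>multi_indices {\<mu>}. \<bar>prod_list (map (\<lambda>b. a \<bullet> b) bs)\<bar>) = (\<Sum>b\<in>Basis. \<bar>a \<bullet> b\<bar>) ^ \<mu>"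
proof (induction \<mu>)
  case (Suc \<mu>)
  have "(\<Sum>bs\<in>multi_indices {Suc \<mu>}. \<bar>prod_list (map (\<lambda>b. a \<bullet> b) bs)\<bar>)
    = (\<Sum>bs\<in>multi_indices {\<mu>}. (\<Sum>b\<in>Basis. \<bar>a \<bullet> b\<bar>) * \<bar>prod_list (map (\<lambda>b. a \<bullet> b) bs)\<bar>)"
    by (simp add: sum_multi_indices_Suc abs_mult sum_distrib_right)
  also have "\<dots> = (\<Sum>b\<in>Basis. \<bar>a \<bullet> b\<bar>) ^ Suc \<mu>"
    by (simp add: sum_distrib_left[symmetric] Suc.IH)
  finally show ?case .
qed simp

lemma sum_abs_inner_Basis_le:
  fixes a :: "'a::euclidean_space"
  shows "(\<Sum>b\<in>Basis. \<bar>a \<bullet> b\<bar>) \<le> sqrt (DIM('a)) * norm a"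
proof -
  have "(\<Sum>b\<in>Basis. \<bar>a \<bullet> b\<bar> * \<bar>1\<bar>) \<le> L2_set (\<lambda>b. a \<bullet> b) Basis * L2_set (\<lambda>_. 1) (Basis :: 'a set)"
    by (rule L2_set_mult_ineq)
  moreover have "L2_set (\<lambda>b. a \<bullet> b) Basis = norm a"
    using euclidean_inner[of a a] by (simp add: L2_set_def norm_eq_sqrt_inner power2_eq_square)
  moreover have "L2_set (\<lambda>_. 1) (Basis :: 'a set) = sqrt (DIM('a))"
    by (simp add: L2_set_def)
  ultimately show ?thesis by (simp add: mult.commute)
qed

text \<open>The weights of the partial derivatives add up to a power of the 1-norm of
  \<open>a\<close>, and by Cauchy-Schwarz a unit vector has 1-norm at most the square root of the
  dimension. The exponent is raised from \<open>\<mu>\<close> to \<open>n\<close> so that one factor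
  serves all orders; it is the power of the dimension that appears in \<open>K_star\<close>. The
  bound is pointwise in \<open>x\<close>, and \<open>J\<close> may be any family of numbers.\<close>

lemma jet_diff_bound:
  fixes J :: "'a::euclidean_space list \<Rightarrow> 'a \<Rightarrow> real"
  assumes "norm a = 1" "\<mu> \<le> n" and J: "\<And>bs. bs \<in> multi_indices {\<mu>} \<Longrightarrow> \<bar>J bs x\<bar> \<le> M"
  shows "\<bar>jet_diff \<mu> J x a\<bar> \<le> M * sqrt (DIM('a)) ^ n"
proof -
  obtain b :: 'a where b: "b \<in> Basis" using nonempty_Basis by blast
  have "0 \<le> M"
    \<comment> \<open>A list of length \<open>\<mu>\<close> is needed in order to read off
      \<open>0 \<le> M\<close>; a constant one will do.\<close>
    using J[of "replicate \<mu> b"] b by (force simp: multi_indices_def)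
  have "\<bar>jet_diff \<mu> J x a\<bar> \<le> (\<Sum>bs\<in>multi_indices {\<mu>}. M * \<bar>prod_list (map (\<lambda>b. a \<bullet> b) bs)\<bar>)"
    unfolding jet_diff_def using J
    by (intro order_trans[OF sum_abs] sum_mono) (auto simp: abs_mult intro!: mult_right_mono)
  also have "\<dots> = M * (\<Sum>b\<in>Basis. \<bar>a \<bullet> b\<bar>) ^ \<mu>"
    by (simp flip: sum_distrib_left add: sum_multi_indices_prod)
  also have "\<dots> \<le> M * sqrt (DIM('a)) ^ \<mu>"
    using sum_abs_inner_Basis_le[of a] \<open>0 \<le> M\<close> assms(1)
    by (intro mult_left_mono power_mono) (auto simp: sum_nonneg)
  also have "\<dots> \<le> M * sqrt (DIM('a)) ^ n"
    using \<open>0 \<le> M\<close> \<open>\<mu> \<le> n\<close> by (intro mult_left_mono power_increasing) (auto simp: Suc_le_eq)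
  finally show ?thesis .
qed

lemma jet_diff_add: "jet_diff \<mu> (\<lambda>bs x. J bs x + K bs x) x a = jet_diff \<mu> J x a + jet_diff \<mu> K x a"
  by (simp add: jet_diff_def sum.distrib distrib_right)

lemma jet_diff_cmult: "jet_diff \<mu> (\<lambda>bs x. c * J bs x) x a = c * jet_diff \<mu> J x a"
  by (simp add: jet_diff_def sum_distrib_left mult.assoc)

lemma jet_diff_cong:
  "(\<And>bs. bs \<in> multi_indices {\<mu>} \<Longrightarrow> J bs x = K bs y) \<Longrightarrow> jet_diff \<mu> J x a = jet_diff \<mu> K y a"
  by (simp add: jet_diff_def)

text \<open>The chain rule in direction \<open>a\<close> replaces \<open>J bs\<close> by the
  combination of all \<open>J (b # bs)\<close> with weights \<open>a \<bullet> b\<close>; together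
  with the products already present these are exactly the lists of the next length.\<close>

lemma jet_line:
  fixes J :: "'a::euclidean_space list \<Rightarrow> 'a \<Rightarrow> real"
  assumes S: "open S" and J: "jet n S J" and "\<mu> < n" and x: "x + t *\<^sub>R a \<in> S"
  shows "((\<lambda>s. jet_diff \<mu> J (x + s *\<^sub>R a) a) has_real_derivative jet_diff (Suc \<mu>) J (x + t *\<^sub>R a) a) (at t)"
proof -
  have D: "((\<lambda>s. J bs (x + s *\<^sub>R a)) has_real_derivative (\<Sum>b\<in>Basis. (a \<bullet> b) * J (b # bs) (x + t *\<^sub>R a))) (at t)"
    if "bs \<in> multi_indices {\<mu>}" for bs
  proof -
    have bs: "bs \<in> multi_indices {..<n}"
      using that \<open>\<mu> < n\<close> by (auto elim: multi_indices_mono)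
    then have "b # bs \<in> multi_indices {..n}" if "b \<in> Basis" for b
      using that by (auto simp: multi_indices_def)
    then have "(J bs has_derivative (\<lambda>v. \<Sum>b\<in>Basis. (v \<bullet> b) * J (b # bs) (x + t *\<^sub>R a))) (at (x + t *\<^sub>R a))"
      using S x jetD[OF J bs] jet_continuous[OF J]
      by (intro has_derivative_continuous_partials[where S = S]) auto
    then have "((\<lambda>s. J bs (x + s *\<^sub>R a)) has_derivative (\<lambda>s. \<Sum>b\<in>Basis. (s *\<^sub>R a \<bullet> b) * J (b # bs) (x + t *\<^sub>R a))) (at t)"
      by (rule has_derivative_compose[rotated]) (auto intro!: derivative_eq_intros)
    then show ?thesis
      unfolding has_field_derivative_def
      by (rule has_derivative_eq_rhs) (auto simp: sum_distrib_left mult_ac)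
  qed
  have "((\<lambda>s. jet_diff \<mu> J (x + s *\<^sub>R a) a) has_real_derivative
      (\<Sum>bs\<in>multi_indices {\<mu>}. (\<Sum>b\<in>Basis. (a \<bullet> b) * J (b # bs) (x + t *\<^sub>R a)) * prod_list (map (\<lambda>b. a \<bullet> b) bs))) (at t)"
    unfolding jet_diff_def
    by (intro DERIV_sum DERIV_cmult_right D)
  then show ?thesis
    by (simp add: jet_diff_def sum_multi_indices_Suc sum_distrib_right sum_distrib_left mult_ac)
qed

lemma jet_continuous_Nil: "jet n S J \<Longrightarrow> continuous_on S (J [])"
  by (auto intro: jet_continuous)

lemma jet_const: "jet n S (\<lambda>bs x. if bs = [] then c else 0)"
  by (auto simp: jet_def uniformly_continuous_on_const)

lemma jet_add: "jet n S J \<Longrightarrow> jet n S K \<Longrightarrow> jet n S (\<lambda>bs x. J bs x + K bs x)"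
  unfolding jet_def by (auto intro!: DERIV_add uniformly_continuous_on_add)

lemma jet_cmult: "jet n S J \<Longrightarrow> jet n S (\<lambda>bs x. c * J bs x)"
  unfolding jet_def
  by (auto intro!: DERIV_cmult bounded_linear.uniformly_continuous_on[OF bounded_linear_mult_right])

lemma jet_zero: "jet n S (\<lambda>bs x. 0)"
  using jet_const[of n S 0] by simp

lemma jet_sum: "(\<And>i. i \<in> I \<Longrightarrow> jet n S (J i)) \<Longrightarrow> jet n S (\<lambda>bs x. \<Sum>i\<in>I. J i bs x)"
  by (induction I rule: infinite_finite_induct) (simp_all add: jet_zero jet_add)

lemma jet_linear_image:
  assumes "Ck_on n S f" "bounded_linear L"
  shows "jet n S (\<lambda>bs x. L (pderivs bs f x))"
proof -
  have "((\<lambda>t. L (pderivs bs f (x + t *\<^sub>R b))) has_real_derivative L (pderivs (b # bs) f x)) (at 0)"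
    if "bs \<in> multi_indices {..<n}" "b \<in> Basis" "x \<in> S" for bs b x
  proof -
    have "(\<lambda>t. pderivs bs f (x + t *\<^sub>R b)) differentiable (at 0)"
      using assms(1) that unfolding Ck_on_def has_pderivs_on_def by blast
    then have "((\<lambda>t. pderivs bs f (x + t *\<^sub>R b)) has_vector_derivative pderivs (b # bs) f x) (at 0)"
      by (simp add: pderivs_def dir_deriv_def vector_derivative_works)
    from bounded_linear.has_vector_derivative[OF assms(2) this]
    show ?thesis by (simp add: has_real_derivative_iff_has_vector_derivative)
  qed
  moreover have "uniformly_continuous_on S (\<lambda>x. L (pderivs bs f x))" if "bs \<in> multi_indices {..n}" for bs
    using assms that
    by (intro bounded_linear.uniformly_continuous_on[OF assms(2)]) (auto simp: Ck_on_def)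
  ultimately show ?thesis by (simp add: jet_def)
qed

lemma jet_pderivs: "Ck_on n S f \<Longrightarrow> jet n S (\<lambda>bs. pderivs bs f)" for f :: "_ \<Rightarrow> real"
  using jet_linear_image[of n S f "\<lambda>x. x"] by simp

text \<open>At a point of an open set, \<open>dir_deriv\<close> sees only values inside that set, so
  agreement on \<open>S\<close> passes from each order to the next.\<close>

lemma pderivs_eq_jet:
  fixes f :: "'a::euclidean_space \<Rightarrow> real"
  assumes S: "open S" and J: "jet n S J" and f: "\<And>x. x \<in> S \<Longrightarrow> f x = J [] x"
    and "bs \<in> multi_indices {..n}" "x \<in> S"
  shows "pderivs bs f x = J bs x"
  using assms(4,5)
proof (induction bs arbitrary: x)
  case Nil
  then show ?case using f by (simp add: pderivs_def)
next
  case (Cons b bs)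
  then have bs: "bs \<in> multi_indices {..<n}" "b \<in> Basis"
    by (auto simp: multi_indices_def)
  have "open ((\<lambda>t. x + t *\<^sub>R b) -` S)"
    using S by (intro open_vimage) (auto intro!: continuous_intros)
  then have "\<forall>\<^sub>F t in nhds 0. t \<in> (\<lambda>t. x + t *\<^sub>R b) -` S"
    using Cons.prems by (intro eventually_nhds_in_open) auto
  then have "\<forall>\<^sub>F t in nhds 0. pderivs bs f (x + t *\<^sub>R b) = J bs (x + t *\<^sub>R b)"
    by eventually_elim (use Cons.IH Cons.prems in \<open>auto simp: multi_indices_def\<close>)
  with jetD[OF J bs Cons.prems(2)]
  have "((\<lambda>t. pderivs bs f (x + t *\<^sub>R b)) has_real_derivative J (b # bs) x) (at 0)"
    by (subst DERIV_cong_ev[OF refl _ refl])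
  then show ?case
    by (simp add: pderivs_def dir_deriv_def has_real_derivative_iff_has_vector_derivative vector_derivative_at)
qed

lemma differential_eq_jet_diff:
  fixes f :: "'a::euclidean_space \<Rightarrow> real"
  assumes "open S" "jet n S J" "\<And>x. x \<in> S \<Longrightarrow> f x = J [] x" "x \<in> S" "\<mu> \<le> n"
  shows "differential \<mu> f x a = jet_diff \<mu> J x a"
  unfolding differential_def jet_diff_def using assms
  by (intro sum.cong refl arg_cong2[where f = "(*)"] pderivs_eq_jet[where S = S and n = n])
    (auto simp: multi_indices_def)

section \<open>Sublevel sets\<close>

text \<open>
  The \<open>\<mu>\<close>-th derivative is bounded away from \<open>0\<close>, so the \<open>(\<mu>-1)\<close>-st one is monotone and, outside an
  interval of length \<open>O(x)\<close>, at least \<open>c x\<close> in absolute value, with a constant sign on either side.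
\<close>

lemma sublevel_interval:
  fixes \<phi> :: "nat \<Rightarrow> real \<Rightarrow> real"
  assumes "is_interval J" "0 < x" "0 < c"
    and "\<And>i t. i < \<mu> \<Longrightarrow> t \<in> J \<Longrightarrow> (\<phi> i has_real_derivative \<phi> (Suc i) t) (at t within J)"
    and "\<sigma> \<in> {1, -1}" "\<And>t. t \<in> J \<Longrightarrow> c \<le> \<sigma> * \<phi> \<mu> t"
  shows "\<exists>T\<in>sets borel. {t \<in> J. \<bar>\<phi> 0 t\<bar> < c * x ^ \<mu>} \<subseteq> T \<and> emeasure lborel T \<le> ennreal (4 * (2 ^ \<mu> - 1) * x)"
  using assms
proof (induction \<mu> arbitrary: J c \<sigma>)
  case 0
  \<comment> \<open>At order 0 the function itself is at least \<open>c\<close>: the set is empty,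
    in accordance with the factor \<open>2 ^ 0 - 1\<close>.\<close>
  have "c \<le> \<bar>\<phi> 0 t\<bar>" if "t \<in> J" for t
    using "0.prems"(5) "0.prems"(6)[OF that] by (cases "\<sigma> = 1") auto
  then have "{t \<in> J. \<bar>\<phi> 0 t\<bar> < c * x ^ 0} = {}" by (simp add: not_less)
  then show ?case by (intro bexI[of _ "{}"]) simp_all
next
  case (Suc \<mu>)
  have incr: "c * (t - s) \<le> \<sigma> * \<phi> \<mu> t - \<sigma> * \<phi> \<mu> s" if "s \<in> J" "t \<in> J" "s < t" for s t
  proof -
    have sub: "{s..t} \<subseteq> J"
      using mem_is_interval_1_I[OF \<open>is_interval J\<close> that(1,2)] by (simp add: subset_iff)
    have "\<exists>z\<in>{s<..<t}. \<phi> \<mu> t - \<phi> \<mu> s = \<phi> (Suc \<mu>) z * (t - s)"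
      using \<open>s < t\<close>
    proof (rule mvt_simple)
      fix z assume "s \<le> z" "z \<le> t"
      then have "(\<phi> \<mu> has_real_derivative \<phi> (Suc \<mu>) z) (at z within {s..t})"
        using Suc.prems(4)[of \<mu> z] sub by (intro DERIV_subset[OF _ sub]) auto
      then show "(\<phi> \<mu> has_derivative (*) (\<phi> (Suc \<mu>) z)) (at z within {s..t})"
        by (simp add: has_field_derivative_def)
    qed
    then obtain z where z: "z \<in> {s<..<t}" "\<phi> \<mu> t - \<phi> \<mu> s = \<phi> (Suc \<mu>) z * (t - s)" by blast
    have "c * (t - s) \<le> (\<sigma> * \<phi> (Suc \<mu>) z) * (t - s)"
      using z(1) sub \<open>s < t\<close> by (intro mult_right_mono Suc.prems(6)) auto
    also have "\<dots> = \<sigma> * \<phi> \<mu> t - \<sigma> * \<phi> \<mu> s"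
      unfolding mult.assoc z(2)[symmetric] by (rule right_diff_distrib)
    finally show ?thesis .
  qed
  have mono: "\<sigma> * \<phi> \<mu> s \<le> \<sigma> * \<phi> \<mu> t" if "s \<in> J" "t \<in> J" "s \<le> t" for s t
  proof (cases "s = t")
    case False
    then have "0 \<le> c * (t - s)" using that \<open>0 < c\<close> by simp
    then show ?thesis using incr[of s t] that False by linarith
  qed simp
  define J1 where "J1 = {t \<in> J. \<sigma> * \<phi> \<mu> t \<le> - (c * x)}"
  define J2 where "J2 = {t \<in> J. \<bar>\<sigma> * \<phi> \<mu> t\<bar> < c * x}"
  define J3 where "J3 = {t \<in> J. c * x \<le> \<sigma> * \<phi> \<mu> t}"
  have "is_interval J1" "is_interval J3"
    unfolding is_interval_1
  proof (safe)
    fix s t z :: real assume st: "s \<le> z" "z \<le> t"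
    assume "s \<in> J1" "t \<in> J1"
    then show "z \<in> J1"
      using mem_is_interval_1_I[OF \<open>is_interval J\<close>, of s t z] mono[of z t] st by (simp add: J1_def)
  next
    fix s t z :: real assume st: "s \<le> z" "z \<le> t"
    assume "s \<in> J3" "t \<in> J3"
    then show "z \<in> J3"
      using mem_is_interval_1_I[OF \<open>is_interval J\<close>, of s t z] mono[of s z] st by (simp add: J3_def)
  qed
  have der: "(\<phi> i has_real_derivative \<phi> (Suc i) t) (at t within K)"
    if "i < \<mu>" "t \<in> K" "K \<subseteq> J" for i t K
    using Suc.prems(4)[of i t] that by (auto intro: DERIV_subset)
  have "0 < c * x" using \<open>0 < c\<close> \<open>0 < x\<close> by simp
  \<comment> \<open>The threshold is regrouped as \<open>(c * x) * x ^ \<mu>\<close>: off the window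
    \<open>J2\<close> the derivative of order \<open>\<mu>\<close> is at least \<open>c * x\<close>
    in absolute value, so \<open>c * x\<close> takes over the role of \<open>c\<close>. On the left
    part \<open>J1\<close> its sign is reversed.\<close>
  have "\<exists>T\<in>sets borel. {t \<in> J1. \<bar>\<phi> 0 t\<bar> < (c * x) * x ^ \<mu>} \<subseteq> T \<and> emeasure lborel T \<le> ennreal (4 * (2 ^ \<mu> - 1) * x)"
  proof (rule Suc.IH[where \<sigma> = "- \<sigma>"])
    show "(\<phi> i has_real_derivative \<phi> (Suc i) t) (at t within J1)" if "i < \<mu>" "t \<in> J1" for i t
      using that by (rule der) (auto simp: J1_def)
    show "- \<sigma> \<in> {1, -1}" using \<open>\<sigma> \<in> {1, -1}\<close> by auto
    show "c * x \<le> - \<sigma> * \<phi> \<mu> t" if "t \<in> J1" for t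
      using that by (simp add: J1_def)
  qed fact+
  moreover have "\<exists>T\<in>sets borel. {t \<in> J3. \<bar>\<phi> 0 t\<bar> < (c * x) * x ^ \<mu>} \<subseteq> T \<and> emeasure lborel T \<le> ennreal (4 * (2 ^ \<mu> - 1) * x)"
  proof (rule Suc.IH[where \<sigma> = \<sigma>])
    show "(\<phi> i has_real_derivative \<phi> (Suc i) t) (at t within J3)" if "i < \<mu>" "t \<in> J3" for i t
      using that by (rule der) (auto simp: J3_def)
    show "c * x \<le> \<sigma> * \<phi> \<mu> t" if "t \<in> J3" for t
      using that by (simp add: J3_def)
  qed fact+
  ultimately obtain T1 T3 where
    T1: "T1 \<in> sets borel" "{t \<in> J1. \<bar>\<phi> 0 t\<bar> < c * x * x ^ \<mu>} \<subseteq> T1" "emeasure lborel T1 \<le> ennreal (4 * (2 ^ \<mu> - 1) * x)" and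
    T3: "T3 \<in> sets borel" "{t \<in> J3. \<bar>\<phi> 0 t\<bar> < c * x * x ^ \<mu>} \<subseteq> T3" "emeasure lborel T3 \<le> ennreal (4 * (2 ^ \<mu> - 1) * x)"
    by blast
  \<comment> \<open>The monotone function has slope at least \<open>c\<close> and varies by at most
    \<open>2 * c * x\<close> on \<open>J2\<close>, so any two points of \<open>J2\<close> are at
    most \<open>2 * x\<close> apart.\<close>
  obtain s0 where J2: "J2 \<subseteq> {s0 - 2 * x..s0 + 2 * x}"
  proof (cases "J2 = {}")
    case False
    then obtain s0 where s0: "s0 \<in> J2" by blast
    have "\<bar>t - s0\<bar> \<le> 2 * x" if "t \<in> J2" for t
    proof -
      have "c * \<bar>t - s0\<bar> \<le> c * (2 * x)"
        using incr[of s0 t] incr[of t s0] s0 that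
        by (cases s0 t rule: linorder_cases) (auto simp: J2_def abs_less_iff algebra_simps)
      then show ?thesis using \<open>0 < c\<close> by simp
    qed
    then show ?thesis by (intro that[of s0]) (auto simp: abs_le_iff algebra_simps)
  qed (use that in blast)
  let ?I = "{s0 - 2 * x..s0 + 2 * x}"
  have "{t \<in> J. \<bar>\<phi> 0 t\<bar> < c * x ^ Suc \<mu>} \<subseteq> T1 \<union> T3 \<union> ?I"
  proof
    fix t assume t: "t \<in> {t \<in> J. \<bar>\<phi> 0 t\<bar> < c * x ^ Suc \<mu>}"
    then have "t \<in> J1 \<or> t \<in> J2 \<or> t \<in> J3" by (auto simp: J1_def J2_def J3_def)
    then show "t \<in> T1 \<union> T3 \<union> ?I"
      using t T1(2) T3(2) J2 by (fastforce simp: mult.assoc)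
  qed
  \<comment> \<open>The constants a(\<mu>) in front of x satisfy a(0) = 0 and a(\<mu> + 1) = 2
    a(\<mu>) + 4, two outer parts and one window; the solution is 4 (2^\<mu> - 1).\<close>
  moreover have "emeasure lborel (T1 \<union> T3 \<union> ?I) \<le> ennreal (4 * (2 ^ Suc \<mu> - 1) * x)"
  proof -
    have "emeasure lborel (T1 \<union> T3 \<union> ?I) \<le> emeasure lborel T1 + emeasure lborel T3 + emeasure lborel ?I"
      using T1(1) T3(1)
      by (intro order_trans[OF emeasure_subadditive] add_right_mono) auto
    also have "\<dots> \<le> ennreal (4 * (2 ^ \<mu> - 1) * x) + ennreal (4 * (2 ^ \<mu> - 1) * x) + ennreal (4 * x)"
      using T1(3) T3(3) \<open>0 < x\<close> by (intro add_mono) auto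
    also have "\<dots> = ennreal (4 * (2 ^ Suc \<mu> - 1) * x)"
      using \<open>0 < x\<close> by (simp flip: ennreal_plus add: algebra_simps)
    finally show ?thesis .
  qed
  ultimately show ?case
    using T1(1) T3(1) by (intro bexI[of _ "T1 \<union> T3 \<union> ?I"]) auto
qed

text \<open>
  Averaging over the translates of \<open>S\<close> along \<open>t a\<close>, \<open>0 \<le> t \<le> 1\<close>, replaces Fubini's theorem in rotated
  coordinates.
\<close>

lemma emeasure_le_of_lines:
  fixes S :: "'a::euclidean_space set"
  assumes S [measurable]: "S \<in> sets borel" and "S \<subseteq> ball 0 R" and a: "norm a \<le> 1"
    and slices: "\<And>x. \<exists>T\<in>sets borel. {t. x + t *\<^sub>R a \<in> S} \<subseteq> T \<and> emeasure lborel T \<le> B"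
  shows "emeasure lborel S \<le> B * emeasure lborel (ball (0::'a) (R + 1))"
proof -
  have meas [measurable]: "(\<lambda>(x, t). indicator S (x + t *\<^sub>R a) * indicator {0..1} t :: ennreal)
      \<in> borel_measurable ((lborel :: 'a measure) \<Otimes>\<^sub>M (lborel :: real measure))"
    by measurable
  have shift: "emeasure lborel S = (\<integral>\<^sup>+x. indicator S (x + t *\<^sub>R a) \<partial>lborel)" for t :: real
  proof -
    have "emeasure lborel S = emeasure (distr lborel borel ((+) (t *\<^sub>R a))) S"
      by (simp add: lborel_distr_plus)
    also have "\<dots> = (\<integral>\<^sup>+x. indicator S x \<partial>distr lborel borel ((+) (t *\<^sub>R a)))"
      by simp
    also have "\<dots> = (\<integral>\<^sup>+x. indicator S (t *\<^sub>R a + x) \<partial>lborel)"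
      by (subst nn_integral_distr) auto
    finally show ?thesis by (simp add: add.commute)
  qed
  have "emeasure lborel S = (\<integral>\<^sup>+t. emeasure lborel S * indicator {0..1} t \<partial>(lborel :: real measure))"
    by (subst nn_integral_cmult_indicator) auto
  also have "\<dots> = (\<integral>\<^sup>+t. (\<integral>\<^sup>+x. indicator S (x + t *\<^sub>R a) * indicator {0..1} t \<partial>lborel) \<partial>lborel)"
    by (subst nn_integral_multc) (simp_all flip: shift)
  also have "\<dots> = (\<integral>\<^sup>+x. (\<integral>\<^sup>+t. indicator S (x + t *\<^sub>R a) * indicator {0..1} t \<partial>lborel) \<partial>lborel)"
    by (rule lborel_pair.Fubini'[OF meas])
  also have "\<dots> \<le> (\<integral>\<^sup>+x. B * indicator (ball 0 (R + 1)) x \<partial>(lborel :: 'a measure))"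
  proof (intro nn_integral_mono)
    fix x :: 'a
    obtain T where T: "T \<in> sets borel" "{t. x + t *\<^sub>R a \<in> S} \<subseteq> T" "emeasure lborel T \<le> B"
      using slices by blast
    show "(\<integral>\<^sup>+t. indicator S (x + t *\<^sub>R a) * indicator {0..1} t \<partial>lborel) \<le> B * indicator (ball 0 (R + 1)) x"
    proof (cases "x \<in> ball 0 (R + 1)")
      case True
      have "(\<integral>\<^sup>+t. indicator S (x + t *\<^sub>R a) * indicator {0..1} t \<partial>lborel) \<le> (\<integral>\<^sup>+t. indicator T t \<partial>lborel)"
        using T(2) by (intro nn_integral_mono) (auto simp: indicator_def)
      also have "\<dots> \<le> B" using T by simp
      finally show ?thesis using True by simp
    next
      \<comment> \<open>A segment of length at most 1 that starts outside the enlarged ball cannot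
        reach \<open>ball 0 R\<close>; hence the radius \<open>R + 1\<close>.\<close>
      case False
      have "x + t *\<^sub>R a \<notin> S" if "t \<in> {0..1}" for t
      proof
        assume "x + t *\<^sub>R a \<in> S"
        then have "norm (x + t *\<^sub>R a) < R" using \<open>S \<subseteq> ball 0 R\<close> by auto
        moreover have "norm (t *\<^sub>R a) \<le> 1" using a that by (simp add: mult_le_one)
        moreover have "norm x \<le> norm (x + t *\<^sub>R a) + norm (t *\<^sub>R a)"
          using norm_triangle_ineq4[of "x + t *\<^sub>R a" "t *\<^sub>R a"] by simp
        ultimately show False using False by simp
      qed
      then have "indicator S (x + t *\<^sub>R a) * indicator {0..1} t = (0::ennreal)" for t
        by (cases "t \<in> {0..1}") simp_all
      then have "(\<lambda>t. indicator S (x + t *\<^sub>R a) * indicator {0..1} t) = (\<lambda>_. 0::ennreal)"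
        by (rule ext)
      then show ?thesis by simp
    qed
  qed
  also have "\<dots> = B * emeasure lborel (ball (0::'a) (R + 1))"
    by (rule nn_integral_cmult_indicator) simp
  finally show ?thesis .
qed

lemma sublevel_open_lmeasurable:
  fixes P :: "'a::euclidean_space set"
  assumes "open P" "bounded P" "continuous_on P h"
  shows "open {x \<in> P. \<bar>h x\<bar> < (\<delta>::real)}" "{x \<in> P. \<bar>h x\<bar> < \<delta>} \<in> lmeasurable"
proof -
  have "{x \<in> P. \<bar>h x\<bar> < \<delta>} = P \<inter> (\<lambda>x. \<bar>h x\<bar>) -` {..<\<delta>}" by auto
  moreover have "open (P \<inter> (\<lambda>x. \<bar>h x\<bar>) -` {..<\<delta>})"
    by (rule continuous_open_preimage[OF continuous_on_rabs[OF assms(3)] assms(1) open_lessThan])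
  ultimately have *: "open {x \<in> P. \<bar>h x\<bar> < \<delta>}" by simp
  moreover have "bounded {x \<in> P. \<bar>h x\<bar> < \<delta>}"
    using assms(2) by (rule bounded_subset) auto
  ultimately show "{x \<in> P. \<bar>h x\<bar> < \<delta>} \<in> lmeasurable" "open {x \<in> P. \<bar>h x\<bar> < \<delta>}"
    by (simp_all add: lmeasurable_open)
qed

text \<open>The derivative that is large at one point of a ball of radius \<open>\<rho> / 2\<close>
  stays at least \<open>c / 2\<close>, with the same order, direction and sign, on the part of the
  ball in \<open>P\<close>, and finitely many such balls cover \<open>P\<close>. Convexity makes
  every line meet such a piece in an interval, as \<open>sublevel_interval\<close> demands.
  \<open>C\<close> is fixed before \<open>J\<close> and \<open>\<delta>\<close>: the family enters
  only through \<open>c\<close> and \<open>\<rho>\<close>.\<close>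

lemma measure_jet_sublevel:
  fixes P :: "'a::euclidean_space set"
  assumes P: "open P" "convex P" "bounded P" and "0 < n" "0 < c" "0 < \<rho>"
  obtains C where "0 \<le> C"
    "\<And>J \<delta>. \<lbrakk>jet n P J;
       \<And>x. x \<in> P \<Longrightarrow> \<exists>\<mu>\<le>n. \<exists>a. norm a = 1 \<and> c \<le> \<bar>jet_diff \<mu> J x a\<bar>;
       \<And>x y \<mu> a. \<lbrakk>x \<in> P; y \<in> P; dist x y < \<rho>; \<mu> \<le> n; norm a = 1\<rbrakk> \<Longrightarrow>
          \<bar>jet_diff \<mu> J x a - jet_diff \<mu> J y a\<bar> \<le> c / 2;
       0 < \<delta>; \<delta> \<le> c / 2\<rbrakk> \<Longrightarrow>
     measure lebesgue {x \<in> P. \<bar>J [] x\<bar> < \<delta>} \<le> C * \<delta> powr (1 / n)"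
proof -
  obtain R where "0 < R" and R: "P \<subseteq> ball 0 R"
    using \<open>bounded P\<close> bounded_subset_ballD by blast
  have "compact (closure P)" using \<open>bounded P\<close> by (simp add: compact_closure)
  then obtain K where K: "finite K" "closure P \<subseteq> (\<Union>k\<in>K. ball k (\<rho> / 2))"
    using \<open>0 < \<rho>\<close> unfolding compact_eq_totally_bounded by (meson half_gt_zero)
  define V where "V = measure lborel (ball (0::'a) (R + 1))"
  define C where "C = card K * (4 * 2 ^ n * V * (1 / (c / 2)) powr (1 / n))"
  have "0 \<le> C" by (simp add: C_def V_def)
  moreover have "measure lebesgue {x \<in> P. \<bar>J [] x\<bar> < \<delta>} \<le> C * \<delta> powr (1 / n)"
    if J: "jet n P J"
      and low: "\<And>x. x \<in> P \<Longrightarrow> \<exists>\<mu>\<le>n. \<exists>a. norm a = 1 \<and> c \<le> \<bar>jet_diff \<mu> J x a\<bar>"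
      and modulus: "\<And>x y \<mu> a. \<lbrakk>x \<in> P; y \<in> P; dist x y < \<rho>; \<mu> \<le> n; norm a = 1\<rbrakk> \<Longrightarrow>
          \<bar>jet_diff \<mu> J x a - jet_diff \<mu> J y a\<bar> \<le> c / 2"
      and \<delta>: "0 < \<delta>" "\<delta> \<le> c / 2" for J \<delta>
  proof -
    \<comment> \<open>\<open>y\<close> solves \<open>\<delta> = (c / 2) * y ^ n\<close>. As
      \<open>y \<le> 1\<close>, an order \<open>\<mu>\<close> below \<open>n\<close> has the larger
      threshold \<open>(c / 2) * y ^ \<mu>\<close>, so whatever order occurs on a ball, the bound is
      linear in \<open>y\<close>.\<close>
    define y where "y = (\<delta> / (c / 2)) powr (1 / n)"
    have "0 < y" using \<open>0 < c\<close> \<delta> by (simp add: y_def)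
    have "y \<le> 1" using \<open>0 < c\<close> \<delta> unfolding y_def by (intro powr_le1) auto
    have "y ^ n = \<delta> / (c / 2)"
      using \<open>0 < c\<close> \<open>0 < n\<close> \<delta> unfolding y_def by (simp flip: powr_realpow add: powr_powr)
    then have y_n: "\<delta> = (c / 2) * y ^ n" using \<open>0 < c\<close> by simp
    let ?S = "\<lambda>k. {x \<in> P \<inter> ball k (\<rho> / 2). \<bar>J [] x\<bar> < \<delta>}"
    have S_meas: "open (?S k)" "?S k \<in> lmeasurable" for k
      using P J
      by (intro sublevel_open_lmeasurable(1) sublevel_open_lmeasurable(2);
          auto intro: continuous_on_subset[OF jet_continuous_Nil] bounded_subset)+
    have piece: "measure lebesgue (?S k) \<le> 4 * 2 ^ n * V * y" for k
    proof (cases "P \<inter> ball k (\<rho> / 2) = {}")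
      case True
      then have "?S k = {}" by blast
      then show ?thesis
        using \<open>0 < y\<close> by (metis V_def measure_empty measure_nonneg mult_nonneg_nonneg less_imp_le
            zero_le_numeral zero_le_power)
    next
      case False
      then obtain p where p: "p \<in> P" "p \<in> ball k (\<rho> / 2)" by blast
      obtain \<mu> a where \<mu>: "\<mu> \<le> n" "norm a = 1" "c \<le> \<bar>jet_diff \<mu> J p a\<bar>"
        using low[OF p(1)] by blast
      define \<sigma> :: real where "\<sigma> = (if 0 \<le> jet_diff \<mu> J p a then 1 else -1)"
      \<comment> \<open>Two points of a ball of radius \<open>\<rho> / 2\<close> are less than
        \<open>\<rho>\<close> apart.\<close>
      have near: "c / 2 \<le> \<sigma> * jet_diff \<mu> J z a" if "z \<in> P" "z \<in> ball k (\<rho> / 2)" for z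
      proof -
        have "dist p z < \<rho>"
          using p(2) that(2) dist_triangle_half_r[of k p \<rho> z] by simp
        then have "\<bar>jet_diff \<mu> J p a - jet_diff \<mu> J z a\<bar> \<le> c / 2"
          using modulus p(1) that(1) \<mu> by blast
        then show ?thesis using \<mu>(3) by (simp add: \<sigma>_def abs_if split: if_splits)
      qed
      have "emeasure lborel (?S k) \<le> ennreal (4 * (2 ^ \<mu> - 1) * y) * emeasure lborel (ball (0::'a) (R + 1))"
      proof (rule emeasure_le_of_lines)
        show "?S k \<in> sets borel" using S_meas(1)[of k] by (rule borel_open)
        show "?S k \<subseteq> ball 0 R" using R by blast
        show "norm a \<le> 1" using \<mu> by simp
      next
        fix x
        define I where "I = {t. x + t *\<^sub>R a \<in> P \<inter> ball k (\<rho> / 2)}"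
        define \<phi> where "\<phi> = (\<lambda>i t. jet_diff i J (x + t *\<^sub>R a) a)"
        have "convex I"
        proof (rule convexI)
          fix s t u v :: real
          assume *: "s \<in> I" "t \<in> I" "0 \<le> u" "0 \<le> v" "u + v = 1"
          have "x + (u *\<^sub>R s + v *\<^sub>R t) *\<^sub>R a = (u + v) *\<^sub>R x + (u *\<^sub>R s + v *\<^sub>R t) *\<^sub>R a"
            using *(5) by simp
          also have "\<dots> = u *\<^sub>R (x + s *\<^sub>R a) + v *\<^sub>R (x + t *\<^sub>R a)"
            by (simp add: algebra_simps)
          also have "\<dots> \<in> P \<inter> ball k (\<rho> / 2)"
            using convex_Int[OF \<open>convex P\<close> convex_ball[of k "\<rho> / 2"]] * unfolding I_def
            by (intro convexD) simp_all
          finally show "u *\<^sub>R s + v *\<^sub>R t \<in> I" by (simp add: I_def)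
        qed
        then have "is_interval I" unfolding is_interval_convex_1 .
        moreover have "(\<phi> i has_real_derivative \<phi> (Suc i) t) (at t within I)" if "i < \<mu>" "t \<in> I" for i t
          unfolding \<phi>_def using that \<mu>(1)
          by (rule_tac has_field_derivative_at_within, rule_tac jet_line[OF \<open>open P\<close> J]) (simp_all add: I_def)
        moreover have "\<sigma> \<in> {1, -1}" by (simp add: \<sigma>_def)
        moreover have "c / 2 \<le> \<sigma> * \<phi> \<mu> t" if "t \<in> I" for t
          using near[of "x + t *\<^sub>R a"] that by (simp add: I_def \<phi>_def)
        ultimately have "\<exists>T\<in>sets borel. {t \<in> I. \<bar>\<phi> 0 t\<bar> < c / 2 * y ^ \<mu>} \<subseteq> T \<and>
            emeasure lborel T \<le> ennreal (4 * (2 ^ \<mu> - 1) * y)"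
          using \<open>0 < y\<close> half_gt_zero[OF \<open>0 < c\<close>] by (intro sublevel_interval[where \<sigma> = \<sigma>])
        then obtain T where T: "T \<in> sets borel"
          "{t \<in> I. \<bar>\<phi> 0 t\<bar> < c / 2 * y ^ \<mu>} \<subseteq> T" "emeasure lborel T \<le> ennreal (4 * (2 ^ \<mu> - 1) * y)"
          by blast
        have "\<delta> \<le> c / 2 * y ^ \<mu>"
          unfolding y_n using \<mu>(1) \<open>0 < c\<close> \<open>0 < y\<close> \<open>y \<le> 1\<close>
          by (intro mult_left_mono power_decreasing) auto
        then have "{t. x + t *\<^sub>R a \<in> ?S k} \<subseteq> {t \<in> I. \<bar>\<phi> 0 t\<bar> < c / 2 * y ^ \<mu>}"
          by (auto simp: I_def \<phi>_def jet_diff_def)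
        then show "\<exists>T\<in>sets borel. {t. x + t *\<^sub>R a \<in> ?S k} \<subseteq> T \<and> emeasure lborel T \<le> ennreal (4 * (2 ^ \<mu> - 1) * y)"
          using T by (intro bexI[of _ T]) blast+
      qed
      also have "\<dots> = ennreal (4 * (2 ^ \<mu> - 1) * y * V)"
        using \<open>0 < y\<close> emeasure_lborel_ball_finite[of "0::'a" "R + 1"] unfolding V_def
        by (subst emeasure_eq_ennreal_measure) (simp_all add: ennreal_mult' less_top)
      finally have "measure lborel (?S k) \<le> 4 * (2 ^ \<mu> - 1) * y * V"
        using \<open>0 < y\<close> unfolding measure_def[of lborel "?S k"] by (intro enn2real_leI) (auto simp: V_def)
      moreover have "measure lebesgue (?S k) = measure lborel (?S k)"
        using S_meas(1) by (intro measure_completion) auto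
      moreover have "4 * (2 ^ \<mu> - 1) * y * V \<le> 4 * 2 ^ n * y * V"
      proof -
        have "(2::real) ^ \<mu> - 1 \<le> 2 ^ n"
          using power_increasing[of \<mu> n "2::real"] \<mu>(1) by linarith
        then show ?thesis
          using \<open>0 < y\<close> by (intro mult_right_mono mult_left_mono) (simp_all add: V_def)
      qed
      ultimately show ?thesis by (simp add: mult_ac)
    qed
    have "{x \<in> P. \<bar>J [] x\<bar> < \<delta>} \<subseteq> (\<Union>k\<in>K. ?S k)"
      using K(2) closure_subset by fastforce
    then have "measure lebesgue {x \<in> P. \<bar>J [] x\<bar> < \<delta>} \<le> measure lebesgue (\<Union>k\<in>K. ?S k)"
      using sublevel_open_lmeasurable(2)[OF P(1,3) jet_continuous_Nil[OF J]] K(1) S_meas(2)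
      by (intro measure_mono_fmeasurable) (auto dest: fmeasurableD)
    also have "\<dots> \<le> (\<Sum>k\<in>K. measure lebesgue (?S k))"
      using K(1) S_meas(2) by (intro measure_UNION_le) (auto dest: fmeasurableD)
    also have "\<dots> \<le> card K * (4 * 2 ^ n * V * y)"
      using piece by (intro sum_bounded_above) auto
    also have "\<dots> = C * \<delta> powr (1 / n)"
      using \<open>0 < c\<close> \<delta> by (simp add: C_def y_def powr_divide powr_mult)
    finally show ?thesis .
  qed
  ultimately show ?thesis by (rule that)
qed

section \<open>Sums over the integer lattice and the cut-offs\<close>

lemma abs_le_norm_real_vec: "\<bar>real_of_int (k $ i)\<bar> \<le> norm (real_vec k)"
  using component_le_norm_cart[of "real_vec k" i] by (simp add: real_vec_def)

lemma norm_real_vec_ge_1: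
  assumes "k \<noteq> 0"
  shows "1 \<le> norm (real_vec k)"
proof -
  obtain i where "k $ i \<noteq> 0" using assms by (auto simp: vec_eq_iff)
  then have "1 \<le> \<bar>real_of_int (k $ i)\<bar>" by linarith
  then show ?thesis using abs_le_norm_real_vec[of k i] by linarith
qed

lemma real_vec_eq_0_iff [simp]: "real_vec k = 0 \<longleftrightarrow> k = 0"
  by (auto simp: real_vec_def vec_eq_iff)

text \<open>\<open>max 1\<close> gives weight 1 to \<open>j = 0\<close>, as required for lattice
  points with vanishing coordinates. The absolute value is injective on each half of the integers,
  so each half costs at most one convergent series.\<close>

lemma sum_int_powr_bounded:
  assumes "1 < p"
  obtains C where "0 \<le> C" "\<And>A. finite A \<Longrightarrow> (\<Sum>j\<in>A. max 1 \<bar>real_of_int j\<bar> powr (- p)) \<le> C"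
proof -
  define g where "g n = max 1 (real n) powr (- p)" for n
  have "summable (\<lambda>n. real n powr (- p))"
    using assms by (simp add: summable_real_powr_iff)
  then have "summable (\<lambda>n. real (Suc n) powr (- p))"
    by (subst summable_Suc_iff)
  \<comment> \<open>The shift removes the index 0, where \<open>real n powr (- p)\<close> is 0 by
    convention but \<open>g\<close> is 1.\<close>
  moreover have "(\<lambda>n. real (Suc n) powr (- p)) = (\<lambda>n. g (Suc n))"
    by (simp add: g_def max_def fun_eq_iff)
  ultimately have g: "summable g"
    using summable_Suc_iff[of g] by metis
  have nat_bound: "sum g B \<le> suminf g" if "finite B" for B
    using g that by (intro sum_le_suminf) (auto simp: g_def)
  have half: "(\<Sum>j\<in>A. max 1 \<bar>real_of_int j\<bar> powr (- p)) \<le> suminf g"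
    if A: "finite A" and inj: "inj_on (\<lambda>j. nat \<bar>j\<bar>) A" for A
  proof -
    have "(\<Sum>j\<in>A. max 1 \<bar>real_of_int j\<bar> powr (- p)) = sum g ((\<lambda>j. nat \<bar>j\<bar>) ` A)"
      by (simp add: sum.reindex[OF inj] g_def)
    also have "\<dots> \<le> suminf g" using A by (intro nat_bound) simp
    finally show ?thesis .
  qed
  show ?thesis
  proof (rule that)
    show "0 \<le> 2 * suminf g" using nat_bound[of "{}"] by simp
  next
    fix A :: "int set" assume A: "finite A"
    have "(\<Sum>j\<in>A. max 1 \<bar>real_of_int j\<bar> powr (- p))
        = (\<Sum>j\<in>A \<inter> {0..}. max 1 \<bar>real_of_int j\<bar> powr (- p)) + (\<Sum>j\<in>A - {0..}. max 1 \<bar>real_of_int j\<bar> powr (- p))"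
      by (rule sum.Int_Diff[OF A])
    also have "\<dots> \<le> suminf g + suminf g"
      using A by (intro add_mono half) (auto simp: inj_on_def)
    finally show "(\<Sum>j\<in>A. max 1 \<bar>real_of_int j\<bar> powr (- p)) \<le> 2 * suminf g" by simp
  qed
qed

text \<open>
  Since \<open>\<bar>k\<bar>\<^sub>2 \<ge> max 1 \<bar>k\<^sub>i\<bar>\<close> for every coordinate of \<open>k \<noteq> 0\<close>, the sum over the lattice is at most a
  product of one-dimensional sums.
\<close>

lemma sum_lattice_powr_bounded:
  assumes s: "real CARD('n::finite) < s"
  obtains C where "0 \<le> C"
    "\<And>F. finite F \<Longrightarrow> 0 \<notin> F \<Longrightarrow> (\<Sum>k\<in>F. norm (real_vec (k :: int ^ 'n)) powr (- s)) \<le> C"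
proof -
  \<comment> \<open>The exponent is shared equally among the coordinates; \<open>s\<close> exceeding
    the dimension means \<open>p > 1\<close>.\<close>
  define p where "p = s / real CARD('n)"
  have "1 < p" using s by (simp add: p_def)
  then obtain C where C: "0 \<le> C" "\<And>A. finite A \<Longrightarrow> (\<Sum>j\<in>A. max 1 \<bar>real_of_int j\<bar> powr (- p)) \<le> C"
    using sum_int_powr_bounded by blast
  define g where "g = (\<lambda>j. max 1 \<bar>real_of_int j\<bar> powr (- p))"
  have term_le: "norm (real_vec k) powr (- s) \<le> (\<Prod>i\<in>UNIV. g (k $ i))" if "k \<noteq> 0" for k :: "int ^ 'n"
  proof -
    have "norm (real_vec k) powr (- s) = (norm (real_vec k) powr (- p)) ^ CARD('n)"
      using that by (simp add: p_def powr_powr flip: powr_realpow)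
    also have "\<dots> = (\<Prod>i\<in>(UNIV :: 'n set). norm (real_vec k) powr (- p))"
      by simp
    also have "\<dots> \<le> (\<Prod>i\<in>UNIV. g (k $ i))"
      unfolding g_def using \<open>1 < p\<close> norm_real_vec_ge_1[OF that]
      by (intro prod_mono conjI powr_mono2') (auto simp: abs_le_norm_real_vec)
    finally show ?thesis .
  qed
  show ?thesis
  proof (rule that)
    show "0 \<le> C ^ CARD('n)" using C(1) by simp
  next
    fix F :: "(int ^ 'n) set" assume F: "finite F" "0 \<notin> F"
    \<comment> \<open>\<open>A\<close> collects all coordinate values occurring in \<open>F\<close>,
      so \<open>F\<close> embeds into a finite box, over which the sum of products
      factorises.\<close>
    define A where "A = (\<Union>k\<in>F. range (($) k))"
    have "finite A" using F(1) by (simp add: A_def)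
    have "(\<Sum>k\<in>F. norm (real_vec k) powr (- s)) \<le> (\<Sum>k\<in>F. \<Prod>i\<in>UNIV. g (k $ i))"
      using F(2) by (intro sum_mono term_le) auto
    also have "\<dots> = (\<Sum>f\<in>(($) ` F). \<Prod>i\<in>UNIV. g (f i))"
      by (subst sum.reindex) (auto simp: inj_on_def vec_eq_iff fun_eq_iff)
    also have "\<dots> \<le> (\<Sum>f\<in>(UNIV :: 'n set) \<rightarrow>\<^sub>E A. \<Prod>i\<in>UNIV. g (f i))"
      using \<open>finite A\<close>
      by (intro sum_mono2 finite_PiE) (auto simp: A_def g_def intro!: prod_nonneg)
    also have "\<dots> = (\<Prod>i\<in>(UNIV :: 'n set). \<Sum>j\<in>A. g j)"
      using \<open>finite A\<close> by (subst prod_sum_PiE) auto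
    also have "\<dots> \<le> C ^ CARD('n)"
      using C(2)[OF \<open>finite A\<close>] unfolding g_def by (simp add: power_mono sum_nonneg)
    finally show "(\<Sum>k\<in>F. norm (real_vec k) powr (- s)) \<le> C ^ CARD('n)" .
  qed
qed

text \<open>This makes the logarithm in \<open>K_prime\<close> nonnegative. From
  \<open>n = 3\<close> on, the power n^n dominates 3^n and hence e^n; for \<open>n = 1\<close> and
  \<open>n = 2\<close> the numerical factors suffice.\<close>

lemma one_le_C_tilde:
  assumes "0 < n"
  shows "1 \<le> C_tilde n"
proof -
  have e: "exp (real n) \<le> 3 ^ n"
    using exp_le power_mono[of "exp 1" "3::real" n] by (simp flip: exp_of_nat_mult)
  have "(3::real) ^ n \<le> 24 * fact n * real n ^ n"
  proof (cases "n \<le> 2")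
    case True
    then have "n = 1 \<or> n = 2" using assms by linarith
    then show ?thesis by (auto simp: power2_eq_square)
  next
    case False
    then have "(3::real) ^ n \<le> real n ^ n" by (intro power_mono) auto
    moreover have "1 * real n ^ n \<le> (24 * fact n) * real n ^ n"
      using fact_ge_1[of n, where 'a = real] by (intro mult_right_mono) (linarith, simp)
    ultimately show ?thesis by linarith
  qed
  with e show ?thesis by (simp add: C_tilde_def exp_minus field_simps)
qed

text \<open>Monotone cut-offs make the shells of successive stages disjoint, so that no
  \<open>k\<close> is treated at two stages.\<close>

lemma mono_K_cut:
  assumes "0 < r" "real \<alpha> \<le> l" "0 < n"
  shows "mono (K_cut r l \<alpha> n)"
proof (rule monoI)
  fix \<mu> \<nu> :: nat assume "\<mu> \<le> \<nu>"
  let ?h = "\<lambda>\<nu>. (l + (real n + 1) * (real \<nu> + 1) - real \<alpha>) * ln 3 + (real n + 1) * \<bar>ln r\<bar> + ln (C_tilde n)"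
  have nonneg: "0 \<le> ?h \<nu>" for \<nu>
  proof -
    have "0 \<le> (real n + 1) * (real \<nu> + 1)" by simp
    then have "0 \<le> l + (real n + 1) * (real \<nu> + 1) - real \<alpha>" using assms(2) by linarith
    then show ?thesis
      using one_le_C_tilde[OF \<open>0 < n\<close>] by (intro add_nonneg_nonneg mult_nonneg_nonneg) simp_all
  qed
  have "?h \<mu> \<le> ?h \<nu>"
    using \<open>\<mu> \<le> \<nu>\<close> by (intro add_mono mult_right_mono diff_mono mult_left_mono) auto
  then have "K_prime r l \<alpha> n \<mu> \<le> K_prime r l \<alpha> n \<nu>"
    unfolding K_prime_def using \<open>0 < r\<close> \<open>\<mu> \<le> \<nu>\<close> nonneg
    by (intro mult_mono power_increasing) auto
  \<comment> \<open>The cut-off at index 0 is 0 by definition and not given by the floor, so the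
    comparison with it rests on nonnegativity.\<close>
  moreover have "0 \<le> K_prime r l \<alpha> n \<nu>"
    unfolding K_prime_def using \<open>0 < r\<close> nonneg by (intro mult_nonneg_nonneg) auto
  ultimately show "K_cut r l \<alpha> n \<mu> \<le> K_cut r l \<alpha> n \<nu>"
    using \<open>\<mu> \<le> \<nu>\<close> by (auto simp: K_cut_def floor_mono)
qed

section \<open>The measure of the resonance zones\<close>

text \<open>The coefficients \<open>b\<close> and \<open>d\<close> are bounded, so a common modulus
  of the finitely many \<open>V i\<close> and \<open>U j\<close> controls all combinations at once,
  and \<open>z\<close> cancels in the difference of two values. Hence \<open>C\<close> and
  \<open>\<eta>\<close> can be fixed before \<open>z\<close>, the coefficients and
  \<open>R\<close>.\<close>

lemma measure_jet_family_sublevel: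
  fixes P :: "'a::euclidean_space set" and V :: "'i::finite \<Rightarrow> 'a list \<Rightarrow> 'a \<Rightarrow> real"
    and U :: "'j::finite \<Rightarrow> 'a list \<Rightarrow> 'a \<Rightarrow> real"
  assumes P: "open P" "convex P" "bounded P" and "0 < n" "0 < c" "0 \<le> B"
    and V: "\<And>i. jet n P (V i)" and U: "\<And>j. jet n P (U j)"
  obtains C \<eta> where "0 \<le> C" "0 < \<eta>"
    "\<And>z b d R \<delta>. \<lbrakk>\<And>i. \<bar>b i\<bar> \<le> B; \<And>j. \<bar>d j\<bar> \<le> B;
       \<And>x. x \<in> P \<Longrightarrow> \<exists>\<mu>\<le>n. \<exists>a. norm a = 1 \<and> c \<le> \<bar>jet_diff \<mu>
         (\<lambda>bs x. (if bs = [] then z else 0) + (\<Sum>i\<in>UNIV. b i * V i bs x) + (\<Sum>j\<in>UNIV. d j * U j bs x)) x a\<bar>;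
       jet n P R; \<And>bs x. bs \<in> multi_indices {..n} \<Longrightarrow> x \<in> P \<Longrightarrow> \<bar>R bs x\<bar> \<le> \<eta>;
       0 < \<delta>; \<delta> \<le> c / 4\<rbrakk> \<Longrightarrow>
     {x \<in> P. \<bar>z + (\<Sum>i\<in>UNIV. b i * V i [] x) + (\<Sum>j\<in>UNIV. d j * U j [] x) + R [] x\<bar> < \<delta>} \<in> lmeasurable \<and>
     measure lebesgue {x \<in> P. \<bar>z + (\<Sum>i\<in>UNIV. b i * V i [] x) + (\<Sum>j\<in>UNIV. d j * U j [] x) + R [] x\<bar> < \<delta>}
       \<le> C * \<delta> powr (1 / n)"
proof -
  define N where "N = sqrt (DIM('a)) ^ n"
  have "0 < N" by (simp add: N_def)
  \<comment> \<open>The budget: \<open>R\<close> changes a differential by at most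
    \<open>c / 16\<close>, and passing to a point at distance less than \<open>\<rho>\<close>
    changes that of the combination by at most \<open>c / 8\<close>. The perturbed function thus
    keeps the lower bound \<open>c / 2\<close>, and its oscillation is at most c/8 + 2 c/16 = c/4,
    half of that bound.\<close>
  define \<eta> where "\<eta> = c / (16 * N)"
  \<comment> \<open>The added 1 keeps \<open>Q\<close> positive when \<open>B = 0\<close>.\<close>
  define Q where "Q = B * real CARD('i) + B * real CARD('j) + 1"
  define e where "e = c / (8 * N * Q)"
  have "0 < Q" using \<open>0 \<le> B\<close> by (simp add: Q_def add_nonneg_pos)
  have "0 < \<eta>" "0 < e" using \<open>0 < c\<close> \<open>0 < N\<close> \<open>0 < Q\<close> by (simp_all add: \<eta>_def e_def)
  have unif: "\<forall>\<^sub>F \<rho> in at_right 0. \<forall>bs\<in>multi_indices {..n}. \<forall>x\<in>P. \<forall>y\<in>P. dist x y < \<rho> \<longrightarrow> \<bar>J bs x - J bs y\<bar> \<le> e"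
    if J: "jet n P J" for J
  proof (rule eventually_ball_finite[OF multi_indices_finite(1)], rule ballI)
    fix bs :: "'a list" assume "bs \<in> multi_indices {..n}"
    then have "uniformly_continuous_on P (J bs)" using J by (simp add: jet_def)
    then obtain d where d: "0 < d" "\<And>x y. x \<in> P \<Longrightarrow> y \<in> P \<Longrightarrow> dist y x < d \<Longrightarrow> dist (J bs y) (J bs x) < e"
      using \<open>0 < e\<close> unfolding uniformly_continuous_on_def by metis
    have "\<forall>\<^sub>F \<rho> in at_right 0. \<rho> \<in> {0<..<d}" using d(1) by (rule eventually_at_right_real)
    then show "\<forall>\<^sub>F \<rho> in at_right 0. \<forall>x\<in>P. \<forall>y\<in>P. dist x y < \<rho> \<longrightarrow> \<bar>J bs x - J bs y\<bar> \<le> e"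
      by eventually_elim (use d(2) in \<open>force simp: dist_real_def dist_commute\<close>)
  qed
  \<comment> \<open>Finitely many moduli of continuity, combined along the filter, yield one
    radius.\<close>
  have "\<forall>\<^sub>F \<rho> in at_right (0::real). 0 < \<rho> \<and>
     (\<forall>i. \<forall>bs\<in>multi_indices {..n}. \<forall>x\<in>P. \<forall>y\<in>P. dist x y < \<rho> \<longrightarrow> \<bar>V i bs x - V i bs y\<bar> \<le> e) \<and>
     (\<forall>j. \<forall>bs\<in>multi_indices {..n}. \<forall>x\<in>P. \<forall>y\<in>P. dist x y < \<rho> \<longrightarrow> \<bar>U j bs x - U j bs y\<bar> \<le> e)"
    by (intro eventually_conj eventually_all_finite unif V U eventually_at_right_less)
  then have "\<exists>\<rho>>0::real.
     (\<forall>i. \<forall>bs\<in>multi_indices {..n}. \<forall>x\<in>P. \<forall>y\<in>P. dist x y < \<rho> \<longrightarrow> \<bar>V i bs x - V i bs y\<bar> \<le> e) \<and>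
     (\<forall>j. \<forall>bs\<in>multi_indices {..n}. \<forall>x\<in>P. \<forall>y\<in>P. dist x y < \<rho> \<longrightarrow> \<bar>U j bs x - U j bs y\<bar> \<le> e)"
    by (rule eventually_happens'[OF trivial_limit_at_right_real])
  then obtain \<rho> where "0 < \<rho>"
    and V_near: "\<And>i bs x y. bs \<in> multi_indices {..n} \<Longrightarrow> x \<in> P \<Longrightarrow> y \<in> P \<Longrightarrow> dist x y < \<rho> \<Longrightarrow> \<bar>V i bs x - V i bs y\<bar> \<le> e"
    and U_near: "\<And>j bs x y. bs \<in> multi_indices {..n} \<Longrightarrow> x \<in> P \<Longrightarrow> y \<in> P \<Longrightarrow> dist x y < \<rho> \<Longrightarrow> \<bar>U j bs x - U j bs y\<bar> \<le> e"
    by blast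
  obtain C where "0 \<le> C" and C:
    "\<And>J \<delta>. \<lbrakk>jet n P J;
       \<And>x. x \<in> P \<Longrightarrow> \<exists>\<mu>\<le>n. \<exists>a. norm a = 1 \<and> c / 2 \<le> \<bar>jet_diff \<mu> J x a\<bar>;
       \<And>x y \<mu> a. \<lbrakk>x \<in> P; y \<in> P; dist x y < \<rho>; \<mu> \<le> n; norm a = 1\<rbrakk> \<Longrightarrow>
          \<bar>jet_diff \<mu> J x a - jet_diff \<mu> J y a\<bar> \<le> c / 2 / 2;
       0 < \<delta>; \<delta> \<le> c / 2 / 2\<rbrakk> \<Longrightarrow>
     measure lebesgue {x \<in> P. \<bar>J [] x\<bar> < \<delta>} \<le> C * \<delta> powr (1 / n)"
    using measure_jet_sublevel[OF P \<open>0 < n\<close> half_gt_zero[OF \<open>0 < c\<close>] \<open>0 < \<rho>\<close>] by blast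
  show ?thesis
  proof (rule that[OF \<open>0 \<le> C\<close> \<open>0 < \<eta>\<close>])
    fix z \<delta> :: real and b :: "'i \<Rightarrow> real" and d :: "'j \<Rightarrow> real" and R :: "'a list \<Rightarrow> 'a \<Rightarrow> real"
    assume b: "\<And>i. \<bar>b i\<bar> \<le> B" and d: "\<And>j. \<bar>d j\<bar> \<le> B" and R: "jet n P R"
      and R_small: "\<And>bs x. bs \<in> multi_indices {..n} \<Longrightarrow> x \<in> P \<Longrightarrow> \<bar>R bs x\<bar> \<le> \<eta>"
      and \<delta>: "0 < \<delta>" "\<delta> \<le> c / 4"
    define G where "G = (\<lambda>bs x. (if bs = [] then z else 0) + (\<Sum>i\<in>UNIV. b i * V i bs x) + (\<Sum>j\<in>UNIV. d j * U j bs x))"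
    define J where "J = (\<lambda>bs x. G bs x + R bs x)"
    assume "\<And>x. x \<in> P \<Longrightarrow> \<exists>\<mu>\<le>n. \<exists>a. norm a = 1 \<and> c \<le> \<bar>jet_diff \<mu>
         (\<lambda>bs x. (if bs = [] then z else 0) + (\<Sum>i\<in>UNIV. b i * V i bs x) + (\<Sum>j\<in>UNIV. d j * U j bs x)) x a\<bar>"
    then have low: "\<exists>\<mu>\<le>n. \<exists>a. norm a = 1 \<and> c \<le> \<bar>jet_diff \<mu> G x a\<bar>" if "x \<in> P" for x
      using that by (simp add: G_def)
    have "jet n P J"
      unfolding J_def G_def by (intro jet_add jet_const jet_sum jet_cmult V U R)
    have R_diff: "\<bar>jet_diff \<mu> R x a\<bar> \<le> c / 16" if "x \<in> P" "\<mu> \<le> n" "norm a = 1" for x \<mu> a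
    proof -
      have "\<bar>jet_diff \<mu> R x a\<bar> \<le> \<eta> * sqrt (DIM('a)) ^ n"
        using that by (intro jet_diff_bound R_small) (auto elim: multi_indices_mono)
      also have "\<dots> = c / 16" using \<open>0 < N\<close> by (simp add: \<eta>_def flip: N_def)
      finally show ?thesis .
    qed
    have J_eq: "jet_diff \<mu> J x a = jet_diff \<mu> G x a + jet_diff \<mu> R x a" for \<mu> x a
      by (simp add: J_def jet_diff_add)
    have "measure lebesgue {x \<in> P. \<bar>J [] x\<bar> < \<delta>} \<le> C * \<delta> powr (1 / n)"
    proof (rule C)
      fix x assume "x \<in> P"
      then obtain \<mu> a where \<mu>: "\<mu> \<le> n" "norm a = 1" "c \<le> \<bar>jet_diff \<mu> G x a\<bar>" using low by blast
      with R_diff[OF \<open>x \<in> P\<close> this(1,2)] \<open>0 < c\<close> have "c / 2 \<le> \<bar>jet_diff \<mu> J x a\<bar>"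
        unfolding J_eq by linarith
      with \<mu> show "\<exists>\<mu>\<le>n. \<exists>a. norm a = 1 \<and> c / 2 \<le> \<bar>jet_diff \<mu> J x a\<bar>" by blast
    next
      fix x y a :: 'a and \<mu> assume xy: "x \<in> P" "y \<in> P" "dist x y < \<rho>" and \<mu>: "\<mu> \<le> n" "norm a = 1"
      have "\<bar>G bs x - G bs y\<bar> \<le> Q * e" if "bs \<in> multi_indices {\<mu>}" for bs
      proof -
        have bs: "bs \<in> multi_indices {..n}" using that \<mu>(1) by (auto elim: multi_indices_mono)
        have "\<bar>G bs x - G bs y\<bar> = \<bar>(\<Sum>i\<in>UNIV. b i * (V i bs x - V i bs y)) + (\<Sum>j\<in>UNIV. d j * (U j bs x - U j bs y))\<bar>"
          by (simp add: G_def right_diff_distrib sum_subtractf)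
        also have "\<dots> \<le> (\<Sum>i\<in>(UNIV::'i set). B * e) + (\<Sum>j\<in>(UNIV::'j set). B * e)"
          by (intro order_trans[OF abs_triangle_ineq] add_mono order_trans[OF sum_abs] sum_mono)
            (auto simp: abs_mult intro!: mult_mono b d V_near U_near bs xy \<open>0 \<le> B\<close>)
        also have "\<dots> \<le> Q * e"
          using \<open>0 < e\<close> by (simp add: Q_def algebra_simps)
        finally show ?thesis .
      qed
      \<comment> \<open>With \<open>y\<close> frozen this family need not be a jet, but
        \<open>jet_diff_bound\<close> looks only at its values at \<open>x\<close>.\<close>
      then have "\<bar>jet_diff \<mu> (\<lambda>bs x'. G bs x' - G bs y) x a\<bar> \<le> Q * e * sqrt (DIM('a)) ^ n"
        using \<mu> by (intro jet_diff_bound) auto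
      moreover have "jet_diff \<mu> (\<lambda>bs x'. G bs x' - G bs y) x a = jet_diff \<mu> G x a - jet_diff \<mu> G y a"
        by (simp add: jet_diff_def left_diff_distrib sum_subtractf)
      moreover have "Q * e * sqrt (DIM('a)) ^ n = c / 8"
        using \<open>0 < Q\<close> \<open>0 < N\<close> by (simp add: e_def flip: N_def)
      ultimately show "\<bar>jet_diff \<mu> J x a - jet_diff \<mu> J y a\<bar> \<le> c / 2 / 2"
        using R_diff[OF xy(1) \<mu>] R_diff[OF xy(2) \<mu>] unfolding J_eq by linarith
    qed (use \<open>jet n P J\<close> \<delta> in simp_all)
    moreover have "{x \<in> P. \<bar>J [] x\<bar> < \<delta>} \<in> lmeasurable"
      using P \<open>jet n P J\<close> by (intro sublevel_open_lmeasurable jet_continuous_Nil)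
    ultimately show "{x \<in> P. \<bar>z + (\<Sum>i\<in>UNIV. b i * V i [] x) + (\<Sum>j\<in>UNIV. d j * U j [] x) + R [] x\<bar> < \<delta>} \<in> lmeasurable \<and>
     measure lebesgue {x \<in> P. \<bar>z + (\<Sum>i\<in>UNIV. b i * V i [] x) + (\<Sum>j\<in>UNIV. d j * U j [] x) + R [] x\<bar> < \<delta>}
       \<le> C * \<delta> powr (1 / n)"
      by (simp add: J_def G_def)
  qed
qed

text \<open>A lost point is missing from the start or leaves at a first stage, through a zone of the
  shell belonging to that stage. Disjointness of the shells lets every pair \<open>(k, m)\<close> be
  charged once altogether instead of once per stage. The zones enter through measurable covers
  \<open>Z'\<close>.\<close>

lemma measure_Cantor_deficit:
  fixes Q :: "nat \<Rightarrow> 'a::euclidean_space set" and Z Z' :: "nat \<Rightarrow> int ^ 'n::finite \<Rightarrow> 'm \<Rightarrow> 'a set"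
    and K :: "nat \<Rightarrow> real" and D s S :: real
  assumes P: "P \<in> lmeasurable" and Q: "\<And>\<nu>. closed (Q \<nu>)" "\<And>\<nu>. Q \<nu> \<subseteq> P"
    and K: "mono K" "K 0 = 0" and "finite M"
    and removal: "\<And>\<nu>. Q (Suc \<nu>) = Q \<nu> -
      (\<Union>m\<in>M. \<Union>k\<in>{k. K \<nu> < norm (real_vec k) \<and> norm (real_vec k) \<le> K (Suc \<nu>)}. Z \<nu> k m)"
    and Z: "\<And>\<nu> k m. k \<noteq> 0 \<Longrightarrow> m \<in> M \<Longrightarrow> Z \<nu> k m \<subseteq> Z' \<nu> k m"
      "\<And>\<nu> k m. k \<noteq> 0 \<Longrightarrow> m \<in> M \<Longrightarrow> Z' \<nu> k m \<in> lmeasurable"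
      "\<And>\<nu> k m. k \<noteq> 0 \<Longrightarrow> m \<in> M \<Longrightarrow> measure lebesgue (Z' \<nu> k m) \<le> D * norm (real_vec k) powr (- s)"
    and "0 \<le> D"
    and S: "\<And>F. finite F \<Longrightarrow> 0 \<notin> F \<Longrightarrow> (\<Sum>k\<in>F. norm (real_vec (k :: int ^ 'n)) powr (- s)) \<le> S"
  shows "measure lebesgue P - measure lebesgue (\<Inter>\<nu>. Q \<nu>) \<le> measure lebesgue (P - Q 0) + real (card M) * D * S"
proof -
  \<comment> \<open>The stage at which \<open>k\<close> is treated. For a \<open>k\<close> in no
    shell the value is arbitrary, which is harmless because the bound on \<open>Z'\<close> holds at
    every stage.\<close>
  define sh where "sh k = (SOME \<nu>. K \<nu> < norm (real_vec k) \<and> norm (real_vec k) \<le> K (Suc \<nu>))" for k :: "int ^ 'n"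
  have sh: "sh k = \<nu>" if "K \<nu> < norm (real_vec k)" "norm (real_vec k) \<le> K (Suc \<nu>)" for k \<nu>
  proof -
    have *: "K (sh k) < norm (real_vec k) \<and> norm (real_vec k) \<le> K (Suc (sh k))"
      unfolding sh_def by (rule someI[of _ \<nu>]) (use that in simp)
    show ?thesis
    proof (rule antisym)
      show "sh k \<le> \<nu>"
        using * that monoD[OF K(1), of "Suc \<nu>" "sh k"] by (rule_tac ccontr) (simp add: not_le)
      show "\<nu> \<le> sh k"
        using * that monoD[OF K(1), of "Suc (sh k)" \<nu>] by (rule_tac ccontr) (simp add: not_le)
    qed
  qed
  define I where "I = (- {0 :: int ^ 'n}) \<times> M"
  define Y where "Y = (\<lambda>(k, m). Z' (sh k) k m)"
  have "countable I"
    using \<open>finite M\<close> unfolding I_def by (intro countable_SIGMA countableI_type) (simp add: countable_finite)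
  have Y: "Y i \<in> lmeasurable" if "i \<in> I" for i
    using that Z(2) by (auto simp: I_def Y_def)
  \<comment> \<open>A bound for all finite subfamilies carries over to the countable union.\<close>
  have fin: "measure lebesgue (\<Union>i\<in>I'. Y i) \<le> real (card M) * D * S" if I': "I' \<subseteq> I" "finite I'" for I'
  proof -
    define F where "F = fst ` I'"
    have F: "finite F" "0 \<notin> F" using I' by (auto simp: F_def I_def)
    have "measure lebesgue (\<Union>i\<in>I'. Y i) \<le> (\<Sum>i\<in>I'. measure lebesgue (Y i))"
      using I' Y by (intro measure_UNION_le) (auto dest!: fmeasurableD)
    also have "\<dots> \<le> (\<Sum>(k, m)\<in>I'. D * norm (real_vec k) powr (- s))"
      using I' Z(3) by (intro sum_mono) (auto simp: I_def Y_def)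
    also have "\<dots> \<le> (\<Sum>(k, m)\<in>F \<times> M. D * norm (real_vec k) powr (- s))"
    proof (rule sum_mono2)
      show "finite (F \<times> M)" using F \<open>finite M\<close> by simp
      show "I' \<subseteq> F \<times> M" using I' unfolding F_def I_def by force
    qed (use \<open>0 \<le> D\<close> in auto)
    also have "\<dots> = real (card M) * D * (\<Sum>k\<in>F. norm (real_vec k) powr (- s))"
      by (simp flip: sum.cartesian_product add: sum_distrib_left mult.assoc)
    also have "\<dots> \<le> real (card M) * D * S"
      using \<open>0 \<le> D\<close> by (intro mult_left_mono S F) simp
    finally show ?thesis .
  qed
  have Y_union: "(\<Union>i\<in>I. Y i) \<in> lmeasurable" "measure lebesgue (\<Union>i\<in>I. Y i) \<le> real (card M) * D * S"
    using fmeasurable_UN_bound[OF \<open>countable I\<close> Y fin] measure_UN_bound[OF \<open>countable I\<close> Y fin] by blast+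
  have Q_leb: "Q \<nu> \<in> sets lebesgue" for \<nu>
    using Q(1) by (simp add: borel_closed)
  have "P - (\<Inter>\<nu>. Q \<nu>) \<subseteq> (P - Q 0) \<union> (\<Union>i\<in>I. Y i)"
  proof
    fix x assume x: "x \<in> P - (\<Inter>\<nu>. Q \<nu>)"
    then obtain \<nu>0 where "x \<notin> Q \<nu>0" by blast
    define \<nu> where "\<nu> = (LEAST \<nu>. x \<notin> Q \<nu>)"
    have \<nu>: "x \<notin> Q \<nu>" unfolding \<nu>_def using \<open>x \<notin> Q \<nu>0\<close> by (rule LeastI)
    show "x \<in> (P - Q 0) \<union> (\<Union>i\<in>I. Y i)"
    proof (cases \<nu>)
      case 0
      then show ?thesis using \<nu> x by simp
    next
      case (Suc \<mu>)
      then have "x \<in> Q \<mu>" using not_less_Least[of \<mu> "\<lambda>\<nu>. x \<notin> Q \<nu>"] by (simp add: \<nu>_def)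
      with \<nu> Suc removal[of \<mu>] obtain m k where mk: "m \<in> M" "K \<mu> < norm (real_vec k)"
        "norm (real_vec k) \<le> K (Suc \<mu>)" "x \<in> Z \<mu> k m" by blast
      have "0 \<le> K \<mu>" using monoD[OF K(1), of 0 \<mu>] K(2) by simp
      then have "k \<noteq> 0" using mk(2) real_vec_eq_0_iff[of k] by (metis norm_zero not_less)
      then have "(k, m) \<in> I" "x \<in> Y (k, m)"
        using mk Z(1)[of k m \<mu>] sh[of \<mu> k] by (auto simp: I_def Y_def)
      then show ?thesis by blast
    qed
  qed
  then have "measure lebesgue (P - (\<Inter>\<nu>. Q \<nu>)) \<le> measure lebesgue ((P - Q 0) \<union> (\<Union>i\<in>I. Y i))"
    using P Q_leb Y_union(1) by (intro measure_mono_fmeasurable) (auto intro!: fmeasurable.Un fmeasurable_Diff)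
  also have "\<dots> \<le> measure lebesgue (P - Q 0) + measure lebesgue (\<Union>i\<in>I. Y i)"
    using P Q_leb Y_union(1) by (intro measure_Un_le) (auto dest: fmeasurableD)
  also have "measure lebesgue (P - (\<Inter>\<nu>. Q \<nu>)) = measure lebesgue P - measure lebesgue (\<Inter>\<nu>. Q \<nu>)"
  proof (rule measurable_measure_Diff)
    show "(\<Inter>\<nu>. Q \<nu>) \<in> sets lebesgue" using Q_leb by (intro sets.countable_INT) auto
    show "(\<Inter>\<nu>. Q \<nu>) \<subseteq> P" using Q(2) by blast
  qed (fact P)
  finally show ?thesis using Y_union(2) by linarith
qed

section \<open>Modes and lower bounds from nondegeneracy\<close>

lemma abs_le_one_norm: "\<bar>m $ i\<bar> \<le> one_norm m"
  unfolding one_norm_def by (rule member_le_sum) auto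

lemma modes_abs_le:
  assumes "m \<in> modes"
  shows "\<bar>real_of_int (m $ i)\<bar> \<le> 2"
proof -
  have "\<bar>m $ i\<bar> \<le> 2" using assms abs_le_one_norm[of m i] by (simp add: modes_def)
  then show ?thesis by linarith
qed

lemma finite_modes: "finite (modes :: (int ^ 'n::finite) set)"
proof (rule finite_imageD)
  have "($) ` (modes :: (int ^ 'n) set) \<subseteq> UNIV \<rightarrow>\<^sub>E {-2..2}"
  proof (clarsimp simp: PiE_def)
    fix m :: "int ^ 'n" and i
    assume "m \<in> modes"
    then have "\<bar>m $ i\<bar> \<le> 2" using abs_le_one_norm[of m i] by (simp add: modes_def)
    then show "- 2 \<le> m $ i \<and> m $ i \<le> 2" by linarith
  qed
  then show "finite (($) ` (modes :: (int ^ 'n) set))"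
    by (rule finite_subset) (simp add: finite_PiE)
  show "inj_on ($) (modes :: (int ^ 'n) set)"
    by (auto simp: inj_on_def vec_eq_iff)
qed

lemma sum_abs_modes_le:
  assumes "m \<in> modes"
  shows "(\<Sum>i\<in>UNIV. \<bar>real_of_int (m $ i)\<bar>) \<le> 2"
proof -
  have "(\<Sum>i\<in>UNIV. \<bar>real_of_int (m $ i)\<bar>) = real_of_int (one_norm m)"
    by (simp add: one_norm_def)
  then show ?thesis using assms by (simp add: modes_def)
qed

text \<open>
  A mode whose components in the second block \<open>- N\<close> sum up to \<open>1\<close> is excluded in the
  nondegeneracy condition; but the opposite mode is admitted.
\<close>

lemma modes_second_block:
  fixes m :: "int ^ 'n::finite"
  assumes m: "m \<in> modes" and "j \<in> - N" "m $ j \<noteq> 0"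
  obtains s where "s \<in> {1, -1}" "1 \<le> one_norm (\<chi> j. if j \<in> N then 0 else s * m $ j)"
    "one_norm (\<chi> j. if j \<in> N then 0 else s * m $ j) \<le> 2"
    "(\<Sum>i\<in>UNIV. (\<chi> j. if j \<in> N then 0 else s * m $ j) $ i) \<in> {0, -1}"
proof -
  define S1 where "S1 = (\<Sum>i\<in>N. m $ i)"
  define S2 where "S2 = (\<Sum>i\<in>- N. m $ i)"
  define T1 where "T1 = (\<Sum>i\<in>N. \<bar>m $ i\<bar>)"
  define T2 where "T2 = (\<Sum>i\<in>- N. \<bar>m $ i\<bar>)"
  have split: "sum f UNIV = sum f N + sum f (- N)" for f :: "'n \<Rightarrow> int"
    using sum.Int_Diff[of UNIV f N] by (simp add: Compl_eq_Diff_UNIV)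
  have "S1 + S2 \<in> {0, -1}" "T1 + T2 \<le> 2"
    using m by (simp_all add: modes_def one_norm_def split S1_def S2_def T1_def T2_def)
  moreover have "\<bar>S1\<bar> \<le> T1" "\<bar>S2\<bar> \<le> T2"
    by (simp_all add: S1_def S2_def T1_def T2_def sum_abs)
  moreover have "1 \<le> T2"
  proof -
    have "\<bar>m $ j\<bar> \<le> T2" unfolding T2_def using assms(2) by (intro member_le_sum) auto
    then show ?thesis using assms(3) by linarith
  qed
  \<comment> \<open>The values 2 and -2 would use up the whole 1-norm, force \<open>S1 = 0\<close>
    and contradict the condition on the total sum.\<close>
  ultimately have S2: "S2 \<in> {0, -1, 1}" by auto
  define s :: int where "s = (if S2 = 1 then -1 else 1)"
  have 1: "one_norm (\<chi> j. if j \<in> N then 0 else s * m $ j) = T2"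
    by (simp add: one_norm_def split T2_def s_def abs_mult)
  have 2: "(\<Sum>i\<in>UNIV. (\<chi> j. if j \<in> N then 0 else s * m $ j) $ i) = s * S2"
    by (simp add: split S2_def sum_distrib_left)
  have "0 \<le> T1" by (simp add: T1_def sum_nonneg)
  show ?thesis
  proof (rule that)
    show "s \<in> {1, -1}" by (simp add: s_def)
    show "1 \<le> one_norm (\<chi> j. if j \<in> N then 0 else s * m $ j)"
      unfolding 1 by fact
    show "one_norm (\<chi> j. if j \<in> N then 0 else s * m $ j) \<le> 2"
      unfolding 1 using \<open>0 \<le> T1\<close> \<open>T1 + T2 \<le> 2\<close> by linarith
    show "(\<Sum>i\<in>UNIV. (\<chi> j. if j \<in> N then 0 else s * m $ j) $ i) \<in> {0, -1}"
      unfolding 2 using S2 by (auto simp: s_def)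
  qed
qed

text \<open>Giving away a factor 2 produces a direction from the supremum whether or not it is
  attained.\<close>

lemma Max_differential_norm_obtain:
  fixes h :: "'a::euclidean_space \<Rightarrow> real"
  assumes "0 < c" "s \<le> n" "c \<le> Max ((\<lambda>\<mu>. differential_norm \<mu> h x) ` {s..n})"
  obtains \<mu> a where "s \<le> \<mu>" "\<mu> \<le> n" "norm a = 1" "c / 2 \<le> \<bar>differential \<mu> h x a\<bar>"
proof -
  have "Max ((\<lambda>\<mu>. differential_norm \<mu> h x) ` {s..n}) \<in> (\<lambda>\<mu>. differential_norm \<mu> h x) ` {s..n}"
    using assms(2) by (intro Max_in) auto
  then obtain \<mu> where \<mu>: "s \<le> \<mu>" "\<mu> \<le> n" "c \<le> differential_norm \<mu> h x"
    using assms(3) by auto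
  obtain b :: 'a where "b \<in> Basis" using nonempty_Basis by blast
  then have "sphere 0 1 \<noteq> ({} :: 'a set)" by (auto intro: exI[of _ b])
  moreover have "c / 2 < (SUP a\<in>sphere 0 1. \<bar>differential \<mu> h x a\<bar>)"
    using \<mu>(3) \<open>0 < c\<close> by (simp add: differential_norm_def)
  ultimately obtain a where "a \<in> sphere 0 1" "c / 2 < \<bar>differential \<mu> h x a\<bar>"
    using less_cSupD[of "(\<lambda>a. \<bar>differential \<mu> h x a\<bar>) ` sphere 0 1" "c / 2"] by blast
  with \<mu> show ?thesis by (intro that[of \<mu> a]) auto
qed

text \<open>Modes supported in the first block are treated like large |k|: there \<open>L\<close> is
  0, so the term with \<open>m\<close> vanishes. The minimum collects what the two cases leave: c2/2
  - c2/8 is at least c2/4, and c3/2 has to be divided by |k| < \<open>K_star\<close>.\<close>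

lemma nondegeneracy_lower_bound:
  fixes N11 :: "'n1::finite set" and N21 :: "'n2::finite set" and P :: "(real ^ 'n3::finite) set"
    and W :: "'n2 \<Rightarrow> (real ^ 'n3) list \<Rightarrow> real ^ 'n3 \<Rightarrow> real" and L :: "'n1 \<Rightarrow> (real ^ 'n3) list \<Rightarrow> real ^ 'n3 \<Rightarrow> real"
  assumes P: "open P" and pos: "0 < \<alpha>" "0 < c1" "0 < c2" "0 < c3"
    and W: "\<And>i. jet \<alpha> P (W i)" "\<And>i \<xi>. \<xi> \<in> P \<Longrightarrow> W i [] \<xi> = w \<xi> $ i"
    and L: "\<And>j. jet \<alpha> P (L j)" "\<And>j \<xi>. j \<notin> N11 \<Longrightarrow> \<xi> \<in> P \<Longrightarrow> L j [] \<xi> = Im (Lam \<xi> $ j)"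
      "\<And>j bs \<xi>. j \<in> N11 \<Longrightarrow> L j bs \<xi> = 0"
      "\<And>j bs \<xi>. bs \<in> multi_indices {..\<alpha>} \<Longrightarrow> \<xi> \<in> P \<Longrightarrow> \<bar>L j bs \<xi>\<bar> \<le> 2 * c1"
    and c2: "\<forall>\<xi>\<in>P. \<forall>b. norm b = 1 \<longrightarrow>
        c2 \<le> Max ((\<lambda>\<mu>. differential_norm \<mu> (\<lambda>\<xi>. b \<bullet> w \<xi>) \<xi>) ` {(if - N21 = {} then 0 else 1)..\<alpha>})"
    and K_star: "K_star = 32 * c1 / c2 * real CARD('n3) powr (real \<alpha> / 2)"
    and c3: "\<forall>\<xi>\<in>P. \<forall>k m.
        0 < norm (real_vec k) \<and> norm (real_vec k) < K_star \<and>
        (\<forall>j\<in>N11. m $ j = 0) \<and> 1 \<le> one_norm m \<and> one_norm m \<le> 2 \<and> (\<Sum>j\<in>UNIV. m $ j) \<in> {0, -1} \<longrightarrow>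
        c3 * \<epsilon> powr q 5 \<le>
          Max ((\<lambda>\<mu>. differential_norm \<mu> (f_km q N11 w0 w Lam \<epsilon> k m) \<xi>) ` {1..\<alpha>})"
    and \<epsilon>: "0 < \<epsilon>" "\<epsilon> \<le> 1" "q 5 \<le> q 3"
    and k: "k \<noteq> 0" and m: "m \<in> modes" and z: "- N21 = {} \<Longrightarrow> z = 0" and x: "x \<in> P"
  shows "\<exists>\<mu>\<le>\<alpha>. \<exists>a. norm a = 1 \<and> min (c2 / 4) (c3 / (2 * K_star)) \<le> \<bar>jet_diff \<mu>
    (\<lambda>bs x. (if bs = [] then z else 0)
      + (\<Sum>i\<in>UNIV. real_of_int (k $ i) / norm (real_vec k) * W i bs x)
      + (\<Sum>j\<in>UNIV. \<epsilon> powr (q 3 - q 5) * real_of_int (m $ j) / norm (real_vec k) * L j bs x)) x a\<bar>"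
proof -
  define N where "N = sqrt (real CARD('n3)) ^ \<alpha>"
  have "0 < N" by (simp add: N_def)
  have N_eq: "real CARD('n3) powr (real \<alpha> / 2) = N"
    by (simp add: N_def powr_half_sqrt[symmetric] powr_powr flip: powr_realpow)
  have "0 < K_star" unfolding K_star N_eq using pos \<open>0 < N\<close> by simp
  define \<kappa> where "\<kappa> = norm (real_vec k)"
  have "1 \<le> \<kappa>" using norm_real_vec_ge_1[OF k] by (simp add: \<kappa>_def)
  define \<theta> where "\<theta> = \<epsilon> powr (q 3 - q 5)"
  have \<theta>: "0 \<le> \<theta>" "\<theta> \<le> 1" using \<epsilon> by (auto simp: \<theta>_def intro: powr_le1)
  define Z :: "(real ^ 'n3) list \<Rightarrow> real ^ 'n3 \<Rightarrow> real" where "Z = (\<lambda>bs x. if bs = [] then z else 0)"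
  define V where "V = (\<lambda>bs x. \<Sum>i\<in>UNIV. real_of_int (k $ i) / \<kappa> * W i bs x)"
  define U where "U = (\<lambda>bs x. \<Sum>j\<in>UNIV. \<theta> * real_of_int (m $ j) / \<kappa> * L j bs x)"
  define G where "G = (\<lambda>bs x. Z bs x + V bs x + U bs x)"
  have G_diff: "jet_diff \<mu> G x a = jet_diff \<mu> Z x a + jet_diff \<mu> V x a + jet_diff \<mu> U x a" for \<mu> a
    by (simp add: G_def jet_diff_add)
  have "\<exists>\<mu>\<le>\<alpha>. \<exists>a. norm a = 1 \<and> min (c2 / 4) (c3 / (2 * K_star)) \<le> \<bar>jet_diff \<mu> G x a\<bar>"
  proof (cases "K_star \<le> \<kappa> \<or> (\<forall>j\<in>- N11. m $ j = 0)")
    case True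
    define b where "b = (1 / \<kappa>) *\<^sub>R real_vec k"
    have "norm b = 1" using \<open>1 \<le> \<kappa>\<close> by (simp add: b_def flip: \<kappa>_def)
    then have "c2 \<le> Max ((\<lambda>\<mu>. differential_norm \<mu> (\<lambda>\<xi>. b \<bullet> w \<xi>) x) ` {(if - N21 = {} then 0 else 1)..\<alpha>})"
      using c2 x by blast
    then obtain \<mu> a where \<mu>: "(if - N21 = {} then 0 else 1) \<le> \<mu>" "\<mu> \<le> \<alpha>" "norm a = 1"
      and low: "c2 / 2 \<le> \<bar>differential \<mu> (\<lambda>\<xi>. b \<bullet> w \<xi>) x a\<bar>"
      using pos by (elim Max_differential_norm_obtain[rotated 2]) (auto split: if_splits)
    have "differential \<mu> (\<lambda>\<xi>. b \<bullet> w \<xi>) x a = jet_diff \<mu> V x a"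
    proof (rule differential_eq_jet_diff[OF P _ _ x \<mu>(2)])
      show "jet \<alpha> P V" unfolding V_def by (intro jet_sum jet_cmult W)
      show "b \<bullet> w \<xi> = V [] \<xi>" if "\<xi> \<in> P" for \<xi>
        using that by (simp add: V_def W(2) b_def inner_vec_def real_vec_def)
    qed
    \<comment> \<open>Order 0 can occur only without a second block of angles, and then
      \<open>z = 0\<close>; every positive order kills the constant.\<close>
    moreover have "jet_diff \<mu> Z x a = 0"
    proof (cases "\<mu> = 0")
      case True
      then have "z = 0" using \<mu>(1) z by (auto split: if_splits)
      then show ?thesis by (simp add: jet_diff_def Z_def cong: if_cong)
    next
      case False
      then show ?thesis unfolding jet_diff_def Z_def
        by (intro sum.neutral) (auto simp: multi_indices_def)
    qed
    moreover have "\<bar>jet_diff \<mu> U x a\<bar> \<le> c2 / 8"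
    proof -
      have "\<bar>U bs x\<bar> \<le> 4 * c1 / K_star" if bs: "bs \<in> multi_indices {\<mu>}" for bs
      proof (cases "K_star \<le> \<kappa>")
        case True
        have bs': "bs \<in> multi_indices {..\<alpha>}" using bs \<mu>(2) by (auto elim: multi_indices_mono)
        have "\<bar>\<theta> * real_of_int (m $ j) / \<kappa> * L j bs x\<bar> \<le> \<bar>real_of_int (m $ j)\<bar> * (2 * c1 / K_star)" for j
        proof -
          have "\<bar>\<theta> * real_of_int (m $ j) / \<kappa> * L j bs x\<bar> = (\<theta> * \<bar>real_of_int (m $ j)\<bar>) * (\<bar>L j bs x\<bar> / \<kappa>)"
            using \<theta> \<open>1 \<le> \<kappa>\<close> by (simp add: abs_mult)
          also have "\<dots> \<le> (1 * \<bar>real_of_int (m $ j)\<bar>) * (2 * c1 / K_star)"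
            using \<theta> \<open>1 \<le> \<kappa>\<close> True \<open>0 < K_star\<close> pos L(4)[OF bs' x]
            by (intro mult_mono frac_le) auto
          finally show ?thesis by simp
        qed
        then have "\<bar>U bs x\<bar> \<le> (\<Sum>j\<in>UNIV. \<bar>real_of_int (m $ j)\<bar> * (2 * c1 / K_star))"
          unfolding U_def by (intro order_trans[OF sum_abs] sum_mono)
        also have "\<dots> = (\<Sum>j\<in>UNIV. \<bar>real_of_int (m $ j)\<bar>) * (2 * c1 / K_star)"
          by (rule sum_distrib_right[symmetric])
        also have "\<dots> \<le> 2 * (2 * c1 / K_star)"
          using \<open>0 < K_star\<close> pos by (intro mult_right_mono sum_abs_modes_le m) auto
        finally show ?thesis by simp
      next
        case False
        then have "\<theta> * real_of_int (m $ j) / \<kappa> * L j bs x = 0" for j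
          using True L(3) by (cases "j \<in> N11") auto
        then have "U bs x = 0" unfolding U_def by (intro sum.neutral) blast
        then show ?thesis using pos \<open>0 < K_star\<close> by simp
      qed
      then have "\<bar>jet_diff \<mu> U x a\<bar> \<le> 4 * c1 / K_star * N"
        unfolding N_def using jet_diff_bound[OF \<mu>(3,2), of U x "4 * c1 / K_star"] by simp
      \<comment> \<open>The number 32 in \<open>K_star\<close> is 2 * 2 * 8: the 1-norm of a mode is
        at most 2, \<open>L\<close> is bounded by \<open>2 * c1\<close>, and an eighth of
        \<open>c2\<close> is given away. The power of the dimension is \<open>N\<close>.\<close>
      also have "\<dots> = c2 / 8"
        unfolding K_star N_eq using pos \<open>0 < N\<close> by (simp add: field_simps)
      finally show ?thesis .
    qed
    ultimately have "c2 / 4 \<le> \<bar>jet_diff \<mu> G x a\<bar>"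
      unfolding G_diff using low pos by linarith
    then show ?thesis using \<mu> by (intro exI[of _ \<mu>] exI[of _ a] conjI) auto
  next
    case False
    then have "\<kappa> < K_star" by simp
    from False obtain j0 where "j0 \<in> - N11" "m $ j0 \<noteq> 0" by blast
    then obtain s where s: "s \<in> {1, -1}"
      and m': "1 \<le> one_norm (\<chi> j. if j \<in> N11 then 0 else s * m $ j)"
        "one_norm (\<chi> j. if j \<in> N11 then 0 else s * m $ j) \<le> 2"
        "(\<Sum>i\<in>UNIV. (\<chi> j. if j \<in> N11 then 0 else s * m $ j) $ i) \<in> {0, -1}"
      by (rule modes_second_block[OF m])
    define m' where "m' = (\<chi> j. if j \<in> N11 then 0 else s * m $ j)"
    \<comment> \<open>\<open>k\<close> changes sign together with \<open>m\<close>: apart from the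
      first block, which does not enter, \<open>f_km\<close> is odd in the pair, so absolute values
      of its differentials are preserved.\<close>
    define k' where "k' = (\<chi> i. s * k $ i)"
    have "real_vec k' = of_int s *\<^sub>R real_vec k"
      by (simp add: k'_def real_vec_def vec_eq_iff)
    then have "norm (real_vec k') = \<kappa>" using s by (auto simp: \<kappa>_def)
    then have "0 < norm (real_vec k') \<and> norm (real_vec k') < K_star \<and>
        (\<forall>j\<in>N11. m' $ j = 0) \<and> 1 \<le> one_norm m' \<and> one_norm m' \<le> 2 \<and> (\<Sum>j\<in>UNIV. m' $ j) \<in> {0, -1}"
      using \<open>1 \<le> \<kappa>\<close> \<open>\<kappa> < K_star\<close> m' unfolding m'_def by simp
    then have "c3 * \<epsilon> powr q 5 \<le>
          Max ((\<lambda>\<mu>. differential_norm \<mu> (f_km q N11 w0 w Lam \<epsilon> k' m') x) ` {1..\<alpha>})"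
      using c3 x by blast
    moreover have "0 < c3 * \<epsilon> powr q 5" "1 \<le> \<alpha>" using pos \<epsilon> by auto
    ultimately obtain \<mu> a where \<mu>: "1 \<le> \<mu>" "\<mu> \<le> \<alpha>" "norm a = 1"
      and low: "c3 * \<epsilon> powr q 5 / 2 \<le> \<bar>differential \<mu> (f_km q N11 w0 w Lam \<epsilon> k' m') x a\<bar>"
      by (elim Max_differential_norm_obtain[rotated 2]) auto
    define F where "F = (\<lambda>bs x. (if bs = [] then real_vec k' \<bullet> w0 else 0)
      + \<epsilon> powr q 5 * (\<Sum>i\<in>UNIV. real_of_int (k' $ i) * W i bs x)
      + \<epsilon> powr q 3 * (\<Sum>j\<in>UNIV. real_of_int (m' $ j) * L j bs x))"
    have "differential \<mu> (f_km q N11 w0 w Lam \<epsilon> k' m') x a = jet_diff \<mu> F x a"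
    proof (rule differential_eq_jet_diff[OF P _ _ x \<mu>(2)])
      show "jet \<alpha> P F"
        unfolding F_def by (intro jet_add jet_const jet_cmult jet_sum W L)
      show "f_km q N11 w0 w Lam \<epsilon> k' m' \<xi> = F [] \<xi>" if "\<xi> \<in> P" for \<xi>
      proof -
        have "(\<Sum>j\<in>UNIV. real_of_int (m' $ j) * L j [] \<xi>) = (\<Sum>j\<in>- N11. real_of_int (m' $ j) * Im (Lam \<xi> $ j))"
          using that by (intro sum.mono_neutral_cong_right) (auto simp: L(2,3))
        moreover have "(\<Sum>i\<in>UNIV. real_of_int (k' $ i) * W i [] \<xi>) = real_vec k' \<bullet> w \<xi>"
          using that by (simp add: W(2) inner_vec_def real_vec_def)
        ultimately show ?thesis by (simp add: f_km_def F_def inner_add_right)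
      qed
    qed
    \<comment> \<open>The two functions have unrelated constant terms, but
      \<open>1 \<le> \<mu>\<close>, so only nonempty lists occur.\<close>
    also have "jet_diff \<mu> F x a = jet_diff \<mu> (\<lambda>bs x. (of_int s * \<epsilon> powr q 5 * \<kappa>) * G bs x) x a"
    proof (rule jet_diff_cong)
      fix bs :: "(real ^ 'n3) list" assume "bs \<in> multi_indices {\<mu>}"
      then have "bs \<noteq> []" using \<mu>(1) by (auto simp: multi_indices_def)
      have "\<epsilon> powr q 3 = \<epsilon> powr q 5 * \<theta>"
        unfolding \<theta>_def by (simp flip: powr_add)
      moreover have "(\<Sum>j\<in>UNIV. real_of_int (m' $ j) * L j bs x) = (\<Sum>j\<in>UNIV. of_int s * real_of_int (m $ j) * L j bs x)"
        by (intro sum.cong refl) (simp add: m'_def L(3))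
      ultimately have "F bs x = \<epsilon> powr q 5 * (\<Sum>i\<in>UNIV. of_int s * real_of_int (k $ i) * W i bs x)
          + \<epsilon> powr q 5 * \<theta> * (\<Sum>j\<in>UNIV. of_int s * real_of_int (m $ j) * L j bs x)"
        using \<open>bs \<noteq> []\<close> by (simp add: F_def k'_def)
      then show "F bs x = of_int s * \<epsilon> powr q 5 * \<kappa> * G bs x"
        using \<open>bs \<noteq> []\<close> \<open>1 \<le> \<kappa>\<close>
        by (simp add: G_def Z_def V_def U_def distrib_left sum_distrib_left mult_ac)
    qed
    also have "\<dots> = (of_int s * \<epsilon> powr q 5 * \<kappa>) * jet_diff \<mu> G x a"
      by (rule jet_diff_cmult)
    finally have "c3 * \<epsilon> powr q 5 / 2 \<le> \<epsilon> powr q 5 * (\<kappa> * \<bar>jet_diff \<mu> G x a\<bar>)"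
      using low s \<open>1 \<le> \<kappa>\<close> by (auto simp: abs_mult mult_ac)
    then have "c3 / 2 \<le> \<kappa> * \<bar>jet_diff \<mu> G x a\<bar>"
      using \<epsilon>(1) mult_le_cancel_left_pos[of "\<epsilon> powr q 5" "c3 / 2" "\<kappa> * \<bar>jet_diff \<mu> G x a\<bar>"]
      by (simp add: mult_ac)
    also have "\<dots> \<le> K_star * \<bar>jet_diff \<mu> G x a\<bar>"
      using \<open>\<kappa> < K_star\<close> by (intro mult_right_mono) auto
    finally have "c3 / (2 * K_star) \<le> \<bar>jet_diff \<mu> G x a\<bar>"
      using \<open>0 < K_star\<close> by (simp add: field_simps)
    then show ?thesis using \<mu> by (intro exI[of _ \<mu>] exI[of _ a] conjI) auto
  qed
  then show ?thesis by (simp add: G_def Z_def V_def U_def \<theta>_def \<kappa>_def)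
qed

section \<open>Small divisors as perturbations of fixed linear combinations\<close>

text \<open>The analogue for real-valued functions and jets of \<open>Ck_norm_le_closed\<close>.\<close>

definition jet_bound ::
    "nat \<Rightarrow> 'a set \<Rightarrow> 'a set \<Rightarrow> ('a::euclidean_space \<Rightarrow> real) \<Rightarrow> real \<Rightarrow> bool" where
  "jet_bound n S T f M \<longleftrightarrow>
     (\<exists>J. jet n S J \<and> (\<forall>bs\<in>multi_indices {..n}. \<forall>x\<in>S. \<bar>J bs x\<bar> \<le> M) \<and> (\<forall>x\<in>T. J [] x = f x))"

lemma jet_bound_linear_image:
  assumes "Ck_norm_le n S f M" "bounded_linear L" "\<And>y. \<bar>L y\<bar> \<le> norm y" "T \<subseteq> S"
  shows "jet_bound n S T (\<lambda>x. L (f x)) M"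
  unfolding jet_bound_def
proof (intro exI conjI ballI)
  show "jet n S (\<lambda>bs x. L (pderivs bs f x))"
    using assms(1,2) by (intro jet_linear_image) (auto simp: Ck_norm_le_def)
  show "\<bar>L (pderivs bs f x)\<bar> \<le> M" if "bs \<in> multi_indices {..n}" "x \<in> S" for bs x
    using assms(1) that order_trans[OF assms(3)] by (auto simp: Ck_norm_le_def)
qed (simp add: pderivs_def)

lemma jet_bound_closed_linear_image:
  assumes "Ck_norm_le_closed n S T f M" "bounded_linear L" "\<And>y. \<bar>L y\<bar> \<le> norm y" "T \<subseteq> S"
  shows "jet_bound n S T (\<lambda>x. L (f x)) M"
proof -
  obtain F where F: "Ck_norm_le n S F M" "\<And>x. x \<in> T \<Longrightarrow> F x = f x"
    using assms(1) by (auto simp: Ck_norm_le_closed_def)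
  have "jet_bound n S T (\<lambda>x. L (F x)) M"
    using F(1) assms(2-4) by (rule jet_bound_linear_image)
  then show ?thesis using F(2) by (simp add: jet_bound_def)
qed

lemmas jet_bound_real = jet_bound_linear_image[OF _ bounded_linear_ident, simplified]
lemmas jet_bound_closed_real = jet_bound_closed_linear_image[OF _ bounded_linear_ident, simplified]
lemmas jet_bound_Im = jet_bound_linear_image[OF _ bounded_linear_Im abs_Im_le_cmod]
lemmas jet_bound_closed_Im = jet_bound_closed_linear_image[OF _ bounded_linear_Im abs_Im_le_cmod]

lemma jet_bound_cong: "jet_bound n S T f M \<Longrightarrow> (\<And>x. x \<in> T \<Longrightarrow> f x = g x) \<Longrightarrow> jet_bound n S T g M"
  by (simp add: jet_bound_def)

lemma jet_bound_mono: "jet_bound n S T f M \<Longrightarrow> M \<le> M' \<Longrightarrow> jet_bound n S T f M'"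
  unfolding jet_bound_def by (meson order_trans)

lemma jet_bound_add:
  fixes f g :: "'a::euclidean_space \<Rightarrow> real"
  assumes "jet_bound n S T f M" "jet_bound n S T g M'"
  shows "jet_bound n S T (\<lambda>x. f x + g x) (M + M')"
proof -
  obtain J K where J: "jet n S J" "\<forall>bs\<in>multi_indices {..n}. \<forall>x\<in>S. \<bar>J bs x\<bar> \<le> M" "\<forall>x\<in>T. J [] x = f x"
    and K: "jet n S K" "\<forall>bs\<in>multi_indices {..n}. \<forall>x\<in>S. \<bar>K bs x\<bar> \<le> M'" "\<forall>x\<in>T. K [] x = g x"
    using assms unfolding jet_bound_def by blast
  show ?thesis unfolding jet_bound_def
  proof (intro exI[of _ "\<lambda>bs x. J bs x + K bs x"] conjI ballI)
    fix bs :: "'a list" and x assume "bs \<in> multi_indices {..n}" "x \<in> S"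
    then have "\<bar>J bs x\<bar> \<le> M" "\<bar>K bs x\<bar> \<le> M'" using J(2) K(2) by blast+
    then show "\<bar>J bs x + K bs x\<bar> \<le> M + M'" by linarith
  qed (use J K in \<open>simp_all add: jet_add\<close>)
qed

lemma jet_bound_cmult:
  assumes "jet_bound n S T f M"
  shows "jet_bound n S T (\<lambda>x. c * f x) (\<bar>c\<bar> * M)"
proof -
  obtain J where J: "jet n S J" "\<forall>bs\<in>multi_indices {..n}. \<forall>x\<in>S. \<bar>J bs x\<bar> \<le> M" "\<forall>x\<in>T. J [] x = f x"
    using assms unfolding jet_bound_def by blast
  show ?thesis unfolding jet_bound_def
    using J by (intro exI[of _ "\<lambda>bs x. c * J bs x"] conjI ballI)
      (simp_all add: jet_cmult abs_mult mult_left_mono)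
qed

lemma jet_bound_zero: "0 \<le> M \<Longrightarrow> jet_bound n S T (\<lambda>x. 0) M"
  unfolding jet_bound_def by (intro exI[of _ "\<lambda>bs x. 0"]) (simp add: jet_zero)

lemma jet_bound_sum:
  assumes "finite I" "\<And>i. i \<in> I \<Longrightarrow> jet_bound n S T (f i) (M i)"
  shows "jet_bound n S T (\<lambda>x. \<Sum>i\<in>I. f i x) (\<Sum>i\<in>I. M i)"
  using assms by (induction I rule: finite_induct) (auto intro: jet_bound_zero jet_bound_add)

lemma Im_small_divisor:
  "Im (small_divisor k m w lam) = (\<Sum>i\<in>UNIV. real_of_int (k $ i) * w $ i) + (\<Sum>j\<in>UNIV. real_of_int (m $ j) * Im (lam $ j))"
  by (simp add: small_divisor_def inner_vec_def real_vec_def)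

text \<open>After division by |k| the coefficients of the frequency errors are at most 1 and those
  of the eigenvalue errors at most 2, so the total error is uniform in \<open>k\<close> and
  \<open>m\<close>. The shifts \<open>y i\<close> are kept apart because they need not stay bounded
  as \<open>e\<close> tends to 0.\<close>

lemma small_divisor_approx:
  fixes k :: "int ^ 'n2::finite" and m :: "int ^ 'n1::finite"
  assumes w: "\<And>i. jet_bound n S T (\<lambda>\<xi>. w \<xi> $ i / e - (y i + V i \<xi>)) \<eta>"
    and lam: "\<And>j. jet_bound n S T (\<lambda>\<xi>. Im (lam \<xi> $ j) / e - \<theta> * U j \<xi>) \<eta>"
    and "0 < e" "0 \<le> \<eta>" "k \<noteq> 0" "m \<in> modes"
  shows "jet_bound n S T (\<lambda>\<xi>. Im (small_divisor k m (w \<xi>) (lam \<xi>)) / (e * norm (real_vec k))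
      - ((\<Sum>i\<in>UNIV. real_of_int (k $ i) / norm (real_vec k) * y i)
         + (\<Sum>i\<in>UNIV. real_of_int (k $ i) / norm (real_vec k) * V i \<xi>)
         + (\<Sum>j\<in>UNIV. \<theta> * real_of_int (m $ j) / norm (real_vec k) * U j \<xi>)))
    ((real CARD('n2) + 2 * real CARD('n1)) * \<eta>)"
proof -
  define \<kappa> where "\<kappa> = norm (real_vec k)"
  have \<kappa>: "1 \<le> \<kappa>" using norm_real_vec_ge_1[OF \<open>k \<noteq> 0\<close>] by (simp add: \<kappa>_def)
  have "jet_bound n S T (\<lambda>\<xi>. real_of_int (k $ i) / \<kappa> * (w \<xi> $ i / e - (y i + V i \<xi>))) \<eta>" for i
  proof (rule jet_bound_mono[OF jet_bound_cmult[OF w]])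
    have "\<bar>real_of_int (k $ i) / \<kappa>\<bar> \<le> 1"
      using \<kappa> abs_le_norm_real_vec[of k i] by (auto simp: \<kappa>_def divide_le_eq_1)
    then show "\<bar>real_of_int (k $ i) / \<kappa>\<bar> * \<eta> \<le> \<eta>" using mult_right_mono[OF _ \<open>0 \<le> \<eta>\<close>] by fastforce
  qed
  moreover have "jet_bound n S T (\<lambda>\<xi>. real_of_int (m $ j) / \<kappa> * (Im (lam \<xi> $ j) / e - \<theta> * U j \<xi>)) (2 * \<eta>)" for j
  proof (rule jet_bound_mono[OF jet_bound_cmult[OF lam]])
    have "\<bar>real_of_int (m $ j)\<bar> \<le> 2 * \<kappa>"
      using \<kappa> modes_abs_le[OF \<open>m \<in> modes\<close>, of j] by linarith
    then have "\<bar>real_of_int (m $ j) / \<kappa>\<bar> \<le> 2"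
      using \<kappa> by (simp add: field_simps)
    then show "\<bar>real_of_int (m $ j) / \<kappa>\<bar> * \<eta> \<le> 2 * \<eta>" using \<open>0 \<le> \<eta>\<close> by (rule mult_right_mono)
  qed
  ultimately have "jet_bound n S T
      (\<lambda>\<xi>. (\<Sum>i\<in>UNIV. real_of_int (k $ i) / \<kappa> * (w \<xi> $ i / e - (y i + V i \<xi>)))
        + (\<Sum>j\<in>UNIV. real_of_int (m $ j) / \<kappa> * (Im (lam \<xi> $ j) / e - \<theta> * U j \<xi>)))
      ((\<Sum>i\<in>(UNIV :: 'n2 set). \<eta>) + (\<Sum>j\<in>(UNIV :: 'n1 set). 2 * \<eta>))"
    by (intro jet_bound_add jet_bound_sum) auto
  then have "jet_bound n S T
      (\<lambda>\<xi>. (\<Sum>i\<in>UNIV. real_of_int (k $ i) / \<kappa> * (w \<xi> $ i / e - (y i + V i \<xi>)))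
        + (\<Sum>j\<in>UNIV. real_of_int (m $ j) / \<kappa> * (Im (lam \<xi> $ j) / e - \<theta> * U j \<xi>)))
      ((real CARD('n2) + 2 * real CARD('n1)) * \<eta>)"
    by (simp add: algebra_simps)
  then show ?thesis
  proof (rule jet_bound_cong)
    fix \<xi>
    show "(\<Sum>i\<in>UNIV. real_of_int (k $ i) / \<kappa> * (w \<xi> $ i / e - (y i + V i \<xi>)))
        + (\<Sum>j\<in>UNIV. real_of_int (m $ j) / \<kappa> * (Im (lam \<xi> $ j) / e - \<theta> * U j \<xi>))
      = Im (small_divisor k m (w \<xi>) (lam \<xi>)) / (e * norm (real_vec k))
      - ((\<Sum>i\<in>UNIV. real_of_int (k $ i) / norm (real_vec k) * y i)
         + (\<Sum>i\<in>UNIV. real_of_int (k $ i) / norm (real_vec k) * V i \<xi>)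
         + (\<Sum>j\<in>UNIV. \<theta> * real_of_int (m $ j) / norm (real_vec k) * U j \<xi>))"
      unfolding Im_small_divisor \<kappa>_def[symmetric] add_divide_distrib sum_divide_distrib
      by (simp add: right_diff_distrib distrib_left sum_subtractf sum.distrib mult_ac add_divide_distrib)
  qed
qed

section \<open>Uniform estimates along the iteration and the measure of the Cantor set\<close>

theorem theorem3:
  fixes N11 :: "'n1::finite set" and N21 :: "'n2::finite set"
    and \<Omega> :: "(real ^ 'n1) set" and P :: "(real ^ 'n3::finite) set"
    and q :: "nat \<Rightarrow> real" and \<alpha> :: nat and l \<iota> r c0 c1 c2 c \<epsilon>_star \<gamma>_star :: real
    and \<omega> :: "real ^ 'n3 \<Rightarrow> real \<Rightarrow> real ^ 'n2"
    and A :: "real ^ 'n3 \<Rightarrow> real \<Rightarrow> real ^ 'n1 ^ 'n1"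
    and B :: "real ^ 'n3 \<Rightarrow> real \<Rightarrow> complex ^ 'n1 ^ 'n1"
    and \<Lambda> :: "real ^ 'n3 \<Rightarrow> real \<Rightarrow> complex ^ 'n1"
    and g12 :: "(real ^ 'n1) \<times> (real ^ 'n2) \<Rightarrow> real ^ 'n3 \<Rightarrow> real \<Rightarrow> real ^ 'n1"
    and g34 :: "(real ^ 'n1) \<times> (real ^ 'n2) \<Rightarrow> real ^ 'n3 \<Rightarrow> real \<Rightarrow> real ^ 'n2"
    and \<omega>20 :: "real ^ 'n2" and \<omega>21 \<omega>_tilde :: "real ^ 'n3 \<Rightarrow> real ^ 'n2" and \<omega>_tilde0 :: "real ^ 'n2"
    and K_star :: real
    and \<epsilon>0 :: "real \<Rightarrow> real"
    and P\<nu> :: "real \<Rightarrow> real \<Rightarrow> nat \<Rightarrow> (real ^ 'n3) set"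
    and \<omega>\<nu> :: "real \<Rightarrow> real \<Rightarrow> nat \<Rightarrow> real ^ 'n3 \<Rightarrow> real ^ 'n2"
    and \<Lambda>\<nu> :: "real \<Rightarrow> real \<Rightarrow> nat \<Rightarrow> real ^ 'n3 \<Rightarrow> complex ^ 'n1"
    and P\<gamma> :: "real \<Rightarrow> real \<Rightarrow> (real ^ 'n3) set"
  \<comment> \<open>domains\<close>
  assumes Omega: "open \<Omega>" "convex \<Omega>" "0 \<in> \<Omega>" "is_block_product N11 \<Omega>" "is_radius \<Omega> r"
    and Pi: "open P" "convex P" "bounded P" "0 < measure lebesgue P"
  \<comment> \<open>(H1)\<close>
    and H1: "\<forall>j\<in>{1..7}. 0 \<le> q j" "q 1 > q 3" "q 3 \<ge> q 5" "q 7 \<ge> q 2 + q 5"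
      "0 < q 2" "q 2 \<le> min (q 4) (q 6)"
  \<comment> \<open>(H2)\<close>
    and pos_constants: "0 < \<alpha>" "0 < c0" "0 < c1" "0 < \<epsilon>_star"
    and H2_smooth: "\<forall>\<epsilon>\<in>{0<..\<epsilon>_star}.
        (\<forall>i. Ck_on \<alpha> P (\<lambda>\<xi>. \<omega> \<xi> \<epsilon> $ i)) \<and> (\<forall>i j. Ck_on \<alpha> P (\<lambda>\<xi>. A \<xi> \<epsilon> $ i $ j))"
    and H2_diag: "\<forall>\<epsilon>\<in>{0<..\<epsilon>_star}. \<forall>\<xi>\<in>P.
        block_diagonal N11 (B \<xi> \<epsilon>) \<and> invertible (B \<xi> \<epsilon>) \<and>
        map_matrix complex_of_real (A \<xi> \<epsilon>) = B \<xi> \<epsilon> ** diag (\<Lambda> \<xi> \<epsilon>) ** matrix_inv (B \<xi> \<epsilon>)"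
    and H2_spectrum: "\<forall>\<epsilon>\<in>{0<..\<epsilon>_star}. \<forall>\<xi>\<in>P.
        (\<forall>j. c0 \<le> cmod (\<Lambda> \<xi> \<epsilon> $ j)) \<and>
        (\<forall>i j. i \<noteq> j \<and> same_block N11 i j \<longrightarrow> c0 \<le> cmod (\<Lambda> \<xi> \<epsilon> $ j - \<Lambda> \<xi> \<epsilon> $ i))"
    and H2_bounds: "\<forall>\<epsilon>\<in>{0<..\<epsilon>_star}.
        (\<forall>i j. Ck_norm_le \<alpha> P (\<lambda>\<xi>. B \<xi> \<epsilon> $ i $ j) c1 \<and>
               Ck_norm_le \<alpha> P (\<lambda>\<xi>. matrix_inv (B \<xi> \<epsilon>) $ i $ j) c1) \<and>
        (\<forall>j. Ck_norm_le \<alpha> P (\<lambda>\<xi>. \<Lambda> \<xi> \<epsilon> $ j) c1)"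
    and H2_freq: "\<forall>\<epsilon>\<in>{0<..\<epsilon>_star}. \<forall>\<xi>\<in>P. \<forall>i.
        \<bar>\<omega> \<xi> \<epsilon> $ i\<bar> \<le> c1 \<and>
        (\<forall>bs\<in>multi_indices {1..\<alpha>}.
           \<bar>pderivs bs (\<lambda>\<xi>. block_scale N21 (\<epsilon> powr q 5) 1 (\<omega> \<xi> \<epsilon>) $ i) \<xi>\<bar> \<le> c1 * \<epsilon> powr q 5)"
  \<comment> \<open>(H3)\<close>
    and H3: "\<exists>M. \<forall>\<epsilon>\<in>{0<..\<epsilon>_star}.
        (\<forall>i. Holder_norm_le l \<alpha> \<Omega> P (\<lambda>x \<xi>. g12 x \<xi> \<epsilon> $ i) M) \<and>
        (\<forall>i. Holder_norm_le l \<alpha> \<Omega> P (\<lambda>x \<xi>. g34 x \<xi> \<epsilon> $ i) M)"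
    and H3_exponents: "l > 2 * (real \<alpha> + 1) * (\<iota> + 2) + real \<alpha> * \<iota>" "\<iota> > real \<alpha> * real CARD('n2) - 1"
  \<comment> \<open>limiting data\<close>
    and limit_omega1: "\<forall>i\<in>N21. \<forall>\<delta>>0. \<forall>\<^sub>F \<epsilon> in at_right 0.
        Ck_norm_le \<alpha> P (\<lambda>\<xi>. \<omega> \<xi> \<epsilon> $ i - \<omega> \<xi> 0 $ i) \<delta>"
    and limit_omega2: "\<forall>i\<in>- N21. \<forall>\<delta>>0. \<forall>\<^sub>F \<epsilon> in at_right 0.
        Ck_norm_le \<alpha> P (\<lambda>\<xi>. \<omega> \<xi> \<epsilon> $ i - (\<omega>20 $ i + \<epsilon> powr q 5 * \<omega>21 \<xi> $ i)) (\<delta> * \<epsilon> powr q 5)"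
    and limit_Lambda2: "\<forall>j\<in>- N11. \<forall>\<delta>>0. \<forall>\<^sub>F \<epsilon> in at_right 0.
        Ck_norm_le \<alpha> P (\<lambda>\<xi>. \<Lambda> \<xi> \<epsilon> $ j - \<Lambda> \<xi> 0 $ j) \<delta>"
    and omega_tilde: "\<omega>_tilde = (\<lambda>\<xi>. col N21 (\<omega> \<xi> 0) (\<omega>21 \<xi>))" "\<omega>_tilde0 = col N21 0 \<omega>20"
  \<comment> \<open>the Cantor set\<close>
    and eps0: "0 < \<gamma>_star" "\<forall>\<gamma>\<in>{0<..\<gamma>_star}. 0 < \<epsilon>0 \<gamma> \<and> \<epsilon>0 \<gamma> \<le> \<epsilon>_star"
      "\<epsilon>0 \<in> o[at_right 0](\<lambda>\<gamma>. \<gamma> powr ((real \<alpha> + 1) / q 2))"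
    and closed_sets: "\<forall>\<gamma>\<in>{0<..\<gamma>_star}. \<forall>\<epsilon>\<in>{0<..\<epsilon>0 \<gamma>}. \<forall>\<nu>. closed (P\<nu> \<gamma> \<epsilon> \<nu>) \<and> P\<nu> \<gamma> \<epsilon> \<nu> \<subseteq> P"
    and initial_set: "\<forall>\<gamma>\<in>{0<..\<gamma>_star}. \<forall>\<epsilon>\<in>{0<..\<epsilon>0 \<gamma>}.
        (\<forall>\<xi>\<in>P\<nu> \<gamma> \<epsilon> 0. \<forall>\<eta>\<in>frontier P. \<gamma> \<le> dist \<xi> \<eta>) \<and>
        measure lebesgue (P - P\<nu> \<gamma> \<epsilon> 0) \<le> c * \<gamma>"
    and initial_data: "\<forall>\<gamma>\<in>{0<..\<gamma>_star}. \<forall>\<epsilon>\<in>{0<..\<epsilon>0 \<gamma>}. \<forall>\<xi>.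
        \<omega>\<nu> \<gamma> \<epsilon> 0 \<xi> = \<omega> \<xi> \<epsilon> \<and> \<Lambda>\<nu> \<gamma> \<epsilon> 0 \<xi> = \<Lambda> \<xi> \<epsilon>"
    and iterates: "\<forall>\<gamma>\<in>{0<..\<gamma>_star}. \<forall>\<epsilon>\<in>{0<..\<epsilon>0 \<gamma>}. \<forall>\<nu>\<ge>1.
        (\<forall>i\<in>N21. Ck_norm_le_closed \<alpha> P (P\<nu> \<gamma> \<epsilon> \<nu>) (\<lambda>\<xi>. \<omega>\<nu> \<gamma> \<epsilon> \<nu> \<xi> $ i - \<omega> \<xi> \<epsilon> $ i) (c * \<epsilon> powr q 6)) \<and>
        (\<forall>i\<in>- N21. Ck_norm_le_closed \<alpha> P (P\<nu> \<gamma> \<epsilon> \<nu>) (\<lambda>\<xi>. \<omega>\<nu> \<gamma> \<epsilon> \<nu> \<xi> $ i - \<omega> \<xi> \<epsilon> $ i) (c * \<epsilon> powr q 7)) \<and>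
        (\<forall>j\<in>N11. Ck_norm_le_closed \<alpha> P (P\<nu> \<gamma> \<epsilon> \<nu>) (\<lambda>\<xi>. \<Lambda>\<nu> \<gamma> \<epsilon> \<nu> \<xi> $ j - \<Lambda> \<xi> \<epsilon> $ j) (c * \<epsilon> powr q 2)) \<and>
        (\<forall>j\<in>- N11. Ck_norm_le_closed \<alpha> P (P\<nu> \<gamma> \<epsilon> \<nu>) (\<lambda>\<xi>. \<Lambda>\<nu> \<gamma> \<epsilon> \<nu> \<xi> $ j - \<Lambda> \<xi> \<epsilon> $ j) (c * \<epsilon> powr q 4))"
    and removal: "\<forall>\<gamma>\<in>{0<..\<gamma>_star}. \<forall>\<epsilon>\<in>{0<..\<epsilon>0 \<gamma>}. \<forall>\<nu>.
        P\<nu> \<gamma> \<epsilon> (Suc \<nu>) = P\<nu> \<gamma> \<epsilon> \<nu> -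
          (\<Union>m\<in>modes. \<Union>k\<in>{k. K_cut r l \<alpha> CARD('n2) \<nu> < norm (real_vec k) \<and>
                                norm (real_vec k) \<le> K_cut r l \<alpha> CARD('n2) (Suc \<nu>)}.
             resonance_zone (P\<nu> \<gamma> \<epsilon> \<nu>)
               (\<lambda>\<xi>. block_scale N21 (\<epsilon> powr q 5) 1 (\<omega>\<nu> \<gamma> \<epsilon> \<nu> \<xi>))
               (\<lambda>\<xi>. block_scale N11 (\<epsilon> powr q 1) (\<epsilon> powr q 3) (\<Lambda>\<nu> \<gamma> \<epsilon> \<nu> \<xi>))
               k m (\<gamma> * \<epsilon> powr q 5 * norm (real_vec k) powr (- \<iota>)))"
    and Cantor_set: "\<forall>\<gamma> \<epsilon>. P\<gamma> \<gamma> \<epsilon> = (\<Inter>\<nu>. P\<nu> \<gamma> \<epsilon> \<nu>)"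
    and tori: "\<forall>\<gamma>\<in>{0<..\<gamma>_star}. \<forall>\<epsilon>\<in>{0<..\<epsilon>0 \<gamma>}. \<forall>\<xi>\<in>P\<gamma> \<gamma> \<epsilon>. \<exists>\<Phi>.
        quasi_periodic_torus
          (multiscale_field q N11 N21 \<epsilon> (A \<xi> \<epsilon>) (\<omega> \<xi> \<epsilon>) (\<lambda>x. g12 x \<xi> \<epsilon>) (\<lambda>x. g34 x \<xi> \<epsilon>)) \<Omega> \<Phi>"
  \<comment> \<open>nondegeneracy\<close>
    and dims: "(\<Sum>j=1..\<alpha>. CARD('n3) ^ j) \<ge> CARD('n2)"
    and i: "\<forall>\<xi>\<in>P.
        (- N21 = {} \<longrightarrow>
           dim (insert (\<omega>_tilde \<xi>) ((\<lambda>bs. pderivs bs \<omega>_tilde \<xi>) ` multi_indices {1..\<alpha>})) = CARD('n2)) \<and>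
        (- N21 \<noteq> {} \<longrightarrow>
           dim ((\<lambda>bs. pderivs bs \<omega>_tilde \<xi>) ` multi_indices {1..\<alpha>}) = CARD('n2))"
    and c2: "0 < c2" "\<forall>\<xi>\<in>P. \<forall>b. norm b = 1 \<longrightarrow>
        c2 \<le> Max ((\<lambda>\<mu>. differential_norm \<mu> (\<lambda>\<xi>. b \<bullet> \<omega>_tilde \<xi>) \<xi>) ` {(if - N21 = {} then 0 else 1)..\<alpha>})"
    and K_star: "K_star = 32 * c1 / c2 * real CARD('n3) powr (real \<alpha> / 2)"
    and ii': "\<exists>c3>0. \<forall>\<^sub>F \<epsilon> in at_right 0. \<forall>\<xi>\<in>P. \<forall>k m.
        0 < norm (real_vec k) \<and> norm (real_vec k) < K_star \<and>
        (\<forall>j\<in>N11. m $ j = 0) \<and> 1 \<le> one_norm m \<and> one_norm m \<le> 2 \<and> (\<Sum>j\<in>UNIV. m $ j) \<in> {0, -1} \<longrightarrow>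
        c3 * \<epsilon> powr q 5 \<le>
          Max ((\<lambda>\<mu>. differential_norm \<mu> (f_km q N11 \<omega>_tilde0 \<omega>_tilde (\<lambda>\<xi>. \<Lambda> \<xi> 0) \<epsilon> k m) \<xi>) ` {1..\<alpha>})"
  shows "\<exists>C>0. \<exists>\<gamma>0>0. \<gamma>0 \<le> \<gamma>_star \<and>
    (\<forall>\<gamma>\<in>{0<..\<gamma>0}. \<forall>\<epsilon>\<in>{0<..\<epsilon>0 \<gamma>}.
       P\<gamma> \<gamma> \<epsilon> \<in> sets lebesgue \<and> \<bar>measure lebesgue (P\<gamma> \<gamma> \<epsilon>) - measure lebesgue P\<bar> \<le> C * \<gamma> powr (1 / real \<alpha>))"
proof -
  define \<eta>c where "\<eta>c = real CARD('n2) + 2 * real CARD('n1)"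
  have "0 < \<eta>c" by (simp add: \<eta>c_def add_pos_pos)
  have q: "q 5 \<le> q 3" "q 3 < q 1" "0 < q 2" "q 2 \<le> q 4" "q 2 \<le> q 6" "q 2 + q 5 \<le> q 7"
    using H1 by auto
  have P_meas: "P \<in> lmeasurable" using Pi by (intro lmeasurable_open)

  have pos_eps: "\<forall>\<^sub>F \<epsilon> in at_right 0. \<epsilon> \<in> {0<..<min 1 \<epsilon>_star}"
    using pos_constants by (intro eventually_at_right_real) simp
  have freq_near: "\<forall>\<^sub>F \<epsilon> in at_right 0.
      (\<forall>i\<in>N21. Ck_norm_le \<alpha> P (\<lambda>\<xi>. \<omega> \<xi> \<epsilon> $ i - \<omega> \<xi> 0 $ i) \<delta>) \<and>
      (\<forall>i\<in>- N21. Ck_norm_le \<alpha> P (\<lambda>\<xi>. \<omega> \<xi> \<epsilon> $ i - (\<omega>20 $ i + \<epsilon> powr q 5 * \<omega>21 \<xi> $ i)) (\<delta> * \<epsilon> powr q 5)) \<and>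
      (\<forall>j\<in>- N11. Ck_norm_le \<alpha> P (\<lambda>\<xi>. \<Lambda> \<xi> \<epsilon> $ j - \<Lambda> \<xi> 0 $ j) \<delta>)" if "0 < \<delta>" for \<delta>
    using that limit_omega1 limit_omega2 limit_Lambda2
    by (intro eventually_conj eventually_ball_finite) auto

  \<comment> \<open>The limits at \<epsilon> = 0 are accessible through their distance to the data
    at small \<epsilon>. Fixing a single such value presents them as differences of smooth
    functions. The tolerance \<open>c1\<close> leads to the bound \<open>2 * c1\<close> on the
    limiting eigenvalues.\<close>
  obtain \<epsilon>' where \<epsilon>': "0 < \<epsilon>'" "\<epsilon>' \<le> \<epsilon>_star"
    and near': "\<And>i. i \<in> N21 \<Longrightarrow> Ck_norm_le \<alpha> P (\<lambda>\<xi>. \<omega> \<xi> \<epsilon>' $ i - \<omega> \<xi> 0 $ i) c1"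
      "\<And>i. i \<in> - N21 \<Longrightarrow> Ck_norm_le \<alpha> P (\<lambda>\<xi>. \<omega> \<xi> \<epsilon>' $ i - (\<omega>20 $ i + \<epsilon>' powr q 5 * \<omega>21 \<xi> $ i)) (c1 * \<epsilon>' powr q 5)"
      "\<And>j. j \<in> - N11 \<Longrightarrow> Ck_norm_le \<alpha> P (\<lambda>\<xi>. \<Lambda> \<xi> \<epsilon>' $ j - \<Lambda> \<xi> 0 $ j) c1"
  proof -
    have "\<exists>\<epsilon>. \<epsilon> \<in> {0<..<min 1 \<epsilon>_star} \<and>
      (\<forall>i\<in>N21. Ck_norm_le \<alpha> P (\<lambda>\<xi>. \<omega> \<xi> \<epsilon> $ i - \<omega> \<xi> 0 $ i) c1) \<and>
      (\<forall>i\<in>- N21. Ck_norm_le \<alpha> P (\<lambda>\<xi>. \<omega> \<xi> \<epsilon> $ i - (\<omega>20 $ i + \<epsilon> powr q 5 * \<omega>21 \<xi> $ i)) (c1 * \<epsilon> powr q 5)) \<and>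
      (\<forall>j\<in>- N11. Ck_norm_le \<alpha> P (\<lambda>\<xi>. \<Lambda> \<xi> \<epsilon> $ j - \<Lambda> \<xi> 0 $ j) c1)"
      by (rule eventually_happens'[OF trivial_limit_at_right_real
            eventually_conj[OF pos_eps freq_near[OF \<open>0 < c1\<close>]]])
    then show ?thesis by (auto intro: that)
  qed

  have "\<exists>J. jet \<alpha> P J \<and> (\<forall>\<xi>\<in>P. J [] \<xi> = \<omega>_tilde \<xi> $ i)" for i
  proof -
    have J1: "jet \<alpha> P (\<lambda>bs. pderivs bs (\<lambda>\<xi>. \<omega> \<xi> \<epsilon>' $ i))"
      using H2_smooth \<epsilon>' by (intro jet_pderivs) simp
    show ?thesis
    proof (cases "i \<in> N21")
      case True
      let ?d = "\<lambda>\<xi>. \<omega> \<xi> \<epsilon>' $ i - \<omega> \<xi> 0 $ i"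
      have J2: "jet \<alpha> P (\<lambda>bs. pderivs bs ?d)"
        using near'(1)[OF True] by (intro jet_pderivs) (simp add: Ck_norm_le_def)
      show ?thesis
        using True
        by (intro exI[of _ "\<lambda>bs \<xi>. pderivs bs (\<lambda>\<xi>. \<omega> \<xi> \<epsilon>' $ i) \<xi> + (-1) * pderivs bs ?d \<xi>"]
            conjI jet_add J1 jet_cmult J2)
          (simp add: pderivs_def omega_tilde col_def)
    next
      case False
      \<comment> \<open>Here \<open>\<omega>21\<close> is recovered by removing the constant
        \<open>\<omega>20\<close>, which affects order 0 only, and dividing by the fixed positive
        number \<open>\<epsilon>' powr q 5\<close>.\<close>
      let ?d = "\<lambda>\<xi>. \<omega> \<xi> \<epsilon>' $ i - (\<omega>20 $ i + \<epsilon>' powr q 5 * \<omega>21 \<xi> $ i)"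
      have J2: "jet \<alpha> P (\<lambda>bs. pderivs bs ?d)"
        using near'(2)[of i] False by (intro jet_pderivs) (simp add: Ck_norm_le_def)
      show ?thesis
        using False \<epsilon>'(1)
        by (intro exI[of _ "\<lambda>bs \<xi>. (1 / \<epsilon>' powr q 5) * ((pderivs bs (\<lambda>\<xi>. \<omega> \<xi> \<epsilon>' $ i) \<xi> + (-1) * pderivs bs ?d \<xi>)
              + (if bs = [] then - \<omega>20 $ i else 0))"]
            conjI jet_add J1 jet_cmult J2 jet_const)
          (simp add: pderivs_def omega_tilde col_def)
    qed
  qed
  then obtain W where W: "\<And>i. jet \<alpha> P (W i)" "\<And>i \<xi>. \<xi> \<in> P \<Longrightarrow> W i [] \<xi> = \<omega>_tilde \<xi> $ i"
    by metis

  \<comment> \<open>The first block is set to 0: its eigenvalues carry the factor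
    \<open>\<epsilon> powr (q 1 - q 5)\<close> and are counted as error.\<close>
  have "\<exists>J. jet \<alpha> P J \<and> (j \<notin> N11 \<longrightarrow> (\<forall>\<xi>\<in>P. J [] \<xi> = Im (\<Lambda> \<xi> 0 $ j))) \<and>
      (j \<in> N11 \<longrightarrow> J = (\<lambda>bs \<xi>. 0)) \<and> (\<forall>bs\<in>multi_indices {..\<alpha>}. \<forall>\<xi>\<in>P. \<bar>J bs \<xi>\<bar> \<le> 2 * c1)" for j
  proof (cases "j \<in> N11")
    case True
    then show ?thesis using pos_constants by (intro exI[of _ "\<lambda>bs \<xi>. 0"]) (simp add: jet_zero)
  next
    case False
    have "jet_bound \<alpha> P P (\<lambda>\<xi>. Im (\<Lambda> \<xi> \<epsilon>' $ j)) c1"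
      using H2_bounds \<epsilon>' by (intro jet_bound_Im) auto
    moreover have "jet_bound \<alpha> P P (\<lambda>\<xi>. (-1) * Im (\<Lambda> \<xi> \<epsilon>' $ j - \<Lambda> \<xi> 0 $ j)) (\<bar>-1\<bar> * c1)"
      using near'(3) False by (intro jet_bound_cmult jet_bound_Im) auto
    ultimately have "jet_bound \<alpha> P P (\<lambda>\<xi>. Im (\<Lambda> \<xi> \<epsilon>' $ j) + (-1) * Im (\<Lambda> \<xi> \<epsilon>' $ j - \<Lambda> \<xi> 0 $ j)) (c1 + \<bar>-1\<bar> * c1)"
      by (rule jet_bound_add)
    then have "\<exists>J. jet \<alpha> P J \<and> (\<forall>bs\<in>multi_indices {..\<alpha>}. \<forall>\<xi>\<in>P. \<bar>J bs \<xi>\<bar> \<le> 2 * c1) \<and>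
        (\<forall>\<xi>\<in>P. J [] \<xi> = Im (\<Lambda> \<xi> 0 $ j))"
      by (simp add: jet_bound_def)
    then show ?thesis using False by blast
  qed
  then obtain L where L: "\<And>j. jet \<alpha> P (L j)" "\<And>j \<xi>. j \<notin> N11 \<Longrightarrow> \<xi> \<in> P \<Longrightarrow> L j [] \<xi> = Im (\<Lambda> \<xi> 0 $ j)"
      "\<And>j bs \<xi>. j \<in> N11 \<Longrightarrow> L j bs \<xi> = 0"
      "\<And>j bs \<xi>. bs \<in> multi_indices {..\<alpha>} \<Longrightarrow> \<xi> \<in> P \<Longrightarrow> \<bar>L j bs \<xi>\<bar> \<le> 2 * c1"
    by metis

  obtain c3 where "0 < c3" and c3: "\<forall>\<^sub>F \<epsilon> in at_right 0. \<forall>\<xi>\<in>P. \<forall>k m.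
        0 < norm (real_vec k) \<and> norm (real_vec k) < K_star \<and>
        (\<forall>j\<in>N11. m $ j = 0) \<and> 1 \<le> one_norm m \<and> one_norm m \<le> 2 \<and> (\<Sum>j\<in>UNIV. m $ j) \<in> {0, -1} \<longrightarrow>
        c3 * \<epsilon> powr q 5 \<le>
          Max ((\<lambda>\<mu>. differential_norm \<mu> (f_km q N11 \<omega>_tilde0 \<omega>_tilde (\<lambda>\<xi>. \<Lambda> \<xi> 0) \<epsilon> k m) \<xi>) ` {1..\<alpha>})"
    using ii' by blast
  define d where "d = min (c2 / 4) (c3 / (2 * K_star))"
  have "0 < d"
    using \<open>0 < c3\<close> c2(1) pos_constants by (simp add: d_def K_star)

  \<comment> \<open>2 bounds all coefficients: the entries of k / |k| are at most 1, those of m at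
    most 2.\<close>
  have "(0::real) \<le> 2" by simp
  obtain C \<eta> where "0 \<le> C" "0 < \<eta>" and sublevel:
    "\<And>z b e R \<delta>. \<lbrakk>\<And>i. \<bar>b i\<bar> \<le> 2; \<And>j. \<bar>e j\<bar> \<le> 2;
       \<And>x. x \<in> P \<Longrightarrow> \<exists>\<mu>\<le>\<alpha>. \<exists>a. norm a = 1 \<and> d \<le> \<bar>jet_diff \<mu>
         (\<lambda>bs x. (if bs = [] then z else 0) + (\<Sum>i\<in>UNIV. b i * W i bs x) + (\<Sum>j\<in>UNIV. e j * L j bs x)) x a\<bar>;
       jet \<alpha> P R; \<And>bs x. bs \<in> multi_indices {..\<alpha>} \<Longrightarrow> x \<in> P \<Longrightarrow> \<bar>R bs x\<bar> \<le> \<eta>;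
       0 < \<delta>; \<delta> \<le> d / 4\<rbrakk> \<Longrightarrow>
     {x \<in> P. \<bar>z + (\<Sum>i\<in>UNIV. b i * W i [] x) + (\<Sum>j\<in>UNIV. e j * L j [] x) + R [] x\<bar> < \<delta>} \<in> lmeasurable \<and>
     measure lebesgue {x \<in> P. \<bar>z + (\<Sum>i\<in>UNIV. b i * W i [] x) + (\<Sum>j\<in>UNIV. e j * L j [] x) + R [] x\<bar> < \<delta>}
       \<le> C * \<delta> powr (1 / \<alpha>)"
  proof (rule measure_jet_family_sublevel[where V = W and U = L, OF Pi(1,2,3) \<open>0 < \<alpha>\<close> \<open>0 < d\<close> \<open>(0::real) \<le> 2\<close> W(1) L(1)], goal_cases)
    case (1 C \<eta>)
    show ?thesis
    proof (rule that[of C \<eta>], goal_cases)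
      case (3 z b e R \<delta>)
      from 1(4)[OF this] show ?case .
    qed fact+
  qed

  \<comment> \<open>Each component has two sources of error, distance to the limit and drift of the
    iterates; \<open>\<eta>c\<close> then adds up the components, and the total is
    \<open>\<eta>\<close>.\<close>
  define \<eta>1 where "\<eta>1 = \<eta> / (2 * \<eta>c)"
  have "0 < \<eta>1" using \<open>0 < \<eta>\<close> \<open>0 < \<eta>c\<close> by (simp add: \<eta>1_def)
  have small_powr: "\<forall>\<^sub>F \<epsilon> in at_right 0. C' * \<epsilon> powr p \<le> \<eta>1" if "0 < p" for C' p :: real
  proof -
    have "((\<lambda>\<epsilon>. C' * \<epsilon> powr p) \<longlongrightarrow> C' * 0 powr p) (at_right 0)"
      using that by (intro tendsto_mult tendsto_const tendsto_powr' tendsto_ident_at)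
        (auto simp: eventually_at_filter)
    then have "\<forall>\<^sub>F \<epsilon> in at_right 0. C' * \<epsilon> powr p < \<eta>1"
      using \<open>0 < \<eta>1\<close> by (intro order_tendstoD(2)) auto
    then show ?thesis by eventually_elim simp
  qed
  \<comment> \<open>By (H1), \<open>q 2\<close> is at most \<open>q 4\<close>, \<open>q 6\<close>
    and \<open>q 7 - q 5\<close>, so its power controls every drift except that of the first
    eigenvalue block. The latter is handled, together with the block itself, by the positive
    exponent \<open>q 1 - q 5\<close>.\<close>
  have "\<forall>\<^sub>F \<epsilon> in at_right 0. \<epsilon> \<in> {0<..<min 1 \<epsilon>_star} \<and>
      ((\<forall>i\<in>N21. Ck_norm_le \<alpha> P (\<lambda>\<xi>. \<omega> \<xi> \<epsilon> $ i - \<omega> \<xi> 0 $ i) \<eta>1) \<and>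
      (\<forall>i\<in>- N21. Ck_norm_le \<alpha> P (\<lambda>\<xi>. \<omega> \<xi> \<epsilon> $ i - (\<omega>20 $ i + \<epsilon> powr q 5 * \<omega>21 \<xi> $ i)) (\<eta>1 * \<epsilon> powr q 5)) \<and>
      (\<forall>j\<in>- N11. Ck_norm_le \<alpha> P (\<lambda>\<xi>. \<Lambda> \<xi> \<epsilon> $ j - \<Lambda> \<xi> 0 $ j) \<eta>1)) \<and>
      \<bar>c\<bar> * \<epsilon> powr q 2 \<le> \<eta>1 \<and> (\<bar>c\<bar> + c1) * \<epsilon> powr (q 1 - q 5) \<le> \<eta>1 \<and>
      (\<forall>\<xi>\<in>P. \<forall>k m.
        0 < norm (real_vec k) \<and> norm (real_vec k) < K_star \<and>
        (\<forall>j\<in>N11. m $ j = 0) \<and> 1 \<le> one_norm m \<and> one_norm m \<le> 2 \<and> (\<Sum>j\<in>UNIV. m $ j) \<in> {0, -1} \<longrightarrow>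
        c3 * \<epsilon> powr q 5 \<le>
          Max ((\<lambda>\<mu>. differential_norm \<mu> (f_km q N11 \<omega>_tilde0 \<omega>_tilde (\<lambda>\<xi>. \<Lambda> \<xi> 0) \<epsilon> k m) \<xi>) ` {1..\<alpha>}))"
    using q by (intro eventually_conj pos_eps freq_near[OF \<open>0 < \<eta>1\<close>] small_powr c3) auto
  then obtain \<epsilon>1 where "0 < \<epsilon>1" and small: "\<And>\<epsilon>. 0 < \<epsilon> \<Longrightarrow> \<epsilon> < \<epsilon>1 \<Longrightarrow> \<epsilon> \<in> {0<..<min 1 \<epsilon>_star} \<and>
      ((\<forall>i\<in>N21. Ck_norm_le \<alpha> P (\<lambda>\<xi>. \<omega> \<xi> \<epsilon> $ i - \<omega> \<xi> 0 $ i) \<eta>1) \<and>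
      (\<forall>i\<in>- N21. Ck_norm_le \<alpha> P (\<lambda>\<xi>. \<omega> \<xi> \<epsilon> $ i - (\<omega>20 $ i + \<epsilon> powr q 5 * \<omega>21 \<xi> $ i)) (\<eta>1 * \<epsilon> powr q 5)) \<and>
      (\<forall>j\<in>- N11. Ck_norm_le \<alpha> P (\<lambda>\<xi>. \<Lambda> \<xi> \<epsilon> $ j - \<Lambda> \<xi> 0 $ j) \<eta>1)) \<and>
      \<bar>c\<bar> * \<epsilon> powr q 2 \<le> \<eta>1 \<and> (\<bar>c\<bar> + c1) * \<epsilon> powr (q 1 - q 5) \<le> \<eta>1 \<and>
      (\<forall>\<xi>\<in>P. \<forall>k m.
        0 < norm (real_vec k) \<and> norm (real_vec k) < K_star \<and>
        (\<forall>j\<in>N11. m $ j = 0) \<and> 1 \<le> one_norm m \<and> one_norm m \<le> 2 \<and> (\<Sum>j\<in>UNIV. m $ j) \<in> {0, -1} \<longrightarrow>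
        c3 * \<epsilon> powr q 5 \<le>
          Max ((\<lambda>\<mu>. differential_norm \<mu> (f_km q N11 \<omega>_tilde0 \<omega>_tilde (\<lambda>\<xi>. \<Lambda> \<xi> 0) \<epsilon> k m) \<xi>) ` {1..\<alpha>}))"
    unfolding eventually_at_right_field by blast

  obtain \<gamma>1 where "0 < \<gamma>1" and eps_small: "\<And>\<gamma>. 0 < \<gamma> \<Longrightarrow> \<gamma> < \<gamma>1 \<Longrightarrow> \<epsilon>0 \<gamma> < \<epsilon>1"
  proof -
    have "\<forall>\<^sub>F \<gamma> in at_right 0. norm (\<epsilon>0 \<gamma>) \<le> 1 * norm (\<gamma> powr ((real \<alpha> + 1) / q 2))"
      using eps0(3) by (rule landau_o.smallD) simp
    moreover have "((\<lambda>\<gamma>. \<gamma> powr ((real \<alpha> + 1) / q 2)) \<longlongrightarrow> 0 powr ((real \<alpha> + 1) / q 2)) (at_right 0)"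
      using q by (intro tendsto_powr' tendsto_ident_at tendsto_const) (auto simp: eventually_at_filter)
    then have "\<forall>\<^sub>F \<gamma> in at_right 0. \<gamma> powr ((real \<alpha> + 1) / q 2) < \<epsilon>1"
      using \<open>0 < \<epsilon>1\<close> by (intro order_tendstoD(2)) auto
    ultimately have "\<forall>\<^sub>F \<gamma> in at_right 0. \<epsilon>0 \<gamma> < \<epsilon>1"
      by eventually_elim simp
    then show ?thesis
      unfolding eventually_at_right_field using that by blast
  qed

  \<comment> \<open>The exponent left of |k|^(-\<iota>-1) after the \<alpha>-th root; the lower
    bound on \<iota> in (H3) says precisely that it exceeds the number of angles.\<close>
  define s where "s = (\<iota> + 1) / real \<alpha>"
  have "real CARD('n2) < s"
    using H3_exponents(2) pos_constants by (simp add: s_def field_simps)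
  then obtain S where "0 \<le> S"
    and S: "\<And>F. finite F \<Longrightarrow> 0 \<notin> F \<Longrightarrow> (\<Sum>k\<in>F. norm (real_vec (k :: int ^ 'n2)) powr (- s)) \<le> S"
    using sum_lattice_powr_bounded by blast

  have "0 \<le> \<iota>"
  proof -
    have "1 \<le> real \<alpha> * real CARD('n2)" using pos_constants by (simp flip: of_nat_mult add: Suc_le_eq)
    then show ?thesis using H3_exponents(2) by linarith
  qed
  have "real \<alpha> \<le> l"
  proof -
    have "real \<alpha> * 1 \<le> 2 * (real \<alpha> + 1) * (\<iota> + 2)"
      using \<open>0 \<le> \<iota>\<close> by (intro mult_mono) auto
    moreover have "0 \<le> real \<alpha> * \<iota>" using \<open>0 \<le> \<iota>\<close> by simp
    ultimately show ?thesis using H3_exponents(1) by linarith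
  qed
  then have K_mono: "mono (K_cut r l \<alpha> CARD('n2))"
    using Omega(5) by (intro mono_K_cut) (auto simp: is_radius_def)

  \<comment> \<open>The entry 1 turns the loss O(\<gamma>) of the initial set into
    O(\<gamma>^(1/\<alpha>)), \<open>d / 4\<close> keeps all thresholds in the range of
    \<open>sublevel\<close>, and halving \<open>\<gamma>1\<close> gives a strict inequality.\<close>
  define \<gamma>0 where "\<gamma>0 = min (min \<gamma>_star 1) (min (d / 4) (\<gamma>1 / 2))"
  have "0 < \<gamma>0" "\<gamma>0 \<le> \<gamma>_star"
    using eps0(1) \<open>0 < d\<close> \<open>0 < \<gamma>1\<close> by (auto simp: \<gamma>0_def)
  define CC where "CC = \<bar>c\<bar> + real (card (modes :: (int ^ 'n1) set)) * C * S + 1"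
  have "0 < CC" using \<open>0 \<le> C\<close> \<open>0 \<le> S\<close> by (simp add: CC_def add_nonneg_pos)
  show ?thesis
  proof (rule exI[of _ CC], rule conjI, fact, rule exI[of _ \<gamma>0], intro conjI ballI)
    fix \<gamma> \<epsilon> assume "\<gamma> \<in> {0<..\<gamma>0}" "\<epsilon> \<in> {0<..\<epsilon>0 \<gamma>}"
    then have \<gamma>: "\<gamma> \<in> {0<..\<gamma>_star}" "0 < \<gamma>" "\<gamma> \<le> 1" "\<gamma> \<le> d / 4" "\<gamma> < \<gamma>1"
      and \<epsilon>: "\<epsilon> \<in> {0<..\<epsilon>0 \<gamma>}" "0 < \<epsilon>" "\<epsilon> < \<epsilon>1"
      using \<open>0 < \<gamma>1\<close> eps_small[of \<gamma>] by (auto simp: \<gamma>0_def)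
    note sm = small[OF \<epsilon>(2,3)]
    have \<epsilon>_star: "\<epsilon> \<in> {0<..\<epsilon>_star}" and "\<epsilon> \<le> 1" using sm by auto
    note closed_sets' = bspec[OF bspec[OF closed_sets \<gamma>(1)] \<epsilon>(1)]
    note removal' = bspec[OF bspec[OF removal \<gamma>(1)] \<epsilon>(1)]
    note iterates' = bspec[OF bspec[OF iterates \<gamma>(1)] \<epsilon>(1)]
    note initial' = bspec[OF bspec[OF initial_data \<gamma>(1)] \<epsilon>(1)]
    let ?e = "\<epsilon> powr q 5"
    have "0 < ?e" using \<epsilon> by simp
    have sub: "P\<nu> \<gamma> \<epsilon> \<nu> \<subseteq> P" for \<nu> using closed_sets' by blast
    have powr_le: "\<epsilon> powr p \<le> \<epsilon> powr q 2" if "q 2 \<le> p" for p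
      using that \<epsilon> \<open>\<epsilon> \<le> 1\<close> by (intro powr_mono') auto
    have c_powr: "\<bar>c\<bar> * \<epsilon> powr p \<le> \<eta>1" if "q 2 \<le> p" for p
      using mult_left_mono[OF powr_le[OF that], of "\<bar>c\<bar>"] sm by linarith
    have c_le: "c * x \<le> \<bar>c\<bar> * x" if "0 \<le> x" for x
      using that by (intro mult_right_mono) auto

    \<comment> \<open>The part that is large for small \<epsilon>; it goes into the free constant of
      \<open>sublevel\<close>.\<close>
    define y where "y i = (if i \<in> N21 then 0 else \<omega>20 $ i / ?e)" for i
    \<comment> \<open>The estimates on the iterates start at \<nu> = 1; at \<nu> = 0 the drift is 0.
      The absolute value is taken because no sign of \<open>c\<close> is prescribed.\<close>
    have drift_w: "jet_bound \<alpha> P (P\<nu> \<gamma> \<epsilon> \<nu>) (\<lambda>\<xi>. \<omega>\<nu> \<gamma> \<epsilon> \<nu> \<xi> $ i - \<omega> \<xi> \<epsilon> $ i)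
        (\<bar>c\<bar> * \<epsilon> powr (if i \<in> N21 then q 6 else q 7))" for \<nu> i
    proof (cases "\<nu> = 0")
      case True
      then show ?thesis using initial' by (simp add: jet_bound_zero)
    next
      case False
      then have "Ck_norm_le_closed \<alpha> P (P\<nu> \<gamma> \<epsilon> \<nu>) (\<lambda>\<xi>. \<omega>\<nu> \<gamma> \<epsilon> \<nu> \<xi> $ i - \<omega> \<xi> \<epsilon> $ i)
          (c * \<epsilon> powr (if i \<in> N21 then q 6 else q 7))"
        using iterates' by auto
      from jet_bound_closed_real[OF this sub] show ?thesis
        by (rule jet_bound_mono) (simp add: c_le)
    qed
    have drift_lam: "jet_bound \<alpha> P (P\<nu> \<gamma> \<epsilon> \<nu>) (\<lambda>\<xi>. Im (\<Lambda>\<nu> \<gamma> \<epsilon> \<nu> \<xi> $ j - \<Lambda> \<xi> \<epsilon> $ j))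
        (\<bar>c\<bar> * \<epsilon> powr (if j \<in> N11 then q 2 else q 4))" for \<nu> j
    proof (cases "\<nu> = 0")
      case True
      then show ?thesis using initial' by (simp add: jet_bound_zero)
    next
      case False
      then have "Ck_norm_le_closed \<alpha> P (P\<nu> \<gamma> \<epsilon> \<nu>) (\<lambda>\<xi>. \<Lambda>\<nu> \<gamma> \<epsilon> \<nu> \<xi> $ j - \<Lambda> \<xi> \<epsilon> $ j)
          (c * \<epsilon> powr (if j \<in> N11 then q 2 else q 4))"
        using iterates' by auto
      from jet_bound_closed_Im[OF this sub] show ?thesis
        by (rule jet_bound_mono) (simp add: c_le)
    qed
    have near_w: "jet_bound \<alpha> P (P\<nu> \<gamma> \<epsilon> \<nu>) (\<lambda>\<xi>. block_scale N21 ?e 1 (\<omega>\<nu> \<gamma> \<epsilon> \<nu> \<xi>) $ i / ?e - (y i + W i [] \<xi>)) (2 * \<eta>1)" for \<nu> i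
    proof (cases "i \<in> N21")
      case True
      have "jet_bound \<alpha> P (P\<nu> \<gamma> \<epsilon> \<nu>) (\<lambda>\<xi>. \<omega> \<xi> \<epsilon> $ i - \<omega> \<xi> 0 $ i) \<eta>1"
        using sm True sub by (intro jet_bound_real) auto
      from jet_bound_add[OF drift_w[of \<nu> i] this]
      have "jet_bound \<alpha> P (P\<nu> \<gamma> \<epsilon> \<nu>) (\<lambda>\<xi>. (\<omega>\<nu> \<gamma> \<epsilon> \<nu> \<xi> $ i - \<omega> \<xi> \<epsilon> $ i) + (\<omega> \<xi> \<epsilon> $ i - \<omega> \<xi> 0 $ i)) (2 * \<eta>1)"
        by (rule jet_bound_mono) (use True c_powr[of "q 6"] q in simp)
      then show ?thesis
      proof (rule jet_bound_cong)
        fix \<xi> assume "\<xi> \<in> P\<nu> \<gamma> \<epsilon> \<nu>"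
        then show "\<omega>\<nu> \<gamma> \<epsilon> \<nu> \<xi> $ i - \<omega> \<xi> \<epsilon> $ i + (\<omega> \<xi> \<epsilon> $ i - \<omega> \<xi> 0 $ i) =
            block_scale N21 ?e 1 (\<omega>\<nu> \<gamma> \<epsilon> \<nu> \<xi>) $ i / ?e - (y i + W i [] \<xi>)"
          using True \<open>0 < ?e\<close> sub[of \<nu>]
          by (simp add: subset_iff W(2) omega_tilde y_def col_def block_scale_def)
      qed
    next
      case False
      have "jet_bound \<alpha> P (P\<nu> \<gamma> \<epsilon> \<nu>) (\<lambda>\<xi>. \<omega> \<xi> \<epsilon> $ i - (\<omega>20 $ i + ?e * \<omega>21 \<xi> $ i)) (\<eta>1 * ?e)"
        using sm False sub by (intro jet_bound_real) auto
      from jet_bound_cmult[OF jet_bound_add[OF drift_w[of \<nu> i] this], of "1 / ?e"]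
      have "jet_bound \<alpha> P (P\<nu> \<gamma> \<epsilon> \<nu>) (\<lambda>\<xi>. (1 / ?e) * ((\<omega>\<nu> \<gamma> \<epsilon> \<nu> \<xi> $ i - \<omega> \<xi> \<epsilon> $ i)
          + (\<omega> \<xi> \<epsilon> $ i - (\<omega>20 $ i + ?e * \<omega>21 \<xi> $ i)))) (2 * \<eta>1)"
      proof (rule jet_bound_mono)
        \<comment> \<open>The second block has no factor \<open>\<epsilon> powr q 5\<close> of its
          own, so the normalisation costs one; \<open>q 7 \<ge> q 2 + q 5\<close> pays for
          it.\<close>
        have "\<bar>c\<bar> * \<epsilon> powr q 7 / ?e = \<bar>c\<bar> * \<epsilon> powr (q 7 - q 5)"
          by (simp add: powr_diff)
        also have "\<dots> \<le> \<eta>1" using q by (intro c_powr) simp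
        finally show "\<bar>1 / ?e\<bar> * (\<bar>c\<bar> * \<epsilon> powr (if i \<in> N21 then q 6 else q 7) + \<eta>1 * ?e) \<le> 2 * \<eta>1"
          using False \<open>0 < ?e\<close> by (simp add: distrib_left add_divide_distrib)
      qed
      then show ?thesis
      proof (rule jet_bound_cong)
        fix \<xi> assume "\<xi> \<in> P\<nu> \<gamma> \<epsilon> \<nu>"
        then show "(1 / ?e) * (\<omega>\<nu> \<gamma> \<epsilon> \<nu> \<xi> $ i - \<omega> \<xi> \<epsilon> $ i + (\<omega> \<xi> \<epsilon> $ i - (\<omega>20 $ i + ?e * \<omega>21 \<xi> $ i))) =
            block_scale N21 ?e 1 (\<omega>\<nu> \<gamma> \<epsilon> \<nu> \<xi>) $ i / ?e - (y i + W i [] \<xi>)"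
          using False \<open>0 < ?e\<close> sub[of \<nu>]
          by (simp add: subset_iff W(2) omega_tilde y_def col_def block_scale_def diff_divide_distrib add_divide_distrib)
      qed
    qed
    let ?\<theta> = "\<epsilon> powr (q 3 - q 5)"
    have near_lam: "jet_bound \<alpha> P (P\<nu> \<gamma> \<epsilon> \<nu>)
        (\<lambda>\<xi>. Im (block_scale N11 (\<epsilon> powr q 1) (\<epsilon> powr q 3) (\<Lambda>\<nu> \<gamma> \<epsilon> \<nu> \<xi>) $ j) / ?e - ?\<theta> * L j [] \<xi>) (2 * \<eta>1)" for \<nu> j
    proof (cases "j \<in> N11")
      case True
      have "jet_bound \<alpha> P (P\<nu> \<gamma> \<epsilon> \<nu>) (\<lambda>\<xi>. Im (\<Lambda> \<xi> \<epsilon> $ j)) c1"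
        using H2_bounds \<epsilon>_star sub by (intro jet_bound_Im) auto
      from jet_bound_cmult[OF jet_bound_add[OF drift_lam[of \<nu> j] this], of "\<epsilon> powr (q 1 - q 5)"]
      have "jet_bound \<alpha> P (P\<nu> \<gamma> \<epsilon> \<nu>)
          (\<lambda>\<xi>. \<epsilon> powr (q 1 - q 5) * (Im (\<Lambda>\<nu> \<gamma> \<epsilon> \<nu> \<xi> $ j - \<Lambda> \<xi> \<epsilon> $ j) + Im (\<Lambda> \<xi> \<epsilon> $ j))) (2 * \<eta>1)"
      proof (rule jet_bound_mono)
        have "\<epsilon> powr q 2 \<le> 1" using \<epsilon> \<open>\<epsilon> \<le> 1\<close> q by (intro powr_le1) auto
        then have "\<epsilon> powr (q 1 - q 5) * (\<bar>c\<bar> * \<epsilon> powr q 2 + c1) \<le> \<epsilon> powr (q 1 - q 5) * (\<bar>c\<bar> + c1)"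
          by (intro mult_left_mono add_right_mono) (auto simp: mult_left_le)
        also have "\<dots> \<le> \<eta>1" using sm by (simp add: mult.commute)
        finally show "\<bar>\<epsilon> powr (q 1 - q 5)\<bar> * (\<bar>c\<bar> * \<epsilon> powr (if j \<in> N11 then q 2 else q 4) + c1) \<le> 2 * \<eta>1"
          using True \<open>0 < \<eta>1\<close> by simp
      qed
      then show ?thesis
        by (rule jet_bound_cong) (use True in \<open>simp add: L(3) block_scale_def col_def powr_diff\<close>)
    next
      case False
      have "jet_bound \<alpha> P (P\<nu> \<gamma> \<epsilon> \<nu>) (\<lambda>\<xi>. Im (\<Lambda> \<xi> \<epsilon> $ j - \<Lambda> \<xi> 0 $ j)) \<eta>1"
        using sm False sub by (intro jet_bound_Im) auto
      from jet_bound_cmult[OF jet_bound_add[OF drift_lam[of \<nu> j] this], of ?\<theta>]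
      have "jet_bound \<alpha> P (P\<nu> \<gamma> \<epsilon> \<nu>)
          (\<lambda>\<xi>. ?\<theta> * (Im (\<Lambda>\<nu> \<gamma> \<epsilon> \<nu> \<xi> $ j - \<Lambda> \<xi> \<epsilon> $ j) + Im (\<Lambda> \<xi> \<epsilon> $ j - \<Lambda> \<xi> 0 $ j))) (2 * \<eta>1)"
      proof (rule jet_bound_mono)
        have "?\<theta> \<le> 1" using \<epsilon> \<open>\<epsilon> \<le> 1\<close> q by (intro powr_le1) auto
        moreover have "\<bar>c\<bar> * \<epsilon> powr q 4 + \<eta>1 \<le> 2 * \<eta>1" using c_powr[of "q 4"] q by simp
        ultimately have "?\<theta> * (\<bar>c\<bar> * \<epsilon> powr q 4 + \<eta>1) \<le> 1 * (2 * \<eta>1)"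
          using \<open>0 < \<eta>1\<close> by (intro mult_mono) auto
        then show "\<bar>?\<theta>\<bar> * (\<bar>c\<bar> * \<epsilon> powr (if j \<in> N11 then q 2 else q 4) + \<eta>1) \<le> 2 * \<eta>1"
          using False by simp
      qed
      then show ?thesis
      proof (rule jet_bound_cong)
        fix \<xi> assume "\<xi> \<in> P\<nu> \<gamma> \<epsilon> \<nu>"
        then have "L j [] \<xi> = Im (\<Lambda> \<xi> 0 $ j)" using sub[of \<nu>] False by (intro L(2)) auto
        then show "?\<theta> * (Im (\<Lambda>\<nu> \<gamma> \<epsilon> \<nu> \<xi> $ j - \<Lambda> \<xi> \<epsilon> $ j) + Im (\<Lambda> \<xi> \<epsilon> $ j - \<Lambda> \<xi> 0 $ j)) =
            Im (block_scale N11 (\<epsilon> powr q 1) (\<epsilon> powr q 3) (\<Lambda>\<nu> \<gamma> \<epsilon> \<nu> \<xi>) $ j) / ?e - ?\<theta> * L j [] \<xi>"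
          using False by (simp add: block_scale_def col_def powr_diff algebra_simps)
      qed
    qed

    let ?zone = "\<lambda>\<nu> k m. resonance_zone (P\<nu> \<gamma> \<epsilon> \<nu>)
               (\<lambda>\<xi>. block_scale N21 ?e 1 (\<omega>\<nu> \<gamma> \<epsilon> \<nu> \<xi>))
               (\<lambda>\<xi>. block_scale N11 (\<epsilon> powr q 1) (\<epsilon> powr q 3) (\<Lambda>\<nu> \<gamma> \<epsilon> \<nu> \<xi>))
               k m (\<gamma> * ?e * norm (real_vec k) powr (- \<iota>))"
    define D where "D = C * \<gamma> powr (1 / real \<alpha>)"
    have "0 \<le> D" using \<open>0 \<le> C\<close> by (simp add: D_def)
    have ex: "\<exists>Y. ?zone \<nu> k m \<subseteq> Y \<and> Y \<in> lmeasurable \<and> measure lebesgue Y \<le> D * norm (real_vec k) powr (- s)"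
      if k: "k \<noteq> 0" and m: "m \<in> modes" for \<nu> k m
    proof -
      define \<kappa> where "\<kappa> = norm (real_vec k)"
      have \<kappa>: "1 \<le> \<kappa>" using norm_real_vec_ge_1[OF k] by (simp add: \<kappa>_def)
      let ?b = "\<lambda>i. real_of_int (k $ i) / \<kappa>"
      let ?d = "\<lambda>j. ?\<theta> * real_of_int (m $ j) / \<kappa>"
      let ?z = "\<Sum>i\<in>UNIV. ?b i * y i"
      let ?f = "\<lambda>\<xi>. Im (small_divisor k m (block_scale N21 ?e 1 (\<omega>\<nu> \<gamma> \<epsilon> \<nu> \<xi>))
          (block_scale N11 (\<epsilon> powr q 1) (\<epsilon> powr q 3) (\<Lambda>\<nu> \<gamma> \<epsilon> \<nu> \<xi>))) / (?e * \<kappa>)"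
      \<comment> \<open>The zone's threshold divided by \<open>?e * \<kappa>\<close>; the
        normalisation by |k| contributes the additional power -1.\<close>
      define \<delta> where "\<delta> = \<gamma> * \<kappa> powr (- \<iota> - 1)"
      have "\<kappa> powr (- \<iota> - 1) \<le> 1"
        using \<kappa> \<open>0 \<le> \<iota>\<close> powr_mono[of "- \<iota> - 1" 0 \<kappa>] by simp
      then have "\<delta> \<le> \<gamma>" using \<gamma> by (simp add: \<delta>_def mult_left_le)
      have "0 < \<delta>" using \<gamma> \<kappa> by (simp add: \<delta>_def)
      have "jet_bound \<alpha> P (P\<nu> \<gamma> \<epsilon> \<nu>)
        (\<lambda>\<xi>. ?f \<xi> - (?z + (\<Sum>i\<in>UNIV. ?b i * W i [] \<xi>) + (\<Sum>j\<in>UNIV. ?d j * L j [] \<xi>))) (\<eta>c * (2 * \<eta>1))"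
        unfolding \<kappa>_def \<eta>c_def
        by (rule small_divisor_approx[OF near_w near_lam \<open>0 < ?e\<close> _ k m]) (use \<open>0 < \<eta>1\<close> in simp)
      moreover have "\<eta>c * (2 * \<eta>1) = \<eta>" using \<open>0 < \<eta>c\<close> by (simp add: \<eta>1_def)
      \<comment> \<open>\<open>R\<close> extends the error from the closed set to all of
        \<open>P\<close>. Adding it back to the fixed combination gives a function on
        \<open>P\<close> that equals the normalised imaginary part on the closed set.\<close>
      ultimately obtain R where R: "jet \<alpha> P R" "\<And>bs x. bs \<in> multi_indices {..\<alpha>} \<Longrightarrow> x \<in> P \<Longrightarrow> \<bar>R bs x\<bar> \<le> \<eta>"
        "\<And>\<xi>. \<xi> \<in> P\<nu> \<gamma> \<epsilon> \<nu> \<Longrightarrow> R [] \<xi> = ?f \<xi> - (?z + (\<Sum>i\<in>UNIV. ?b i * W i [] \<xi>) + (\<Sum>j\<in>UNIV. ?d j * L j [] \<xi>))"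
        unfolding jet_bound_def by auto
      define Y where "Y = {x \<in> P. \<bar>?z + (\<Sum>i\<in>UNIV. ?b i * W i [] x) + (\<Sum>j\<in>UNIV. ?d j * L j [] x) + R [] x\<bar> < \<delta>}"
      have "?zone \<nu> k m \<subseteq> Y"
      proof
        fix \<xi> assume "\<xi> \<in> ?zone \<nu> k m"
        then have \<xi>: "\<xi> \<in> P\<nu> \<gamma> \<epsilon> \<nu>"
          and "cmod (small_divisor k m (block_scale N21 ?e 1 (\<omega>\<nu> \<gamma> \<epsilon> \<nu> \<xi>))
          (block_scale N11 (\<epsilon> powr q 1) (\<epsilon> powr q 3) (\<Lambda>\<nu> \<gamma> \<epsilon> \<nu> \<xi>))) < \<gamma> * ?e * \<kappa> powr (- \<iota>)"
          by (auto simp: resonance_zone_def \<kappa>_def)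
        then have "\<bar>Im (small_divisor k m (block_scale N21 ?e 1 (\<omega>\<nu> \<gamma> \<epsilon> \<nu> \<xi>))
          (block_scale N11 (\<epsilon> powr q 1) (\<epsilon> powr q 3) (\<Lambda>\<nu> \<gamma> \<epsilon> \<nu> \<xi>)))\<bar> < \<gamma> * ?e * \<kappa> powr (- \<iota>)"
          by (rule_tac order_le_less_trans[OF abs_Im_le_cmod])
        moreover have "0 < ?e * \<kappa>" using \<open>0 < ?e\<close> \<kappa> by simp
        ultimately have "\<bar>?f \<xi>\<bar> < \<gamma> * ?e * \<kappa> powr (- \<iota>) / (?e * \<kappa>)"
          unfolding abs_divide by (simp only: abs_of_pos divide_strict_right_mono)
        also have "\<dots> = \<delta>"
          using \<open>0 < ?e\<close> \<kappa> by (simp add: \<delta>_def powr_diff)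
        finally show "\<xi> \<in> Y" using \<xi> sub[of \<nu>] by (auto simp: Y_def R(3))
      qed
      moreover have "Y \<in> lmeasurable \<and> measure lebesgue Y \<le> C * \<delta> powr (1 / \<alpha>)"
        unfolding Y_def
      proof (rule sublevel[OF _ _ _ R(1,2) \<open>0 < \<delta>\<close>])
        show "\<bar>?b i\<bar> \<le> 2" for i
        proof -
          have "\<bar>real_of_int (k $ i)\<bar> \<le> 2 * \<kappa>"
            using abs_le_norm_real_vec[of k i] \<kappa> unfolding \<kappa>_def by linarith
          then show ?thesis using \<kappa> by (simp add: field_simps)
        qed
        show "\<bar>?d j\<bar> \<le> 2" for j
        proof -
          have "?\<theta> \<le> 1" using \<epsilon> \<open>\<epsilon> \<le> 1\<close> q by (intro powr_le1) auto
          then have "?\<theta> * \<bar>real_of_int (m $ j)\<bar> \<le> 1 * 2"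
            using modes_abs_le[OF m, of j] by (intro mult_mono) auto
          then have "?\<theta> * \<bar>real_of_int (m $ j)\<bar> \<le> 2 * \<kappa>" using \<kappa> by linarith
          then show ?thesis using \<kappa> by (simp add: abs_mult field_simps)
        qed
        show "\<delta> \<le> d / 4" using \<open>\<delta> \<le> \<gamma>\<close> \<gamma> by linarith
        fix x assume "x \<in> P"
        have z: "?z = 0" if "- N21 = {}"
        proof -
          have "i \<in> N21" for i using that by auto
          then show ?thesis by (simp add: y_def)
        qed
        show "\<exists>\<mu>\<le>\<alpha>. \<exists>a. norm a = 1 \<and> d \<le> \<bar>jet_diff \<mu>
         (\<lambda>bs x. (if bs = [] then ?z else 0) + (\<Sum>i\<in>UNIV. ?b i * W i bs x) + (\<Sum>j\<in>UNIV. ?d j * L j bs x)) x a\<bar>"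
          unfolding d_def \<kappa>_def
          by (rule nondegeneracy_lower_bound[where ?N11.0 = N11 and ?N21.0 = N21 and w = \<omega>_tilde and Lam = "\<lambda>\<xi>. \<Lambda> \<xi> 0" and ?w0.0 = \<omega>_tilde0,
                OF Pi(1) \<open>0 < \<alpha>\<close> \<open>0 < c1\<close> c2(1) \<open>0 < c3\<close> W L c2(2) K_star _ \<epsilon>(2) \<open>\<epsilon> \<le> 1\<close> q(1) k m z[unfolded \<kappa>_def] \<open>x \<in> P\<close>])
            (use sm in blast)+
      qed
      moreover have "C * \<delta> powr (1 / \<alpha>) = D * norm (real_vec k) powr (- s)"
      proof -
        have "(- \<iota> - 1) * (1 / real \<alpha>) = - s" by (simp add: s_def diff_divide_distrib add_divide_distrib)
        then have "\<delta> powr (1 / \<alpha>) = \<gamma> powr (1 / \<alpha>) * \<kappa> powr (- s)"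
          using \<gamma> \<kappa> by (simp only: \<delta>_def powr_mult powr_powr)
        then show ?thesis by (simp add: D_def \<kappa>_def)
      qed
      ultimately show ?thesis by auto
    qed
    \<comment> \<open>One cover is chosen for every stage and every pair, as
      \<open>measure_Cantor_deficit\<close> expects.\<close>
    define Y where "Y = (\<lambda>\<nu> k m. SOME Y. ?zone \<nu> k m \<subseteq> Y \<and> Y \<in> lmeasurable \<and>
        measure lebesgue Y \<le> D * norm (real_vec k) powr (- s))"
    have Y: "?zone \<nu> k m \<subseteq> Y \<nu> k m" "Y \<nu> k m \<in> lmeasurable"
      "measure lebesgue (Y \<nu> k m) \<le> D * norm (real_vec k) powr (- s)"
      if "k \<noteq> 0" "m \<in> modes" for \<nu> k m
      using someI_ex[OF ex[OF that, of \<nu>]] unfolding Y_def by simp_all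
    have P\<gamma>: "P\<gamma> \<gamma> \<epsilon> = (\<Inter>\<nu>. P\<nu> \<gamma> \<epsilon> \<nu>)" using Cantor_set by blast
    have "closed (P\<gamma> \<gamma> \<epsilon>)" unfolding P\<gamma> using closed_sets' by blast
    then show leb: "P\<gamma> \<gamma> \<epsilon> \<in> sets lebesgue" by (simp add: borel_closed)
    have "measure lebesgue P - measure lebesgue (P\<gamma> \<gamma> \<epsilon>)
        \<le> measure lebesgue (P - P\<nu> \<gamma> \<epsilon> 0) + real (card (modes :: (int ^ 'n1) set)) * D * S"
      unfolding P\<gamma>
    proof (rule measure_Cantor_deficit[OF P_meas _ sub K_mono _ finite_modes _ Y \<open>0 \<le> D\<close> S])
      show "closed (P\<nu> \<gamma> \<epsilon> \<nu>)" for \<nu> using closed_sets' by blast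
      show "K_cut r l \<alpha> CARD('n2) 0 = 0" by (simp add: K_cut_def)
      show "P\<nu> \<gamma> \<epsilon> (Suc \<nu>) = P\<nu> \<gamma> \<epsilon> \<nu> -
          (\<Union>m\<in>modes. \<Union>k\<in>{k. K_cut r l \<alpha> CARD('n2) \<nu> < norm (real_vec k) \<and>
              norm (real_vec k) \<le> K_cut r l \<alpha> CARD('n2) (Suc \<nu>)}. ?zone \<nu> k m)" for \<nu>
        using removal' by (rule spec)
    qed
    moreover have "measure lebesgue (P - P\<nu> \<gamma> \<epsilon> 0) \<le> \<bar>c\<bar> * \<gamma> powr (1 / real \<alpha>)"
    proof -
      have "measure lebesgue (P - P\<nu> \<gamma> \<epsilon> 0) \<le> c * \<gamma>"
        using initial_set \<gamma>(1) \<epsilon>(1) by blast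
      also have "\<dots> \<le> \<bar>c\<bar> * \<gamma> powr (1 / real \<alpha>)"
        using \<gamma> pos_constants powr_mono'[of "1 / real \<alpha>" 1 \<gamma>] by (intro mult_mono) auto
      finally show ?thesis .
    qed
    moreover have "measure lebesgue (P\<gamma> \<gamma> \<epsilon>) \<le> measure lebesgue P"
      using P_meas leb sub unfolding P\<gamma> by (intro measure_mono_fmeasurable) auto
    ultimately have "\<bar>measure lebesgue (P\<gamma> \<gamma> \<epsilon>) - measure lebesgue P\<bar>
        \<le> (\<bar>c\<bar> + real (card (modes :: (int ^ 'n1) set)) * C * S) * \<gamma> powr (1 / real \<alpha>)"
      unfolding D_def by (simp add: algebra_simps)
    also have "\<dots> \<le> CC * \<gamma> powr (1 / real \<alpha>)"
      by (intro mult_right_mono) (simp_all add: CC_def)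
    finally show "\<bar>measure lebesgue (P\<gamma> \<gamma> \<epsilon>) - measure lebesgue P\<bar> \<le> CC * \<gamma> powr (1 / real \<alpha>)" .
  qed fact+
qed

end
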